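(* Let $R$ be an LG-ring, and let $S/R$ be a quadratic étale extension with standard involution $\sigma$. If $h_1$, $h_2$ and $h_3$ are $(S,\sigma)$-hermitian spaces, then $$h_1\perp h_3\cong h_2\perp h_3\implies h_1\cong h_2,$$ where $\cong$ denotes isometry.
   Context: A commutative ring $R$ is an LG-ring if for every $n$ and every $f\in R[X_1,\dots,X_n]$ the following holds: there exists $r\in R^n$ with $f(r)\in R^\times$ if and only if for every maximal ideal $\mathfrak{m}$ of $R$ there exists $x\in (R/\mathfrak{m})^n$ with $f(x)\neq 0$ in $R/\mathfrak{m}$. A quadratic étale extension $S/R$ is a commutative étale $R$-algebra whose underlying $R$-module is projective of rank 2; its standard involution $\sigma$ is the $R$-algebra involution given, when $S$ is free with basis $\{1,z\}$ and $z^2=az+b$, by $\sigma(z)=a-z$, and in general by Zariski descent. An $(S,\sigma)$-hermitian form is a pair $(M,h)$, often written $h$, where $M$ is a finitely generated projective $S$-module and $h:M\times M\to S$ is bi-additive with $h(m_1s_1,m_2s_2)=\sigma(s_1)h(m_1,m_2)s_2$ and $h(m,m')=\sigma(h(m',m))$. It is regular, and $(M,h)$ is then called a hermitian space, if the adjoint map $M\to M^*$, $m\mapsto h(m,-)$, is bijective, where $M^*$ is $\mathrm{Hom}_S(M,S)$ with $S$-action twisted by $\sigma$. An isometry $(M_1,h_1)\to(M_2,h_2)$ is an $S$-linear bijection $f$ with $h_2(f(m),f(m'))=h_1(m,m')$. The orthogonal sum $h_1\perp h_2$ is the form on $M_1\oplus M_2$ given by $(m_1+m_2,m_1'+m_2')\mapsto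 h_1(m_1,m_1')+h_2(m_2,m_2')$. *)

theory Defs
  imports "HOL-Algebra.Algebra"
begin

section \<open>Polynomials in several variables and LG-rings\<close>

text \<open>The set \<open>R[X\<^sub>0, \<dots>, X\<^sub>n\<^sub>-\<^sub>1]\<close> is the library's \<open>indexed_pset\<close>; monomials are multisets of indices.\<close>

definition mpoly_ring :: "('r, 'a) ring_scheme \<Rightarrow> nat \<Rightarrow> (nat multiset \<Rightarrow> 'r) ring" where
  "mpoly_ring R n =
    \<lparr>carrier = ring.indexed_pset R {..<n} (carrier R),
     monoid.mult = (\<lambda>p q m. \<Oplus>\<^bsub>R\<^esub>ab\<in>{(a, b). a + b = m}. p (fst ab) \<otimes>\<^bsub>R\<^esub> q (snd ab)),
     one = ring.indexed_const R \<one>\<^bsub>R\<^esub>,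
     ring.zero = ring.indexed_const R \<zero>\<^bsub>R\<^esub>,
     ring.add = ring.indexed_padd R\<rparr>"

text \<open>Value of \<open>p\<close> at the point \<open>x\<close> of \<open>A\<^sup>n\<close>, the coefficients being mapped to \<open>A\<close> by \<open>\<phi>\<close>.\<close>

definition mpoly_eval ::
  "('r, 'a) ring_scheme \<Rightarrow> ('s, 'b) ring_scheme \<Rightarrow> ('r \<Rightarrow> 's) \<Rightarrow> nat \<Rightarrow> (nat \<Rightarrow> 's)
    \<Rightarrow> (nat multiset \<Rightarrow> 'r) \<Rightarrow> 's" where
  "mpoly_eval R A \<phi> n x p =
    (\<Oplus>\<^bsub>A\<^esub>m\<in>{m. p m \<noteq> \<zero>\<^bsub>R\<^esub>}. \<phi> (p m) \<otimes>\<^bsub>A\<^esub> (\<Otimes>\<^bsub>A\<^esub>i\<in>{..<n}. x i [^]\<^bsub>A\<^esub> count m i))"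

definition LG_ring :: "('r, 'a) ring_scheme \<Rightarrow> bool" where
  "LG_ring R \<longleftrightarrow> cring R \<and>
    (\<forall>n. \<forall>f\<in>carrier (mpoly_ring R n).
      (\<exists>x\<in>{..<n} \<rightarrow>\<^sub>E carrier R. mpoly_eval R R (\<lambda>a. a) n x f \<in> Units R) \<longleftrightarrow>
      (\<forall>\<mm>. maximalideal \<mm> R \<longrightarrow>
        (\<exists>x\<in>{..<n} \<rightarrow>\<^sub>E carrier (R Quot \<mm>).
          mpoly_eval R (R Quot \<mm>) (\<lambda>a. \<mm> +>\<^bsub>R\<^esub> a) n x f \<noteq> \<zero>\<^bsub>R Quot \<mm>\<^esub>)))"


section \<open>Modules\<close>

definition module_hom ::
  "('r, 'a) ring_scheme \<Rightarrow> ('r, 'm, 'b) module_scheme \<Rightarrow> ('r, 'n, 'c) module_scheme \<Rightarrow> ('m \<Rightarrow> 'n) set" where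
  "module_hom R M N =
    {f \<in> hom (add_monoid M) (add_monoid N).
      \<forall>r\<in>carrier R. \<forall>x\<in>carrier M. f (r \<odot>\<^bsub>M\<^esub> x) = r \<odot>\<^bsub>N\<^esub> f x}"

definition regular_module :: "('r, 'a) ring_scheme \<Rightarrow> ('r, 'r) module" where
  "regular_module R =
    \<lparr>carrier = carrier R, monoid.mult = monoid.mult R, one = \<one>\<^bsub>R\<^esub>, ring.zero = \<zero>\<^bsub>R\<^esub>, ring.add = ring.add R,
     smult = monoid.mult R\<rparr>"

text \<open>In the next two records the ring multiplication is only there because the library's
  module record extends the ring record.\<close>

definition free_module :: "('r, 'a) ring_scheme \<Rightarrow> nat \<Rightarrow> ('r, nat \<Rightarrow> 'r) module" where
  "free_module R n =
    \<lparr>carrier = {..<n} \<rightarrow>\<^sub>E carrier R,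
     monoid.mult = (\<lambda>x y. \<lambda>i\<in>{..<n}. x i \<otimes>\<^bsub>R\<^esub> y i),
     one = (\<lambda>i\<in>{..<n}. \<one>\<^bsub>R\<^esub>),
     ring.zero = (\<lambda>i\<in>{..<n}. \<zero>\<^bsub>R\<^esub>),
     ring.add = (\<lambda>x y. \<lambda>i\<in>{..<n}. x i \<oplus>\<^bsub>R\<^esub> y i),
     smult = (\<lambda>r x. \<lambda>i\<in>{..<n}. r \<otimes>\<^bsub>R\<^esub> x i)\<rparr>"

definition direct_sum ::
  "('r, 'm, 'b) module_scheme \<Rightarrow> ('r, 'n, 'c) module_scheme \<Rightarrow> ('r, 'm \<times> 'n) module" where
  "direct_sum M N =
    \<lparr>carrier = carrier M \<times> carrier N,
     monoid.mult = (\<lambda>(x, y) (x', y'). (x \<otimes>\<^bsub>M\<^esub> x', y \<otimes>\<^bsub>N\<^esub> y')),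
     one = (\<one>\<^bsub>M\<^esub>, \<one>\<^bsub>N\<^esub>),
     ring.zero = (\<zero>\<^bsub>M\<^esub>, \<zero>\<^bsub>N\<^esub>),
     ring.add = (\<lambda>(x, y) (x', y'). (x \<oplus>\<^bsub>M\<^esub> x', y \<oplus>\<^bsub>N\<^esub> y')),
     smult = (\<lambda>r (x, y). (r \<odot>\<^bsub>M\<^esub> x, r \<odot>\<^bsub>N\<^esub> y))\<rparr>"

text \<open>Finitely generated projective: a direct summand of some \<open>R\<^sup>n\<close>.\<close>

definition fg_projective :: "('r, 'a) ring_scheme \<Rightarrow> ('r, 'm, 'b) module_scheme \<Rightarrow> bool" where
  "fg_projective R M \<longleftrightarrow> module R M \<and>
    (\<exists>n. \<exists>\<iota>\<in>module_hom R M (free_module R n). \<exists>\<pi>\<in>module_hom R (free_module R n) M.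
      \<forall>x\<in>carrier M. \<pi> (\<iota> x) = x)"

definition is_basis :: "('r, 'a) ring_scheme \<Rightarrow> ('r, 'm, 'b) module_scheme \<Rightarrow> 'm set \<Rightarrow> bool" where
  "is_basis R M B \<longleftrightarrow> finite B \<and> B \<subseteq> carrier M \<and>
    (\<forall>x\<in>carrier M. \<exists>!c. c \<in> B \<rightarrow>\<^sub>E carrier R \<and> x = (\<Oplus>\<^bsub>M\<^esub>b\<in>B. c b \<odot>\<^bsub>M\<^esub> b))"


section \<open>Localization\<close>

text \<open>For a multiplicative set \<open>W\<close> of \<open>R\<close>, fractions with numerator in \<open>M\<close> and denominator in \<open>W\<close>
  are classes of pairs (numerator, denominator). If \<open>M\<close> is an \<open>R\<close>-algebra, the multiplication
  and unit below make the localization an algebra over the ring of fractions of \<open>R\<close>.\<close>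

definition frac_rel ::
  "('r, 'a) ring_scheme \<Rightarrow> 'r set \<Rightarrow> ('r, 'm, 'b) module_scheme \<Rightarrow> (('m \<times> 'r) \<times> ('m \<times> 'r)) set" where
  "frac_rel R W M =
    {((x, w), (y, v)) | x w y v. x \<in> carrier M \<and> y \<in> carrier M \<and> w \<in> W \<and> v \<in> W \<and>
      (\<exists>u\<in>W. u \<odot>\<^bsub>M\<^esub> (v \<odot>\<^bsub>M\<^esub> x) = u \<odot>\<^bsub>M\<^esub> (w \<odot>\<^bsub>M\<^esub> y))}"

definition fraction ::
  "('r, 'a) ring_scheme \<Rightarrow> 'r set \<Rightarrow> ('r, 'm, 'b) module_scheme \<Rightarrow> 'm \<Rightarrow> 'r \<Rightarrow> ('m \<times> 'r) set" where
  "fraction R W M x w = frac_rel R W M `` {(x, w)}"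

definition localization ::
  "('r, 'a) ring_scheme \<Rightarrow> 'r set \<Rightarrow> ('r, 'm, 'b) module_scheme
    \<Rightarrow> (('r \<times> 'r) set, ('m \<times> 'r) set) module" where
  "localization R W M =
    \<lparr>carrier = (carrier M \<times> W) // frac_rel R W M,
     monoid.mult = (\<lambda>P Q. \<Union>(x, w)\<in>P. \<Union>(y, v)\<in>Q. fraction R W M (x \<otimes>\<^bsub>M\<^esub> y) (w \<otimes>\<^bsub>R\<^esub> v)),
     one = fraction R W M \<one>\<^bsub>M\<^esub> \<one>\<^bsub>R\<^esub>,
     ring.zero = fraction R W M \<zero>\<^bsub>M\<^esub> \<one>\<^bsub>R\<^esub>,
     ring.add = (\<lambda>P Q. \<Union>(x, w)\<in>P. \<Union>(y, v)\<in>Q.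
              fraction R W M (v \<odot>\<^bsub>M\<^esub> x \<oplus>\<^bsub>M\<^esub> w \<odot>\<^bsub>M\<^esub> y) (w \<otimes>\<^bsub>R\<^esub> v)),
     smult = (\<lambda>A P. \<Union>(a, w)\<in>A. \<Union>(x, v)\<in>P. fraction R W M (a \<odot>\<^bsub>M\<^esub> x) (w \<otimes>\<^bsub>R\<^esub> v))\<rparr>"

abbreviation fraction_ring ::
  "('r, 'a) ring_scheme \<Rightarrow> 'r set \<Rightarrow> (('r \<times> 'r) set, ('r \<times> 'r) set) module" where
  "fraction_ring R W \<equiv> localization R W (regular_module R)"

text \<open>The map induced by an \<open>R\<close>-linear endomorphism.\<close>

definition localization_map ::
  "('r, 'a) ring_scheme \<Rightarrow> 'r set \<Rightarrow> ('r, 'm, 'b) module_scheme \<Rightarrow> ('m \<Rightarrow> 'm)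
    \<Rightarrow> ('m \<times> 'r) set \<Rightarrow> ('m \<times> 'r) set" where
  "localization_map R W M f P = (\<Union>(x, w)\<in>P. fraction R W M (f x) w)"

definition powers :: "('r, 'a) ring_scheme \<Rightarrow> 'r \<Rightarrow> 'r set" where
  "powers R f = {f [^]\<^bsub>R\<^esub> n | n :: nat. True}"

definition projective_of_rank ::
  "('r, 'a) ring_scheme \<Rightarrow> ('r, 'm, 'b) module_scheme \<Rightarrow> nat \<Rightarrow> bool" where
  "projective_of_rank R M n \<longleftrightarrow> fg_projective R M \<and>
    (\<forall>\<pp>. primeideal \<pp> R \<longrightarrow>
      (\<exists>B. card B = n \<and>
        is_basis (fraction_ring R (carrier R - \<pp>)) (localization R (carrier R - \<pp>) M) B))"


section \<open>Etale algebras\<close>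

definition tensor_relations ::
  "('r, 'a) ring_scheme \<Rightarrow> ('r, 'm, 'b) module_scheme \<Rightarrow> ('r, 'n, 'c) module_scheme
    \<Rightarrow> (('m \<times> 'n) \<Rightarrow>\<^sub>0 int) set" where
  "tensor_relations R M N =
    {frag_of (x \<oplus>\<^bsub>M\<^esub> x', y) - frag_of (x, y) - frag_of (x', y) | x x' y.
       x \<in> carrier M \<and> x' \<in> carrier M \<and> y \<in> carrier N} \<union>
    {frag_of (x, y \<oplus>\<^bsub>N\<^esub> y') - frag_of (x, y) - frag_of (x, y') | x y y'.
       x \<in> carrier M \<and> y \<in> carrier N \<and> y' \<in> carrier N} \<union>
    {frag_of (r \<odot>\<^bsub>M\<^esub> x, y) - frag_of (x, r \<odot>\<^bsub>N\<^esub> y) | r x y.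
       r \<in> carrier R \<and> x \<in> carrier M \<and> y \<in> carrier N}"

definition tensor_subgroup ::
  "('r, 'a) ring_scheme \<Rightarrow> ('r, 'm, 'b) module_scheme \<Rightarrow> ('r, 'n, 'c) module_scheme
    \<Rightarrow> (('m \<times> 'n) \<Rightarrow>\<^sub>0 int) set" where
  "tensor_subgroup R M N =
    generate (free_Abelian_group (carrier M \<times> carrier N)) (tensor_relations R M N)"

definition tensor_product ::
  "('r, 'a) ring_scheme \<Rightarrow> ('r, 'm, 'b) module_scheme \<Rightarrow> ('r, 'n, 'c) module_scheme
    \<Rightarrow> (('m \<times> 'n) \<Rightarrow>\<^sub>0 int) set monoid" where
  "tensor_product R M N =
    free_Abelian_group (carrier M \<times> carrier N) Mod tensor_subgroup R M N"

definition pure_tensor ::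
  "('r, 'a) ring_scheme \<Rightarrow> ('r, 'm, 'b) module_scheme \<Rightarrow> ('r, 'n, 'c) module_scheme
    \<Rightarrow> 'm \<Rightarrow> 'n \<Rightarrow> (('m \<times> 'n) \<Rightarrow>\<^sub>0 int) set" where
  "pure_tensor R M N x y =
    tensor_subgroup R M N #>\<^bsub>free_Abelian_group (carrier M \<times> carrier N)\<^esub> frag_of (x, y)"

text \<open>Flatness, tested on the inclusions of ideals: \<open>I \<otimes> M \<rightarrow> M\<close> is injective for every ideal \<open>I\<close>.
  (Quantifying over all injections of \<open>R\<close>-modules is not possible inside a HOL definition.)\<close>

definition flat :: "('r, 'a) ring_scheme \<Rightarrow> ('r, 'm, 'b) module_scheme \<Rightarrow> bool" where
  "flat R M \<longleftrightarrow> module R M \<and>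
    (\<forall>I. ideal I R \<longrightarrow>
      (let I\<^sub>R = (regular_module R)\<lparr>carrier := I\<rparr> in
       \<exists>\<mu>\<in>mon (tensor_product R I\<^sub>R M) (add_monoid M).
         \<forall>a\<in>I. \<forall>x\<in>carrier M. \<mu> (pure_tensor R I\<^sub>R M a x) = a \<odot>\<^bsub>M\<^esub> x))"

definition finitely_presented_algebra ::
  "('r, 'a) ring_scheme \<Rightarrow> ('r, 's, 'b) module_scheme \<Rightarrow> bool" where
  "finitely_presented_algebra R S \<longleftrightarrow> algebra R S \<and>
    (\<exists>n. \<exists>x\<in>{..<n} \<rightarrow>\<^sub>E carrier S. \<exists>F.
      let P = mpoly_ring R n; ev = mpoly_eval R S (\<lambda>r. r \<odot>\<^bsub>S\<^esub> \<one>\<^bsub>S\<^esub>) n x in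
      ev ` carrier P = carrier S \<and>
      finite F \<and> F \<subseteq> carrier P \<and> a_kernel P S ev = Idl\<^bsub>P\<^esub> F)"

text \<open>The module of Kaehler differentials of \<open>S/R\<close>, as an abelian group: the pair \<open>(s, t)\<close> stands for
  \<open>s dt\<close>. The tensor relations give \<open>S\<close>-linearity in \<open>s\<close> and \<open>R\<close>-linearity of \<open>d\<close>, and the remaining
  ones are \<open>s d(tu) = st du + su dt\<close>.\<close>

definition kaehler_differentials ::
  "('r, 'a) ring_scheme \<Rightarrow> ('r, 's, 'b) module_scheme \<Rightarrow> (('s \<times> 's) \<Rightarrow>\<^sub>0 int) set monoid" where
  "kaehler_differentials R S =
    (let F = free_Abelian_group (carrier S \<times> carrier S) in
     F Mod generate F (tensor_relations R S S \<union>
       {frag_of (s, t \<otimes>\<^bsub>S\<^esub> u) - frag_of (s \<otimes>\<^bsub>S\<^esub> t, u) - frag_of (s \<otimes>\<^bsub>S\<^esub> u, t) | s t u.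
          s \<in> carrier S \<and> t \<in> carrier S \<and> u \<in> carrier S}))"

definition etale :: "('r, 'a) ring_scheme \<Rightarrow> ('r, 's, 'b) module_scheme \<Rightarrow> bool" where
  "etale R S \<longleftrightarrow>
    finitely_presented_algebra R S \<and> flat R S \<and> trivial_group (kaehler_differentials R S)"

definition quadratic_etale :: "('r, 'a) ring_scheme \<Rightarrow> ('r, 's, 'b) module_scheme \<Rightarrow> bool" where
  "quadratic_etale R S \<longleftrightarrow> algebra R S \<and> etale R S \<and> projective_of_rank R S 2"

text \<open>The standard involution of \<open>S/R\<close> is the \<open>R\<close>-algebra involution \<open>\<sigma>\<close> whose localization \<open>\<sigma>\<^sub>f\<close>
  satisfies \<open>\<sigma>\<^sub>f(z) = a - z\<close> on every principal open set of the spectrum of \<open>R\<close> over which \<open>S\<close> is free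
  with basis \<open>{1, z}\<close>, where \<open>z\<^sup>2 = az + b\<close>. Such open sets cover the spectrum when \<open>S\<close> has
  rank 2; the case of \<open>f = 1\<close> is the formula for \<open>S\<close> itself.\<close>

definition standard_involution ::
  "('r, 'a) ring_scheme \<Rightarrow> ('r, 's, 'b) module_scheme \<Rightarrow> ('s \<Rightarrow> 's) \<Rightarrow> bool" where
  "standard_involution R S \<sigma> \<longleftrightarrow>
    \<sigma> \<in> ring_hom S S \<and>
    (\<forall>r\<in>carrier R. \<forall>s\<in>carrier S. \<sigma> (r \<odot>\<^bsub>S\<^esub> s) = r \<odot>\<^bsub>S\<^esub> \<sigma> s) \<and>
    (\<forall>s\<in>carrier S. \<sigma> (\<sigma> s) = s) \<and>
    (\<forall>f\<in>carrier R.
      let R\<^sub>f = fraction_ring R (powers R f);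
          S\<^sub>f = localization R (powers R f) S;
          \<sigma>\<^sub>f = localization_map R (powers R f) S \<sigma>
      in \<forall>z\<in>carrier S\<^sub>f. \<forall>a\<in>carrier R\<^sub>f. \<forall>b\<in>carrier R\<^sub>f.
           is_basis R\<^sub>f S\<^sub>f {\<one>\<^bsub>S\<^sub>f\<^esub>, z} \<longrightarrow>
           z \<otimes>\<^bsub>S\<^sub>f\<^esub> z = a \<odot>\<^bsub>S\<^sub>f\<^esub> z \<oplus>\<^bsub>S\<^sub>f\<^esub> b \<odot>\<^bsub>S\<^sub>f\<^esub> \<one>\<^bsub>S\<^sub>f\<^esub> \<longrightarrow>
           \<sigma>\<^sub>f z = a \<odot>\<^bsub>S\<^sub>f\<^esub> \<one>\<^bsub>S\<^sub>f\<^esub> \<ominus>\<^bsub>S\<^sub>f\<^esub> z)"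


section \<open>Hermitian forms\<close>

text \<open>Since \<open>S\<close> is commutative, the right \<open>S\<close>-modules of the theory of hermitian forms are
  written with the scalars on the left.\<close>

definition hermitian_form ::
  "('s, 'b) ring_scheme \<Rightarrow> ('s \<Rightarrow> 's) \<Rightarrow> ('s, 'm, 'c) module_scheme \<Rightarrow> ('m \<Rightarrow> 'm \<Rightarrow> 's) \<Rightarrow> bool" where
  "hermitian_form S \<sigma> M h \<longleftrightarrow> fg_projective S M \<and>
    (\<forall>x\<in>carrier M. \<forall>y\<in>carrier M. h x y \<in> carrier S) \<and>
    (\<forall>x\<in>carrier M. \<forall>x'\<in>carrier M. \<forall>y\<in>carrier M. h (x \<oplus>\<^bsub>M\<^esub> x') y = h x y \<oplus>\<^bsub>S\<^esub> h x' y) \<and>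
    (\<forall>x\<in>carrier M. \<forall>y\<in>carrier M. \<forall>y'\<in>carrier M. h x (y \<oplus>\<^bsub>M\<^esub> y') = h x y \<oplus>\<^bsub>S\<^esub> h x y') \<and>
    (\<forall>x\<in>carrier M. \<forall>y\<in>carrier M. \<forall>s\<in>carrier S. \<forall>t\<in>carrier S.
      h (s \<odot>\<^bsub>M\<^esub> x) (t \<odot>\<^bsub>M\<^esub> y) = \<sigma> s \<otimes>\<^bsub>S\<^esub> h x y \<otimes>\<^bsub>S\<^esub> t) \<and>
    (\<forall>x\<in>carrier M. \<forall>y\<in>carrier M. h x y = \<sigma> (h y x))"

text \<open>The underlying set of \<open>M\<^sup>*\<close>; its twisted \<open>S\<close>-action does not enter into regularity.\<close>

definition dual :: "('s, 'b) ring_scheme \<Rightarrow> ('s, 'm, 'c) module_scheme \<Rightarrow> ('m \<Rightarrow> 's) set" where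
  "dual S M = module_hom S M (regular_module S) \<inter> extensional (carrier M)"

definition hermitian_space ::
  "('s, 'b) ring_scheme \<Rightarrow> ('s \<Rightarrow> 's) \<Rightarrow> ('s, 'm, 'c) module_scheme \<Rightarrow> ('m \<Rightarrow> 'm \<Rightarrow> 's) \<Rightarrow> bool" where
  "hermitian_space S \<sigma> M h \<longleftrightarrow> hermitian_form S \<sigma> M h \<and>
    bij_betw (\<lambda>x. \<lambda>y\<in>carrier M. h x y) (carrier M) (dual S M)"

definition isometric ::
  "('s, 'b) ring_scheme \<Rightarrow> ('s, 'm, 'c) module_scheme \<Rightarrow> ('m \<Rightarrow> 'm \<Rightarrow> 's)
    \<Rightarrow> ('s, 'n, 'd) module_scheme \<Rightarrow> ('n \<Rightarrow> 'n \<Rightarrow> 's) \<Rightarrow> bool" where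
  "isometric S M h N k \<longleftrightarrow>
    (\<exists>f\<in>module_hom S M N. bij_betw f (carrier M) (carrier N) \<and>
      (\<forall>x\<in>carrier M. \<forall>y\<in>carrier M. k (f x) (f y) = h x y))"

definition orthogonal_sum ::
  "('s, 'b) ring_scheme \<Rightarrow> ('m \<Rightarrow> 'm \<Rightarrow> 's) \<Rightarrow> ('n \<Rightarrow> 'n \<Rightarrow> 's) \<Rightarrow> 'm \<times> 'n \<Rightarrow> 'm \<times> 'n \<Rightarrow> 's" where
  "orthogonal_sum S h k = (\<lambda>(x, y) (x', y'). h x x' \<oplus>\<^bsub>S\<^esub> k y y')"

end

theory Submission
  imports Defs "HOL-Decision_Procs.Commutative_Ring"
begin

text \<open>
  Hyperbolic planes can be cancelled, and this suffices. A hermitian space \<open>(M, h)\<close> is an orthogonal summand of some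
  hyperbolic space \<open>H\<^sup>n\<close>: since \<open>S\<close> is etale, there is \<open>l\<close> with \<open>l + \<sigma>(l) = 1\<close>, so \<open>h\<close> is the sum of \<open>lh\<close> and its
  conjugate transpose, and this yields an isometric embedding of \<open>M\<close> into \<open>H\<^sup>n\<close>, which splits because \<open>h\<close> is regular
  (\<open>embed_in_hyperbolic\<close>). Adding the complement of \<open>h3\<close> to both sides leaves the case that \<open>h3\<close> is \<open>H\<^sup>n\<close>
  (\<open>isometric_add_hyperbolic\<close>), and by induction the case of one hyperbolic plane.

  So let \<open>(e, f)\<close> and \<open>(e', f')\<close> be hyperbolic pairs in one hermitian module; their orthogonal complements have to be
  compared. If \<open>e\<close> is isotropic and has unit products with \<open>f\<close> and \<open>g\<close>, then the complements of \<open>{e, f}\<close> and of \<open>{e, g}\<close>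
  are isometric (\<open>isometry_exchange\<close>). It is therefore enough to find an isotropic \<open>g\<close> whose products with \<open>e\<close> and
  \<open>e'\<close> are units (\<open>exists_common_neighbour\<close>). The isotropic vectors whose product with \<open>e\<close> is \<open>1\<close> contain a polynomial
  family with parameters in \<open>S\<^sup>3\<close>, hence in some \<open>R\<^sup>k\<close>, and the norm of the product with \<open>e'\<close> is a polynomial function on
  \<open>R\<^sup>k\<close> with values in \<open>R\<close>. By the LG property a unit value exists if for each maximal ideal \<open>\<mm>\<close> some value lies outside
  \<open>\<mm>\<close> (\<open>spoly_on_unit\<close>). That is a computation in the residue fields of the primes \<open>Q\<close> and \<open>\<sigma>(Q)\<close> of \<open>S\<close> over \<open>\<mm>\<close>
  (\<open>neighbour_value_nonzero_local\<close>); where the residue field has only two elements it relies on an element \<open>\<delta>\<close> with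
  \<open>\<sigma>(\<delta>) = -\<delta>\<close> that is a unit at \<open>\<mm>\<close>.

  The existence of \<open>l\<close> and \<open>\<delta>\<close> and the fact that traces and norms lie in \<open>R\<close> come from local coordinates: near each
  maximal ideal, \<open>S\<close> has a basis \<open>{1, z}\<close> with \<open>z\<^sup>2 = az + b\<close> and \<open>\<sigma>(z) = a - z\<close> (\<open>standard_involution_quad_coords\<close>). If
  \<open>z - \<sigma>(z) = 2z - a\<close> were not a unit there, the coefficient of \<open>z\<close> would be a nonzero derivation of \<open>S\<close> into a residue
  field, against the vanishing of the Kaehler differentials (\<open>different_notin\<close>).
\<close>

section \<open>Polynomial identities in commutative rings\<close>

context cring
begin

text \<open>An identity between ring terms is proved by comparing the normal forms of their reifications. Resolution
  with \<open>reify_rules\<close> computes the reifications, given the list of atoms.\<close>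

lemma ring_identityI:
  assumes "x = Ipolex l P" "y = Ipolex l Q" "norm P = norm Q" "in_carrier l"
  shows "x = y"
  using norm_ci[OF assms(4), of P] norm_ci[OF assms(4), of Q] assms by simp

lemma reify_rules:
  "x = Ipolex l P \<Longrightarrow> y = Ipolex l Q \<Longrightarrow> x \<oplus> y = Ipolex l (Add P Q)"
  "x = Ipolex l P \<Longrightarrow> y = Ipolex l Q \<Longrightarrow> x \<otimes> y = Ipolex l (Mul P Q)"
  "x = Ipolex l P \<Longrightarrow> y = Ipolex l Q \<Longrightarrow> x \<ominus> y = Ipolex l (Sub P Q)"
  "x = Ipolex l P \<Longrightarrow> \<ominus> x = Ipolex l (Neg P)"
  "\<one> = Ipolex l (Const 1)"
  "\<zero> = Ipolex l (Const 0)"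
  "z = Ipolex (z # l) (Var 0)"
  "z = Ipolex l (Var n) \<Longrightarrow> z = Ipolex (w # l) (Var (Suc n))"
  by simp_all

lemmas in_carrier_simps = in_carrier_Cons in_carrier_Nil

end

lemmas norm_simps = mkPX_def mkPinj_def sub_def

section \<open>Maximal ideals\<close>

context cring
begin

lemma idealI_comm:
  assumes "I \<subseteq> carrier R" "\<zero> \<in> I" "\<And>a b. a \<in> I \<Longrightarrow> b \<in> I \<Longrightarrow> a \<oplus> b \<in> I"
    and "\<And>a r. a \<in> I \<Longrightarrow> r \<in> carrier R \<Longrightarrow> r \<otimes> a \<in> I"
  shows "ideal I R"
proof (rule idealI)
  show "ring R" by (rule ring_axioms)
  show "subgroup I (add_monoid R)"
  proof (rule add.subgroupI)
    fix a assume a: "a \<in> I"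
    then have "(\<ominus> \<one>) \<otimes> a \<in> I" using assms(4) by simp
    then show "\<ominus> a \<in> I" using a assms(1) by (simp add: l_minus subset_iff)
  qed (use assms in auto)
  show "r \<otimes> a \<in> I" if "a \<in> I" "r \<in> carrier R" for a r using that assms(4) by blast
  show "a \<otimes> r \<in> I" if "a \<in> I" "r \<in> carrier R" for a r
    using that assms(4)[OF that] assms(1) m_comm by (simp add: subset_iff)
qed

lemma idealD:
  assumes "ideal I R"
  shows "\<zero> \<in> I" "a \<in> I \<Longrightarrow> b \<in> I \<Longrightarrow> a \<oplus> b \<in> I"
    "a \<in> I \<Longrightarrow> \<ominus> a \<in> I" "a \<in> I \<Longrightarrow> b \<in> I \<Longrightarrow> a \<ominus> b \<in> I"
    "a \<in> I \<Longrightarrow> r \<in> carrier R \<Longrightarrow> r \<otimes> a \<in> I"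
    "a \<in> I \<Longrightarrow> r \<in> carrier R \<Longrightarrow> a \<otimes> r \<in> I" "a \<in> I \<Longrightarrow> a \<in> carrier R"
proof -
  interpret I: ideal I R by fact
  show "\<zero> \<in> I" "a \<in> I \<Longrightarrow> b \<in> I \<Longrightarrow> a \<oplus> b \<in> I" "a \<in> I \<Longrightarrow> \<ominus> a \<in> I"
    "a \<in> I \<Longrightarrow> b \<in> I \<Longrightarrow> a \<ominus> b \<in> I"
    "a \<in> I \<Longrightarrow> r \<in> carrier R \<Longrightarrow> r \<otimes> a \<in> I"
    "a \<in> I \<Longrightarrow> r \<in> carrier R \<Longrightarrow> a \<otimes> r \<in> I" "a \<in> I \<Longrightarrow> a \<in> carrier R"
    using I.zero_closed I.a_closed I.a_inv_closed I.I_l_closed I.I_r_closed I.Icarr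
    by (simp_all add: minus_eq)
qed

lemma exists_maximalideal:
  assumes "ideal I R" "\<one> \<notin> I"
  obtains J where "maximalideal J R" "I \<subseteq> J"
proof -
  let ?A = "{J. ideal J R \<and> I \<subseteq> J \<and> \<one> \<notin> J}"
  have "\<exists>J\<in>?A. \<forall>K\<in>?A. J \<subseteq> K \<longrightarrow> K = J"
  proof (rule subset_Zorn_nonempty)
    show "?A \<noteq> {}" using assms by auto
    fix C assume C: "C \<noteq> {}" "subset.chain ?A C"
    have CA: "\<And>J. J \<in> C \<Longrightarrow> ideal J R \<and> I \<subseteq> J \<and> \<one> \<notin> J"
      using C(2) unfolding subset.chain_def by blast
    have lin: "\<And>J K. J \<in> C \<Longrightarrow> K \<in> C \<Longrightarrow> J \<subseteq> K \<or> K \<subseteq> J"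
      using C(2) unfolding subset.chain_def by blast
    have "ideal (\<Union>C) R"
    proof (rule idealI_comm)
      show "\<Union>C \<subseteq> carrier R" using CA ideal.Icarr by fastforce
      show "\<zero> \<in> \<Union>C"
      proof -
        obtain L where L: "L \<in> C" using C(1) by auto
        then have "\<zero> \<in> L" using CA[OF L] idealD(1) by simp
        then show ?thesis using L by auto
      qed
    next
      fix a b assume "a \<in> \<Union>C" "b \<in> \<Union>C"
      then obtain J K where J: "J \<in> C" "a \<in> J" "K \<in> C" "b \<in> K" by blast
      have "\<exists>L\<in>C. a \<in> L \<and> b \<in> L" using lin[OF J(1) J(3)] J by (elim disjE) auto
      then obtain L where L: "L \<in> C" "a \<in> L" "b \<in> L" by auto
      then have "a \<oplus> b \<in> L"
        using CA[OF L(1)] idealD(2) by simp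
      then show "a \<oplus> b \<in> \<Union>C" using L(1) by auto
    next
      fix a r assume "a \<in> \<Union>C" and r: "r \<in> carrier R"
      then obtain L where L: "L \<in> C" "a \<in> L" by auto
      then have "r \<otimes> a \<in> L" using CA[OF L(1)] idealD(5) r by simp
      then show "r \<otimes> a \<in> \<Union>C" using L(1) by auto
    qed
    moreover obtain L where "L \<in> C" using C(1) by auto
    then have "I \<subseteq> \<Union>C" using CA[of L] by (meson Union_upper subset_trans)
    moreover have "\<one> \<notin> \<Union>C" using CA by (meson UnionE)
    ultimately show "\<Union>C \<in> ?A" by simp
  qed
  then obtain J where J: "ideal J R \<and> I \<subseteq> J \<and> \<one> \<notin> J"
    and "\<forall>K\<in>?A. J \<subseteq> K \<longrightarrow> K = J" by (elim bexE) simp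
  then have max: "K = J" if "ideal K R" "I \<subseteq> K" "\<one> \<notin> K" "J \<subseteq> K" for K
    using that by (metis (no_types, lifting) mem_Collect_eq)
  have "maximalideal J R"
  proof (rule maximalidealI)
    show "ideal J R" using J by simp
    show "carrier R \<noteq> J" using J one_closed by metis
    fix K assume K: "ideal K R" "J \<subseteq> K" "K \<subseteq> carrier R"
    show "K = J \<or> K = carrier R"
    proof (cases "\<one> \<in> K")
      case True then show ?thesis using ideal.one_imp_carrier[OF K(1)] by simp
    next
      case False
      then have "K = J" using max[OF K(1)] K(2) J by (meson subset_trans)
      then show ?thesis ..
    qed
  qed
  then show ?thesis using that J by simp
qed

text \<open>This turns local statements into global ones: it is applied to the ideal of those \<open>r\<close> for which the
  statement becomes true after multiplication by \<open>r\<close>.\<close>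

lemma one_in_idealI:
  assumes "ideal I R" "\<And>\<mm>. maximalideal \<mm> R \<Longrightarrow> \<exists>r\<in>I. r \<notin> \<mm>"
  shows "\<one> \<in> I"
proof (rule ccontr)
  assume "\<one> \<notin> I"
  then obtain J where "maximalideal J R" "I \<subseteq> J" using exists_maximalideal[OF assms(1)] by metis
  then show False using assms(2)[of J] by auto
qed

lemma maximalideal_inverse:
  assumes "maximalideal \<mm> R" "a \<in> carrier R" "a \<notin> \<mm>"
  obtains c where "c \<in> carrier R" "a \<otimes> c \<ominus> \<one> \<in> \<mm>"
proof -
  interpret m: maximalideal \<mm> R by fact
  have id: "ideal (PIdl a <+> \<mm>) R" using add_ideals[OF cgenideal_ideal[OF assms(2)] m.ideal_axioms] .
  have za: "\<zero> \<in> PIdl a"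
    by (rule idealD(1)[OF cgenideal_ideal[OF assms(2)]])
  have "\<mm> \<subseteq> PIdl a <+> \<mm>"
  proof
    fix q assume q: "q \<in> \<mm>"
    then have "q = \<zero> \<oplus> q" using m.Icarr by simp
    then show "q \<in> PIdl a <+> \<mm>" using q za unfolding set_add_def' by blast
  qed
  moreover have "a = a \<oplus> \<zero>" using assms(2) by simp
  then have "a \<in> PIdl a <+> \<mm>"
    using cgenideal_self[OF assms(2)] m.zero_closed unfolding set_add_def' by blast
  ultimately have "PIdl a <+> \<mm> = carrier R"
    using m.I_maximal[OF id] ideal.Icarr[OF id] assms(3) by blast
  then obtain i q where iq: "i \<in> PIdl a" "q \<in> \<mm>" "\<one> = i \<oplus> q"
    using one_closed unfolding set_add_def' by blast
  then obtain c where c: "c \<in> carrier R" "i = c \<otimes> a" unfolding cgenideal_def by blast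
  have "i \<ominus> (i \<oplus> q) = \<ominus> q"
    by (rule ring_identityI[of _ "[i, q]"], (rule reify_rules)+)
      (use c assms(2) m.Icarr[OF iq(2)] in \<open>simp_all add: in_carrier_simps norm_simps\<close>)
  then have "a \<otimes> c \<ominus> \<one> = \<ominus> q"
    using c(2) m_comm[OF assms(2) c(1)] iq(3) by simp
  then show ?thesis using that[OF c(1)] m.a_inv_closed[OF iq(2)] by simp
qed

end

section \<open>Polynomial functions\<close>

context cring
begin

text \<open>One rule for each rule that generates the set of polynomials. Closure under products, for which the
  polynomials offer no rule, is proved for the functions instead.\<close>

inductive_set polyfun :: "nat \<Rightarrow> ((nat \<Rightarrow> 'a) \<Rightarrow> 'a) set" for n where
  const: "c \<in> carrier R \<Longrightarrow> (\<lambda>x. c) \<in> polyfun n"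
| add: "F \<in> polyfun n \<Longrightarrow> G \<in> polyfun n \<Longrightarrow> (\<lambda>x. F x \<oplus> G x) \<in> polyfun n"
| var_mult: "F \<in> polyfun n \<Longrightarrow> i < n \<Longrightarrow> (\<lambda>x. F x \<otimes> x i) \<in> polyfun n"

lemma polyfun_closed:
  "F \<in> polyfun n \<Longrightarrow> x \<in> {..<n} \<rightarrow> carrier R \<Longrightarrow> F x \<in> carrier R"
  by (induction rule: polyfun.induct) (auto simp: Pi_def)

text \<open>Agreement is asked for on \<open>R\<^sup>n\<close> only, because the ring laws hold on the carrier only.\<close>

definition poly_on :: "nat \<Rightarrow> ((nat \<Rightarrow> 'a) \<Rightarrow> 'a) \<Rightarrow> bool" where
  "poly_on n F \<longleftrightarrow> (\<exists>G\<in>polyfun n. \<forall>x\<in>{..<n} \<rightarrow> carrier R. F x = G x)"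

lemma poly_on_closed: "poly_on n F \<Longrightarrow> x \<in> {..<n} \<rightarrow> carrier R \<Longrightarrow> F x \<in> carrier R"
  using polyfun_closed unfolding poly_on_def by auto

lemma poly_on_cong:
  assumes "poly_on n F" "\<And>x. x \<in> {..<n} \<rightarrow> carrier R \<Longrightarrow> G x = F x"
  shows "poly_on n G"
  using assms unfolding poly_on_def by fastforce

lemma poly_on_const: "c \<in> carrier R \<Longrightarrow> poly_on n (\<lambda>x. c)"
  unfolding poly_on_def using polyfun.const[of c n] by (intro bexI[of _ "\<lambda>x. c"]) auto

lemma poly_on_add: "poly_on n F \<Longrightarrow> poly_on n G \<Longrightarrow> poly_on n (\<lambda>x. F x \<oplus> G x)"
  unfolding poly_on_def using polyfun.add[of _ n] by fastforce

lemma poly_on_var_mult: "poly_on n F \<Longrightarrow> i < n \<Longrightarrow> poly_on n (\<lambda>x. F x \<otimes> x i)"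
  unfolding poly_on_def using polyfun.var_mult[of _ n i] by fastforce

lemma poly_on_var: "i < n \<Longrightarrow> poly_on n (\<lambda>x. x i)"
  by (rule poly_on_cong[OF poly_on_var_mult[OF poly_on_const[OF one_closed]]]) (auto simp: Pi_def)

lemma poly_on_scale:
  assumes "c \<in> carrier R" "poly_on n F"
  shows "poly_on n (\<lambda>x. c \<otimes> F x)"
proof -
  have "G \<in> polyfun n \<Longrightarrow> poly_on n (\<lambda>x. c \<otimes> G x)" for G
  proof (induction rule: polyfun.induct)
    case (const d)
    then show ?case using assms(1) poly_on_const by simp
  next
    case (add F G)
    show ?case
      by (rule poly_on_cong[OF poly_on_add[OF add.IH]])
        (simp add: r_distr assms(1) polyfun_closed[OF add.hyps(1)] polyfun_closed[OF add.hyps(2)])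
  next
    case (var_mult F i)
    show ?case
      by (rule poly_on_cong[OF poly_on_var_mult[OF var_mult.IH var_mult.hyps(2)]])
        (use assms(1) polyfun_closed[OF var_mult.hyps(1)] var_mult.hyps(2) in
          \<open>auto simp: m_assoc Pi_def\<close>)
  qed
  then show ?thesis
    using assms(2) unfolding poly_on_def[of n F] by (elim bexE) (rule poly_on_cong, auto)
qed

lemma poly_on_mult:
  assumes "poly_on n F" "poly_on n H"
  shows "poly_on n (\<lambda>x. F x \<otimes> H x)"
proof -
  note cl = poly_on_closed[OF assms(1)]
  have "G \<in> polyfun n \<Longrightarrow> poly_on n (\<lambda>x. F x \<otimes> G x)" for G
  proof (induction rule: polyfun.induct)
    case (const d)
    show ?case by (rule poly_on_cong[OF poly_on_scale[OF const assms(1)]])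
        (use const cl m_comm in auto)
  next
    case (add F G)
    show ?case
      by (rule poly_on_cong[OF poly_on_add[OF add.IH]])
        (simp add: r_distr cl polyfun_closed[OF add.hyps(1)] polyfun_closed[OF add.hyps(2)])
  next
    case (var_mult F i)
    show ?case
      by (rule poly_on_cong[OF poly_on_var_mult[OF var_mult.IH var_mult.hyps(2)]])
        (use cl polyfun_closed[OF var_mult.hyps(1)] var_mult.hyps(2) in
          \<open>auto simp: m_assoc Pi_def\<close>)
  qed
  then show ?thesis
    using assms(2) unfolding poly_on_def[of n H] by (elim bexE) (rule poly_on_cong, auto)
qed

abbreviation monomial :: "nat \<Rightarrow> (nat \<Rightarrow> 'a) \<Rightarrow> nat multiset \<Rightarrow> 'a" where
  "monomial n x m \<equiv> \<Otimes>i\<in>{..<n}. x i [^] count m i"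

lemma monomial_closed: "x \<in> {..<n} \<rightarrow> carrier R \<Longrightarrow> monomial n x m \<in> carrier R"
  by (intro finprod_closed) (auto simp: Pi_def)

lemma monomial_add_mset:
  assumes "x \<in> {..<n} \<rightarrow> carrier R" "i < n"
  shows "monomial n x (add_mset i m) = monomial n x m \<otimes> x i"
proof -
  have split: "{..<n} = insert i ({..<n} - {i})" using assms(2) by auto
  have cl: "x j \<in> carrier R" if "j < n" for j using assms(1) that by auto
  have eq: "(\<Otimes>j\<in>{..<n} - {i}. x j [^] count (add_mset i m) j) = (\<Otimes>j\<in>{..<n} - {i}. x j [^] count m j)"
    by (rule finprod_cong') (auto simp: cl)
  have ins: "monomial n x k = x i [^] count k i \<otimes> (\<Otimes>j\<in>{..<n} - {i}. x j [^] count k j)" for k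
    by (subst split, subst finprod_insert) (auto simp: cl assms(2))
  have c2: "(\<Otimes>j\<in>{..<n} - {i}. x j [^] count m j) \<in> carrier R" by (intro finprod_closed) (auto simp: cl)
  show ?thesis unfolding ins[of "add_mset i m"] ins[of m] eq
    using cl[OF assms(2)] c2 by (simp add: m_ac)
qed

text \<open>Summing over a superset of the support makes sums of polynomials with cancelling terms harmless.\<close>

lemma mpoly_eval_superset:
  assumes "finite A" "{m. p m \<noteq> \<zero>} \<subseteq> A" "\<And>m. p m \<in> carrier R" "x \<in> {..<n} \<rightarrow> carrier R"
  shows "mpoly_eval R R (\<lambda>a. a) n x p = (\<Oplus>m\<in>A. p m \<otimes> monomial n x m)"
  unfolding mpoly_eval_def
  by (rule add.finprod_mono_neutral_cong_left)
    (use assms monomial_closed[OF assms(4)] in \<open>auto\<close>)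

lemma indexed_pset_finite_support:
  "p \<in> indexed_pset I (carrier R) \<Longrightarrow> (\<forall>m. p m \<in> carrier R) \<and> finite {m. p m \<noteq> \<zero>}"
proof (induction rule: indexed_pset.induct)
  case (indexed_const k)
  then show ?case by (auto simp: indexed_const_def intro: finite_subset[of _ "{{#}}"])
next
  case (indexed_padd P Q)
  then have "finite ({m. P m \<noteq> \<zero>} \<union> {m. Q m \<noteq> \<zero>})" by simp
  then have "finite {m. indexed_padd P Q m \<noteq> \<zero>}"
    by (rule rev_finite_subset) (auto simp: indexed_padd_def)
  then show ?case using indexed_padd by (auto simp: indexed_padd_def)
next
  case (indexed_pmult P i)
  then have "finite (add_mset i ` {m. P m \<noteq> \<zero>})" by simp
  then have "finite {m. indexed_pmult P i m \<noteq> \<zero>}"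
  proof (rule rev_finite_subset, safe)
    fix m assume "indexed_pmult P i m \<noteq> \<zero>"
    then have "i \<in># m" "P (m - {#i#}) \<noteq> \<zero>" by (auto simp: indexed_pmult_def split: if_splits)
    then show "m \<in> add_mset i ` {m. P m \<noteq> \<zero>}" by (intro image_eqI[of _ _ "m - {#i#}"]) auto
  qed
  then show ?case using indexed_pmult by (auto simp: indexed_pmult_def)
qed

lemma polyfun_is_mpoly_eval:
  assumes "F \<in> polyfun n"
  shows "\<exists>p\<in>indexed_pset {..<n} (carrier R). \<forall>x\<in>{..<n} \<rightarrow> carrier R. mpoly_eval R R (\<lambda>a. a) n x p = F x"
  using assms
proof (induction rule: polyfun.induct)
  case (const c)
  have "mpoly_eval R R (\<lambda>a. a) n x (indexed_const c) = c" if x: "x \<in> {..<n} \<rightarrow> carrier R" for x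
  proof -
    have "mpoly_eval R R (\<lambda>a. a) n x (indexed_const c) = (\<Oplus>m\<in>{{#}}. indexed_const c m \<otimes> monomial n x m)"
      by (rule mpoly_eval_superset) (use const x in \<open>auto simp: indexed_const_def\<close>)
    then show ?thesis using const monomial_closed[OF x] by (simp add: indexed_const_def)
  qed
  then show ?case using const indexed_pset.indexed_const by blast
next
  case (add F G)
  then obtain p q where p: "p \<in> indexed_pset {..<n} (carrier R)" "\<And>x. x\<in>{..<n} \<rightarrow> carrier R \<Longrightarrow> mpoly_eval R R (\<lambda>a. a) n x p = F x"
    and q: "q \<in> indexed_pset {..<n} (carrier R)" "\<And>x. x\<in>{..<n} \<rightarrow> carrier R \<Longrightarrow> mpoly_eval R R (\<lambda>a. a) n x q = G x"
    by blast
  note fp = indexed_pset_finite_support[OF p(1)] and fq = indexed_pset_finite_support[OF q(1)]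
  have "mpoly_eval R R (\<lambda>a. a) n x (indexed_padd p q) = F x \<oplus> G x" if x: "x \<in> {..<n} \<rightarrow> carrier R" for x
  proof -
    let ?A = "{m. p m \<noteq> \<zero>} \<union> {m. q m \<noteq> \<zero>}"
    note mc = monomial_closed[OF x]
    have "mpoly_eval R R (\<lambda>a. a) n x (indexed_padd p q) = (\<Oplus>m\<in>?A. indexed_padd p q m \<otimes> monomial n x m)"
      by (rule mpoly_eval_superset) (use fp fq x in \<open>auto simp: indexed_padd_def\<close>)
    also have "\<dots> = (\<Oplus>m\<in>?A. p m \<otimes> monomial n x m \<oplus> q m \<otimes> monomial n x m)"
      by (rule finsum_cong') (use fp fq mc in \<open>auto simp: indexed_padd_def l_distr\<close>)
    also have "\<dots> = (\<Oplus>m\<in>?A. p m \<otimes> monomial n x m) \<oplus> (\<Oplus>m\<in>?A. q m \<otimes> monomial n x m)"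
      by (rule finsum_addf) (use fp fq mc in auto)
    also have "(\<Oplus>m\<in>?A. p m \<otimes> monomial n x m) = F x"
      by (subst p(2)[OF x, symmetric], rule mpoly_eval_superset[symmetric]) (use fp fq x in auto)
    also have "(\<Oplus>m\<in>?A. q m \<otimes> monomial n x m) = G x"
      by (subst q(2)[OF x, symmetric], rule mpoly_eval_superset[symmetric]) (use fp fq x in auto)
    finally show ?thesis .
  qed
  then show ?case using p(1) q(1) indexed_pset.indexed_padd by blast
next
  case (var_mult F i)
  then obtain p where p: "p \<in> indexed_pset {..<n} (carrier R)" "\<And>x. x\<in>{..<n} \<rightarrow> carrier R \<Longrightarrow> mpoly_eval R R (\<lambda>a. a) n x p = F x"
    by blast
  note fp = indexed_pset_finite_support[OF p(1)]
  have "mpoly_eval R R (\<lambda>a. a) n x (indexed_pmult p i) = F x \<otimes> x i" if x: "x \<in> {..<n} \<rightarrow> carrier R" for x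
  proof -
    let ?A = "{m. p m \<noteq> \<zero>}"
    note mc = monomial_closed[OF x]
    have xi: "x i \<in> carrier R" using x var_mult.hyps by auto
    have "mpoly_eval R R (\<lambda>a. a) n x (indexed_pmult p i)
        = (\<Oplus>m\<in>add_mset i ` ?A. indexed_pmult p i m \<otimes> monomial n x m)"
    proof (rule mpoly_eval_superset)
      show "{m. indexed_pmult p i m \<noteq> \<zero>} \<subseteq> add_mset i ` {m. p m \<noteq> \<zero>}"
      proof safe
        fix m assume "indexed_pmult p i m \<noteq> \<zero>"
        then have "i \<in># m" "p (m - {#i#}) \<noteq> \<zero>" by (auto simp: indexed_pmult_def split: if_splits)
        then show "m \<in> add_mset i ` {m. p m \<noteq> \<zero>}" by (intro image_eqI[of _ _ "m - {#i#}"]) auto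
      qed
    qed (use fp x in \<open>auto simp: indexed_pmult_def\<close>)
    also have "\<dots> = (\<Oplus>m\<in>?A. indexed_pmult p i (add_mset i m) \<otimes> monomial n x (add_mset i m))"
      by (rule finsum_reindex) (use fp mc in \<open>auto simp: indexed_pmult_def inj_on_def\<close>)
    also have "\<dots> = (\<Oplus>m\<in>?A. (p m \<otimes> monomial n x m) \<otimes> x i)"
      by (rule finsum_cong')
        (use fp mc xi monomial_add_mset[OF x var_mult.hyps(2)] in \<open>auto simp: indexed_pmult_def m_assoc\<close>)
    also have "\<dots> = (\<Oplus>m\<in>?A. p m \<otimes> monomial n x m) \<otimes> x i"
      by (rule finsum_ldistr[symmetric]) (use fp mc xi in auto)
    also have "(\<Oplus>m\<in>?A. p m \<otimes> monomial n x m) = F x"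
      by (subst p(2)[OF x, symmetric], rule mpoly_eval_superset[symmetric]) (use fp x in auto)
    finally show ?thesis .
  qed
  moreover have "indexed_pmult p i \<in> indexed_pset {..<n} (carrier R)"
    using p(1) var_mult.hyps(2) by (simp add: indexed_pset.indexed_pmult)
  ultimately show ?case by (intro bexI[of _ "indexed_pmult p i"]) auto
qed

end

lemma (in ring_hom_cring) mpoly_eval_hom:
  assumes p: "\<And>m. p m \<in> carrier R" and x: "x \<in> {..<n} \<rightarrow> carrier R"
    and fin: "finite {m. p m \<noteq> \<zero>\<^bsub>R\<^esub>}"
  shows "mpoly_eval R S h n (\<lambda>i\<in>{..<n}. h (x i)) p = h (mpoly_eval R R (\<lambda>a. a) n x p)"
proof -
  have mono: "(\<Otimes>\<^bsub>S\<^esub>i\<in>{..<n}. (\<lambda>i\<in>{..<n}. h (x i)) i [^]\<^bsub>S\<^esub> count m i) = h (R.monomial n x m)" for m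
  proof -
    have "h (R.monomial n x m) = (\<Otimes>\<^bsub>S\<^esub>i\<in>{..<n}. h (x i [^]\<^bsub>R\<^esub> count m i))"
      using x by (subst hom_finprod) (auto simp: Pi_def comp_def)
    also have "\<dots> = (\<Otimes>\<^bsub>S\<^esub>i\<in>{..<n}. (\<lambda>i\<in>{..<n}. h (x i)) i [^]\<^bsub>S\<^esub> count m i)"
      by (rule S.finprod_cong') (use x in \<open>auto simp: Pi_def\<close>)
    finally show ?thesis by simp
  qed
  have "h (mpoly_eval R R (\<lambda>a. a) n x p) = (\<Oplus>\<^bsub>S\<^esub>m\<in>{m. p m \<noteq> \<zero>\<^bsub>R\<^esub>}. h (p m \<otimes>\<^bsub>R\<^esub> R.monomial n x m))"
    unfolding mpoly_eval_def using p R.monomial_closed[OF x]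
    by (subst hom_finsum) (auto simp: comp_def)
  also have "\<dots> = mpoly_eval R S h n (\<lambda>i\<in>{..<n}. h (x i)) p"
    unfolding mpoly_eval_def mono
    by (rule S.finsum_cong') (use p R.monomial_closed[OF x] in auto)
  finally show ?thesis by simp
qed


text \<open>The LG property without reference to polynomials and residue fields: a point of \<open>(R/\<mm>)\<^sup>n\<close> is replaced by
  a lift to \<open>R\<^sup>n\<close>.\<close>

lemma (in cring) LG_ring_poly_on:
  assumes LG: "LG_ring R" and F: "poly_on n F"
    and loc: "\<And>\<mm>. maximalideal \<mm> R \<Longrightarrow> \<exists>x\<in>{..<n} \<rightarrow> carrier R. F x \<notin> \<mm>"
  shows "\<exists>x\<in>{..<n} \<rightarrow> carrier R. F x \<in> Units R"
proof -
  obtain p where p: "p \<in> indexed_pset {..<n} (carrier R)"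
    and ev: "\<And>x. x\<in>{..<n} \<rightarrow> carrier R \<Longrightarrow> mpoly_eval R R (\<lambda>a. a) n x p = F x"
    using F polyfun_is_mpoly_eval unfolding poly_on_def by metis
  note fp = indexed_pset_finite_support[OF p]
  let ?E = "\<lambda>x. mpoly_eval R R (\<lambda>a. a) n x p"
  have loc': "\<exists>x\<in>{..<n} \<rightarrow>\<^sub>E carrier (R Quot \<mm>).
          mpoly_eval R (R Quot \<mm>) (\<lambda>a. \<mm> +>\<^bsub>R\<^esub> a) n x p \<noteq> \<zero>\<^bsub>R Quot \<mm>\<^esub>"
    if m: "maximalideal \<mm> R" for \<mm>
  proof -
    interpret m: maximalideal \<mm> R by fact
    interpret q: ring_hom_cring R "R Quot \<mm>" "(+>) \<mm>" by (rule m.rcos_ring_hom_cring[OF is_cring])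
    from loc[OF m] obtain x where x: "x \<in> {..<n} \<rightarrow> carrier R" "F x \<notin> \<mm>" by (elim bexE)
    have "mpoly_eval R (R Quot \<mm>) ((+>) \<mm>) n (\<lambda>i\<in>{..<n}. \<mm> +> x i) p = \<mm> +> ?E x"
      by (rule q.mpoly_eval_hom[OF _ x(1)]) (simp_all only: fp)
    moreover have "\<mm> +> F x \<noteq> \<mm>"
      using x(2) m.rcos_const_imp_mem[OF poly_on_closed[OF F x(1)]] by (intro notI) (simp only: simp_thms)
    ultimately have "mpoly_eval R (R Quot \<mm>) ((+>) \<mm>) n (\<lambda>i\<in>{..<n}. \<mm> +> x i) p \<noteq> \<zero>\<^bsub>R Quot \<mm>\<^esub>"
      unfolding FactRing_def ev[OF x(1)] by simp
    moreover have "(\<lambda>i\<in>{..<n}. \<mm> +> x i) \<in> {..<n} \<rightarrow>\<^sub>E carrier (R Quot \<mm>)"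
      using x(1) by (intro restrict_PiE_iff[THEN iffD2]) (simp add: Pi_iff)
    ultimately show ?thesis by (intro bexI)
  qed
  have "p \<in> carrier (mpoly_ring R n)" using p by (simp add: mpoly_ring_def)
  then have "(\<exists>x\<in>{..<n} \<rightarrow>\<^sub>E carrier R. ?E x \<in> Units R)"
    using LG loc' unfolding LG_ring_def by simp
  then obtain x where x: "x \<in> {..<n} \<rightarrow>\<^sub>E carrier R" "?E x \<in> Units R" by (elim bexE)
  then have xc: "x \<in> {..<n} \<rightarrow> carrier R" by (simp add: PiE_def)
  then show ?thesis using ev[OF xc] x(2) by (intro bexI[of _ x]) simp_all
qed

context cring
begin

text \<open>An equation follows from others when it is a linear combination of them.\<close>

lemma linear_combination:
  assumes "l = r" "L \<ominus> K = c \<otimes> (l \<ominus> r)" "l \<in> carrier R" "c \<in> carrier R" "L \<in> carrier R" "K \<in> carrier R"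
  shows "L = K"
proof -
  have "L \<ominus> K = \<zero>" using assms by (simp add: minus_eq r_neg)
  then show ?thesis using assms by (simp add: r_right_minus_eq)
qed

lemma linear_combination2:
  assumes "l = r" "l' = r'" "L \<ominus> K = c \<otimes> (l \<ominus> r) \<oplus> c' \<otimes> (l' \<ominus> r')"
    "l \<in> carrier R" "c \<in> carrier R" "l' \<in> carrier R" "c' \<in> carrier R" "L \<in> carrier R" "K \<in> carrier R"
  shows "L = K"
proof -
  have "L \<ominus> K = \<zero>" using assms by (simp add: minus_eq r_neg)
  then show ?thesis using assms by (simp add: r_right_minus_eq)
qed

lemma primeideal_mult_notin:
  assumes "primeideal p R" "a \<in> carrier R" "b \<in> carrier R" "a \<notin> p" "b \<notin> p"
  shows "a \<otimes> b \<notin> p"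
  using primeideal.I_prime[OF assms(1)] assms by metis

lemma primeideal_one_notin:
  assumes "primeideal p R" shows "\<one> \<notin> p"
  using primeideal.I_notcarr[OF assms] ideal.one_imp_carrier[OF primeideal.axioms(1)[OF assms]] by metis

end

section \<open>Local coordinates\<close>

context ring_hom_cring
begin

definition linear_form :: "('c \<Rightarrow> 'a) \<Rightarrow> bool" where
  "linear_form A \<longleftrightarrow> A \<in> carrier S \<rightarrow> carrier R \<and>
    (\<forall>s\<in>carrier S. \<forall>t\<in>carrier S. A (s \<oplus>\<^bsub>S\<^esub> t) = A s \<oplus> A t) \<and>
    (\<forall>r\<in>carrier R. \<forall>s\<in>carrier S. A (h r \<otimes>\<^bsub>S\<^esub> s) = r \<otimes> A s)"

lemma linear_formD:
  assumes "linear_form A"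
  shows "s \<in> carrier S \<Longrightarrow> A s \<in> carrier R"
    "s \<in> carrier S \<Longrightarrow> t \<in> carrier S \<Longrightarrow> A (s \<oplus>\<^bsub>S\<^esub> t) = A s \<oplus> A t"
    "r \<in> carrier R \<Longrightarrow> s \<in> carrier S \<Longrightarrow> A (h r \<otimes>\<^bsub>S\<^esub> s) = r \<otimes> A s"
  using assms unfolding linear_form_def by auto

lemma linear_form_zero: "linear_form (\<lambda>s. \<zero>)"
  unfolding linear_form_def by simp

lemma linear_form_add: "linear_form A \<Longrightarrow> linear_form B \<Longrightarrow> linear_form (\<lambda>s. A s \<oplus> B s)"
  unfolding linear_form_def by (auto simp: R.a_ac R.r_distr Pi_def)

lemma linear_form_scale: "linear_form A \<Longrightarrow> c \<in> carrier R \<Longrightarrow> linear_form (\<lambda>s. c \<otimes> A s)"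
  unfolding linear_form_def by (auto simp: R.m_ac R.r_distr Pi_def)

text \<open>An elementwise way of saying that \<open>x\<close> and \<open>y\<close> form a basis of the localization of \<open>S\<close> at \<open>p\<close>.\<close>

definition basis_at :: "'a set \<Rightarrow> 'c \<Rightarrow> 'c \<Rightarrow> bool" where
  "basis_at p x y \<longleftrightarrow> x \<in> carrier S \<and> y \<in> carrier S \<and>
    (\<forall>s\<in>carrier S. \<exists>w\<in>carrier R - p. \<exists>a\<in>carrier R. \<exists>b\<in>carrier R.
       h w \<otimes>\<^bsub>S\<^esub> s = h a \<otimes>\<^bsub>S\<^esub> x \<oplus>\<^bsub>S\<^esub> h b \<otimes>\<^bsub>S\<^esub> y) \<and>
    (\<forall>a\<in>carrier R. \<forall>b\<in>carrier R. h a \<otimes>\<^bsub>S\<^esub> x \<oplus>\<^bsub>S\<^esub> h b \<otimes>\<^bsub>S\<^esub> y = \<zero>\<^bsub>S\<^esub> \<longrightarrow>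
       (\<exists>w\<in>carrier R - p. w \<otimes> a = \<zero> \<and> w \<otimes> b = \<zero>))"

lemma basis_atD:
  assumes "basis_at p x y"
  shows "x \<in> carrier S" "y \<in> carrier S"
   and "\<And>s. s \<in> carrier S \<Longrightarrow> \<exists>w a b. w \<in> carrier R \<and> w \<notin> p \<and> a \<in> carrier R \<and> b \<in> carrier R \<and>
       h w \<otimes>\<^bsub>S\<^esub> s = h a \<otimes>\<^bsub>S\<^esub> x \<oplus>\<^bsub>S\<^esub> h b \<otimes>\<^bsub>S\<^esub> y"
   and "\<And>a b. a \<in> carrier R \<Longrightarrow> b \<in> carrier R \<Longrightarrow> h a \<otimes>\<^bsub>S\<^esub> x \<oplus>\<^bsub>S\<^esub> h b \<otimes>\<^bsub>S\<^esub> y = \<zero>\<^bsub>S\<^esub> \<Longrightarrow>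
       \<exists>w. w \<in> carrier R \<and> w \<notin> p \<and> w \<otimes> a = \<zero> \<and> w \<otimes> b = \<zero>"
  using assms unfolding basis_at_def by (simp_all, blast+)

lemma basis_at_commute:
  assumes "basis_at p x y" shows "basis_at p y x"
  unfolding basis_at_def
proof (intro conjI ballI impI)
  note D = basis_atD[OF assms]
  show "x \<in> carrier S" "y \<in> carrier S" using D by auto
  fix s assume "s \<in> carrier S"
  then obtain w a b where "w \<in> carrier R" "w \<notin> p" "a \<in> carrier R" "b \<in> carrier R"
      "h w \<otimes>\<^bsub>S\<^esub> s = h a \<otimes>\<^bsub>S\<^esub> x \<oplus>\<^bsub>S\<^esub> h b \<otimes>\<^bsub>S\<^esub> y" using D(3) by metis
  then show "\<exists>w\<in>carrier R - p. \<exists>a\<in>carrier R. \<exists>b\<in>carrier R. h w \<otimes>\<^bsub>S\<^esub> s = h a \<otimes>\<^bsub>S\<^esub> y \<oplus>\<^bsub>S\<^esub> h b \<otimes>\<^bsub>S\<^esub> x"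
    using D(1,2) by (intro bexI[of _ w] bexI[of _ a] bexI[of _ b]) (simp_all add: S.a_comm)
next
  note D = basis_atD[OF assms]
  fix a b assume ab: "a \<in> carrier R" "b \<in> carrier R" "h a \<otimes>\<^bsub>S\<^esub> y \<oplus>\<^bsub>S\<^esub> h b \<otimes>\<^bsub>S\<^esub> x = \<zero>\<^bsub>S\<^esub>"
  then have "h b \<otimes>\<^bsub>S\<^esub> x \<oplus>\<^bsub>S\<^esub> h a \<otimes>\<^bsub>S\<^esub> y = \<zero>\<^bsub>S\<^esub>" using D(1,2) by (simp add: S.a_comm)
  then show "\<exists>w\<in>carrier R - p. w \<otimes> a = \<zero> \<and> w \<otimes> b = \<zero>" using D(4)[OF ab(2,1)] by auto
qed

lemma basis_at_replace:
  assumes p: "primeideal p R" and bas: "basis_at p x y"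
    and u: "u \<in> carrier R" "u \<notin> p" and a0: "a0 \<in> carrier R" and b0: "b0 \<in> carrier R" "b0 \<notin> p"
    and eq: "h u = h a0 \<otimes>\<^bsub>S\<^esub> x \<oplus>\<^bsub>S\<^esub> h b0 \<otimes>\<^bsub>S\<^esub> y"
  shows "basis_at p \<one>\<^bsub>S\<^esub> x"
  unfolding basis_at_def
proof (intro conjI ballI impI)
  note D = basis_atD[OF bas]
  show "\<one>\<^bsub>S\<^esub> \<in> carrier S" "x \<in> carrier S" using D by auto
  fix s assume s: "s \<in> carrier S"
  then obtain w a b where w: "w \<in> carrier R" "w \<notin> p" "a \<in> carrier R" "b \<in> carrier R"
      "h w \<otimes>\<^bsub>S\<^esub> s = h a \<otimes>\<^bsub>S\<^esub> x \<oplus>\<^bsub>S\<^esub> h b \<otimes>\<^bsub>S\<^esub> y" using D(3) by metis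
  have "h b0 \<otimes>\<^bsub>S\<^esub> h w \<otimes>\<^bsub>S\<^esub> s = h b \<otimes>\<^bsub>S\<^esub> h u \<otimes>\<^bsub>S\<^esub> \<one>\<^bsub>S\<^esub> \<oplus>\<^bsub>S\<^esub> (h b0 \<otimes>\<^bsub>S\<^esub> h a \<ominus>\<^bsub>S\<^esub> h b \<otimes>\<^bsub>S\<^esub> h a0) \<otimes>\<^bsub>S\<^esub> x"
    by (rule S.linear_combination2[OF w(5) eq, of _ _ "h b0" "\<ominus>\<^bsub>S\<^esub> h b"],
        rule S.ring_identityI[of _ "[h b0, h w, s, h b, h u, h a, h a0, x, y]"], (rule S.reify_rules)+)
      (use D(1,2) s w(1-4) u a0 b0 in \<open>simp_all add: S.in_carrier_simps norm_simps\<close>)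
  then have "h (b0 \<otimes> w) \<otimes>\<^bsub>S\<^esub> s = h (b \<otimes> u) \<otimes>\<^bsub>S\<^esub> \<one>\<^bsub>S\<^esub> \<oplus>\<^bsub>S\<^esub> h (b0 \<otimes> a \<ominus> b \<otimes> a0) \<otimes>\<^bsub>S\<^esub> x"
    using s w(1-4) u a0 b0 by (simp add: R.minus_eq S.minus_eq)
  moreover have "b0 \<otimes> w \<in> carrier R - p" using R.primeideal_mult_notin[OF p] w b0 by simp
  ultimately show "\<exists>w\<in>carrier R - p. \<exists>a\<in>carrier R. \<exists>b\<in>carrier R. h w \<otimes>\<^bsub>S\<^esub> s = h a \<otimes>\<^bsub>S\<^esub> \<one>\<^bsub>S\<^esub> \<oplus>\<^bsub>S\<^esub> h b \<otimes>\<^bsub>S\<^esub> x"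
    using w(1-4) u a0 b0
    by (intro bexI[of _ "b0 \<otimes> w"] bexI[of _ "b \<otimes> u"] bexI[of _ "b0 \<otimes> a \<ominus> b \<otimes> a0"]) simp_all
next
  note D = basis_atD[OF bas]
  fix c d assume cd: "c \<in> carrier R" "d \<in> carrier R" "h c \<otimes>\<^bsub>S\<^esub> \<one>\<^bsub>S\<^esub> \<oplus>\<^bsub>S\<^esub> h d \<otimes>\<^bsub>S\<^esub> x = \<zero>\<^bsub>S\<^esub>"
  have "(h c \<otimes>\<^bsub>S\<^esub> h a0 \<oplus>\<^bsub>S\<^esub> h u \<otimes>\<^bsub>S\<^esub> h d) \<otimes>\<^bsub>S\<^esub> x \<oplus>\<^bsub>S\<^esub> (h c \<otimes>\<^bsub>S\<^esub> h b0) \<otimes>\<^bsub>S\<^esub> y = \<zero>\<^bsub>S\<^esub>"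
    by (rule S.linear_combination2[OF cd(3) eq, of _ _ "h u" "\<ominus>\<^bsub>S\<^esub> h c"],
        rule S.ring_identityI[of _ "[h c, h d, h u, h a0, h b0, x, y]"], (rule S.reify_rules)+)
      (use D(1,2) cd(1,2) u a0 b0 in \<open>simp_all add: S.in_carrier_simps norm_simps\<close>)
  then have "h (c \<otimes> a0 \<oplus> u \<otimes> d) \<otimes>\<^bsub>S\<^esub> x \<oplus>\<^bsub>S\<^esub> h (c \<otimes> b0) \<otimes>\<^bsub>S\<^esub> y = \<zero>\<^bsub>S\<^esub>"
    using cd(1,2) u a0 b0 by simp
  then obtain v where v: "v \<in> carrier R" "v \<notin> p" "v \<otimes> (c \<otimes> a0 \<oplus> u \<otimes> d) = \<zero>" "v \<otimes> (c \<otimes> b0) = \<zero>"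
    using D(4)[of "c \<otimes> a0 \<oplus> u \<otimes> d" "c \<otimes> b0"] cd(1,2) u a0 b0 by auto
  have 1: "v \<otimes> b0 \<otimes> u \<otimes> c = \<zero>"
    by (rule R.linear_combination[OF v(4), of _ _ u],
        rule R.ring_identityI[of _ "[v, c, b0, u]"], (rule R.reify_rules)+)
      (use v(1) cd(1,2) u a0 b0 in \<open>simp_all add: R.in_carrier_simps norm_simps\<close>)
  have 2: "v \<otimes> b0 \<otimes> u \<otimes> d = \<zero>"
    by (rule R.linear_combination2[OF v(3,4), of _ _ b0 "\<ominus> a0"],
        rule R.ring_identityI[of _ "[v, c, b0, u, d, a0]"], (rule R.reify_rules)+)
      (use v(1) cd(1,2) u a0 b0 in \<open>simp_all add: R.in_carrier_simps norm_simps\<close>)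
  have "v \<otimes> b0 \<otimes> u \<in> carrier R - p" using R.primeideal_mult_notin[OF p] v b0 u by simp
  then show "\<exists>w\<in>carrier R - p. w \<otimes> c = \<zero> \<and> w \<otimes> d = \<zero>" using 1 2 by (intro bexI conjI)
qed

text \<open>Since \<open>1\<close> generates \<open>S\<close> as an ideal, not both of its coordinates lie in \<open>p\<close>, so it can replace one
  of the two basis vectors.\<close>

lemma basis_at_one:
  assumes p: "primeideal p R" and bas: "basis_at p x y"
  obtains z where "basis_at p \<one>\<^bsub>S\<^esub> z"
proof -
  interpret p: primeideal p R by fact
  note D = basis_atD[OF bas]
  obtain u a0 b0 where u: "u \<in> carrier R" "u \<notin> p" "a0 \<in> carrier R" "b0 \<in> carrier R"
      and eq': "h u \<otimes>\<^bsub>S\<^esub> \<one>\<^bsub>S\<^esub> = h a0 \<otimes>\<^bsub>S\<^esub> x \<oplus>\<^bsub>S\<^esub> h b0 \<otimes>\<^bsub>S\<^esub> y" using D(3)[of "\<one>\<^bsub>S\<^esub>"] by auto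
  have eq: "h u = h a0 \<otimes>\<^bsub>S\<^esub> x \<oplus>\<^bsub>S\<^esub> h b0 \<otimes>\<^bsub>S\<^esub> y" using eq' u by simp
  have eq2: "h u = h b0 \<otimes>\<^bsub>S\<^esub> y \<oplus>\<^bsub>S\<^esub> h a0 \<otimes>\<^bsub>S\<^esub> x" using eq u D(1,2) by (simp add: S.a_comm)
  have "a0 \<notin> p \<or> b0 \<notin> p"
  proof (rule ccontr)
    assume "\<not> ?thesis"
    then have ab: "a0 \<in> p" "b0 \<in> p" by auto
    obtain w a b where w: "w \<in> carrier R" "w \<notin> p" "a \<in> carrier R" "b \<in> carrier R"
      and e1: "h w \<otimes>\<^bsub>S\<^esub> (x \<otimes>\<^bsub>S\<^esub> x) = h a \<otimes>\<^bsub>S\<^esub> x \<oplus>\<^bsub>S\<^esub> h b \<otimes>\<^bsub>S\<^esub> y" using D(3)[of "x \<otimes>\<^bsub>S\<^esub> x"] D(1) by auto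
    obtain w' a' b' where w': "w' \<in> carrier R" "w' \<notin> p" "a' \<in> carrier R" "b' \<in> carrier R"
      and e2: "h w' \<otimes>\<^bsub>S\<^esub> (y \<otimes>\<^bsub>S\<^esub> x) = h a' \<otimes>\<^bsub>S\<^esub> x \<oplus>\<^bsub>S\<^esub> h b' \<otimes>\<^bsub>S\<^esub> y" using D(3)[of "y \<otimes>\<^bsub>S\<^esub> x"] D(1,2) by auto
    note cl = D(1,2) u w w'
    let ?c = "w \<otimes> w' \<otimes> u \<ominus> a0 \<otimes> w' \<otimes> a \<ominus> b0 \<otimes> w \<otimes> a'" and ?d = "\<ominus> (a0 \<otimes> w' \<otimes> b \<oplus> b0 \<otimes> w \<otimes> b')"
    have "h w \<otimes>\<^bsub>S\<^esub> h w' \<otimes>\<^bsub>S\<^esub> x \<otimes>\<^bsub>S\<^esub> h u = h a0 \<otimes>\<^bsub>S\<^esub> h w' \<otimes>\<^bsub>S\<^esub> (h w \<otimes>\<^bsub>S\<^esub> (x \<otimes>\<^bsub>S\<^esub> x)) \<oplus>\<^bsub>S\<^esub> h b0 \<otimes>\<^bsub>S\<^esub> h w \<otimes>\<^bsub>S\<^esub> (h w' \<otimes>\<^bsub>S\<^esub> (y \<otimes>\<^bsub>S\<^esub> x))"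
      by (rule S.linear_combination[OF eq, of _ _ "h w \<otimes>\<^bsub>S\<^esub> h w' \<otimes>\<^bsub>S\<^esub> x"],
          rule S.ring_identityI[of _ "[h w, h w', h a0, h b0, h u, x, y]"], (rule S.reify_rules)+)
        (use cl in \<open>simp_all add: S.in_carrier_simps norm_simps\<close>)
    then have e3: "h w \<otimes>\<^bsub>S\<^esub> h w' \<otimes>\<^bsub>S\<^esub> x \<otimes>\<^bsub>S\<^esub> h u = h a0 \<otimes>\<^bsub>S\<^esub> h w' \<otimes>\<^bsub>S\<^esub> (h a \<otimes>\<^bsub>S\<^esub> x \<oplus>\<^bsub>S\<^esub> h b \<otimes>\<^bsub>S\<^esub> y) \<oplus>\<^bsub>S\<^esub> h b0 \<otimes>\<^bsub>S\<^esub> h w \<otimes>\<^bsub>S\<^esub> (h a' \<otimes>\<^bsub>S\<^esub> x \<oplus>\<^bsub>S\<^esub> h b' \<otimes>\<^bsub>S\<^esub> y)"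
      unfolding e1 e2 .
    have "(h w \<otimes>\<^bsub>S\<^esub> h w' \<otimes>\<^bsub>S\<^esub> h u \<ominus>\<^bsub>S\<^esub> h a0 \<otimes>\<^bsub>S\<^esub> h w' \<otimes>\<^bsub>S\<^esub> h a \<ominus>\<^bsub>S\<^esub> h b0 \<otimes>\<^bsub>S\<^esub> h w \<otimes>\<^bsub>S\<^esub> h a') \<otimes>\<^bsub>S\<^esub> x \<oplus>\<^bsub>S\<^esub> (\<ominus>\<^bsub>S\<^esub> (h a0 \<otimes>\<^bsub>S\<^esub> h w' \<otimes>\<^bsub>S\<^esub> h b \<oplus>\<^bsub>S\<^esub> h b0 \<otimes>\<^bsub>S\<^esub> h w \<otimes>\<^bsub>S\<^esub> h b')) \<otimes>\<^bsub>S\<^esub> y = \<zero>\<^bsub>S\<^esub>"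
      by (rule S.linear_combination[OF e3, of _ _ "\<one>\<^bsub>S\<^esub>"],
          rule S.ring_identityI[of _ "[h w, h w', h a0, h b0, h u, x, y, h a, h a', h b, h b']"], (rule S.reify_rules)+)
        (use cl in \<open>simp_all add: S.in_carrier_simps norm_simps\<close>)
    then have "h ?c \<otimes>\<^bsub>S\<^esub> x \<oplus>\<^bsub>S\<^esub> h ?d \<otimes>\<^bsub>S\<^esub> y = \<zero>\<^bsub>S\<^esub>"
      using cl by (simp add: R.minus_eq S.minus_eq)
    then obtain v where v: "v \<in> carrier R" "v \<notin> p" "v \<otimes> ?c = \<zero>"
      using D(4)[of ?c ?d] cl by auto
    have "v \<otimes> (w \<otimes> w' \<otimes> u) = (v \<otimes> w' \<otimes> a) \<otimes> a0 \<oplus> (v \<otimes> w \<otimes> a') \<otimes> b0"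
      by (rule R.linear_combination[OF v(3), of _ _ \<one>],
          rule R.ring_identityI[of _ "[v, w, w', u, a0, b0, a, a']"], (rule R.reify_rules)+)
        (use cl v(1) in \<open>simp_all add: R.in_carrier_simps norm_simps\<close>)
    also have "\<dots> \<in> p"
      using ab cl v(1) by (intro R.idealD(2)[OF p.is_ideal] R.idealD(5)[OF p.is_ideal]) auto
    finally show False
      using R.primeideal_mult_notin[OF p] cl v(1,2) by simp
  qed
  then show ?thesis
  proof
    assume "b0 \<notin> p"
    then show ?thesis using that[OF basis_at_replace[OF p bas u(1-3) u(4) _ eq]] by simp
  next
    assume "a0 \<notin> p"
    then show ?thesis
      using that[OF basis_at_replace[OF p basis_at_commute[OF bas] u(1,2,4) u(3) _ eq2]] by simp
  qed
qed

text \<open>\<open>A\<close> and \<open>B\<close> are \<open>f\<close> times the coordinate functions for the basis \<open>{1, z}\<close> of the localization of \<open>S\<close> at the powers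
  of \<open>f\<close>. The factor \<open>f\<close> makes them linear forms on \<open>S\<close> itself, so that no fractions are needed.\<close>

definition local_coords :: "'a set \<Rightarrow> 'a \<Rightarrow> 'c \<Rightarrow> ('c \<Rightarrow> 'a) \<Rightarrow> ('c \<Rightarrow> 'a) \<Rightarrow> bool" where
  "local_coords p f z A B \<longleftrightarrow> f \<in> carrier R \<and> f \<notin> p \<and> z \<in> carrier S \<and> linear_form A \<and> linear_form B \<and>
    (\<forall>s\<in>carrier S. h f \<otimes>\<^bsub>S\<^esub> s = h (A s) \<oplus>\<^bsub>S\<^esub> h (B s) \<otimes>\<^bsub>S\<^esub> z) \<and>
    A \<one>\<^bsub>S\<^esub> = f \<and> A z = \<zero> \<and> B \<one>\<^bsub>S\<^esub> = \<zero> \<and> B z = f"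

lemma local_coords_scale:
  assumes "local_coords p f z A B" "c \<in> carrier R" "c \<otimes> f \<notin> p"
  shows "local_coords p (c \<otimes> f) z (\<lambda>s. c \<otimes> A s) (\<lambda>s. c \<otimes> B s)"
  using assms unfolding local_coords_def
  by (auto simp: linear_form_scale linear_formD S.m_assoc S.r_distr)

text \<open>A finite system of generators whose coordinates can be chosen linearly.\<close>

definition dual_basis :: "nat \<Rightarrow> (nat \<Rightarrow> 'c \<Rightarrow> 'a) \<Rightarrow> (nat \<Rightarrow> 'c) \<Rightarrow> bool" where
  "dual_basis n \<xi> g \<longleftrightarrow> (\<forall>i<n. linear_form (\<xi> i) \<and> g i \<in> carrier S) \<and>
    (\<forall>s\<in>carrier S. s = (\<Oplus>\<^bsub>S\<^esub>i\<in>{..<n}. h (\<xi> i s) \<otimes>\<^bsub>S\<^esub> g i))"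

text \<open>The linear forms of a dual basis turn the pointwise denominators of \<open>basis_at\<close> into one common
  denominator.\<close>

lemma local_coords_exist:
  assumes p: "primeideal p R" and bas: "basis_at p \<one>\<^bsub>S\<^esub> z" and db: "dual_basis n \<xi> g"
  obtains f A B where "local_coords p f z A B"
proof -
  interpret p: primeideal p R by fact
  note D = basis_atD[OF bas]
  have z: "z \<in> carrier S" by (rule D(2))
  have lin: "\<And>i. i < n \<Longrightarrow> linear_form (\<xi> i)" and g: "\<And>i. i < n \<Longrightarrow> g i \<in> carrier S"
    and sum: "\<And>s. s \<in> carrier S \<Longrightarrow> (\<Oplus>\<^bsub>S\<^esub>i\<in>{..<n}. h (\<xi> i s) \<otimes>\<^bsub>S\<^esub> g i) = s"
    using db unfolding dual_basis_def by auto
  have "k \<le> n \<Longrightarrow> \<exists>u A B. u \<in> carrier R \<and> u \<notin> p \<and> linear_form A \<and> linear_form B \<and>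
      (\<forall>s\<in>carrier S. h u \<otimes>\<^bsub>S\<^esub> (\<Oplus>\<^bsub>S\<^esub>i\<in>{..<k}. h (\<xi> i s) \<otimes>\<^bsub>S\<^esub> g i) = h (A s) \<oplus>\<^bsub>S\<^esub> h (B s) \<otimes>\<^bsub>S\<^esub> z)" for k
  proof (induction k)
    case 0
    show ?case
      using R.primeideal_one_notin[OF p] z
      by (intro exI[of _ \<one>] exI[of _ "\<lambda>s. \<zero>"]) (auto simp: linear_form_zero)
  next
    case (Suc k)
    then obtain u A B where u: "u \<in> carrier R" "u \<notin> p" and AB: "linear_form A" "linear_form B"
      and IH: "\<And>s. s \<in> carrier S \<Longrightarrow> h u \<otimes>\<^bsub>S\<^esub> (\<Oplus>\<^bsub>S\<^esub>i\<in>{..<k}. h (\<xi> i s) \<otimes>\<^bsub>S\<^esub> g i) = h (A s) \<oplus>\<^bsub>S\<^esub> h (B s) \<otimes>\<^bsub>S\<^esub> z"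
      by auto
    have k: "k < n" using Suc.prems by simp
    obtain w a b where w: "w \<in> carrier R" "w \<notin> p" "a \<in> carrier R" "b \<in> carrier R"
      and e1: "h w \<otimes>\<^bsub>S\<^esub> g k = h a \<oplus>\<^bsub>S\<^esub> h b \<otimes>\<^bsub>S\<^esub> z"
      using D(3)[OF g[OF k]] by auto
    let ?A = "\<lambda>s. w \<otimes> A s \<oplus> (u \<otimes> a) \<otimes> \<xi> k s" and ?B = "\<lambda>s. w \<otimes> B s \<oplus> (u \<otimes> b) \<otimes> \<xi> k s"
    have "h (w \<otimes> u) \<otimes>\<^bsub>S\<^esub> (\<Oplus>\<^bsub>S\<^esub>i\<in>{..<Suc k}. h (\<xi> i s) \<otimes>\<^bsub>S\<^esub> g i) = h (?A s) \<oplus>\<^bsub>S\<^esub> h (?B s) \<otimes>\<^bsub>S\<^esub> z"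
      if s: "s \<in> carrier S" for s
    proof -
      let ?T = "\<Oplus>\<^bsub>S\<^esub>i\<in>{..<k}. h (\<xi> i s) \<otimes>\<^bsub>S\<^esub> g i" and ?x = "\<xi> k s"
      have x: "\<xi> i s \<in> carrier R" if "i < n" for i using linear_formD(1)[OF lin s] that by simp
      have T: "?T \<in> carrier S" using x g k by (intro S.finsum_closed) auto
      note cl = T x[OF k] g[OF k] u w linear_formD(1)[OF AB(1) s] linear_formD(1)[OF AB(2) s] z
      have "(\<Oplus>\<^bsub>S\<^esub>i\<in>{..<Suc k}. h (\<xi> i s) \<otimes>\<^bsub>S\<^esub> g i) = h ?x \<otimes>\<^bsub>S\<^esub> g k \<oplus>\<^bsub>S\<^esub> ?T"
        unfolding lessThan_Suc using x g k by (subst S.finsum_insert) auto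
      moreover have "h w \<otimes>\<^bsub>S\<^esub> h u \<otimes>\<^bsub>S\<^esub> (h ?x \<otimes>\<^bsub>S\<^esub> g k \<oplus>\<^bsub>S\<^esub> ?T) = (h w \<otimes>\<^bsub>S\<^esub> h (A s) \<oplus>\<^bsub>S\<^esub> h u \<otimes>\<^bsub>S\<^esub> h a \<otimes>\<^bsub>S\<^esub> h ?x)
          \<oplus>\<^bsub>S\<^esub> (h w \<otimes>\<^bsub>S\<^esub> h (B s) \<oplus>\<^bsub>S\<^esub> h u \<otimes>\<^bsub>S\<^esub> h b \<otimes>\<^bsub>S\<^esub> h ?x) \<otimes>\<^bsub>S\<^esub> z"
        by (rule S.linear_combination2[OF e1 IH[OF s], of _ _ "h u \<otimes>\<^bsub>S\<^esub> h ?x" "h w"],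
          rule S.ring_identityI[of _ "[h w, h u, h ?x, g k, ?T, h (A s), h a, h (B s), h b, z]"], (rule S.reify_rules)+)
        (use cl in \<open>simp_all add: S.in_carrier_simps norm_simps\<close>)
      ultimately show ?thesis using cl by simp
    qed
    moreover have "linear_form ?A" "linear_form ?B"
      using AB lin[OF k] u w by (simp_all add: linear_form_add linear_form_scale)
    moreover have "w \<otimes> u \<in> carrier R" "w \<otimes> u \<notin> p" using u w R.primeideal_mult_notin[OF p] by simp_all
    ultimately show ?case by (intro exI conjI ballI)
  qed
  from this[of n] obtain u A B where u: "u \<in> carrier R" "u \<notin> p" and AB: "linear_form A" "linear_form B"
      and eq: "\<And>s. s \<in> carrier S \<Longrightarrow> h u \<otimes>\<^bsub>S\<^esub> s = h (A s) \<oplus>\<^bsub>S\<^esub> h (B s) \<otimes>\<^bsub>S\<^esub> z"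
    using sum by auto
  note A = linear_formD(1)[OF AB(1)] and B = linear_formD(1)[OF AB(2)]
  have "h (A \<one>\<^bsub>S\<^esub> \<ominus> u) \<otimes>\<^bsub>S\<^esub> \<one>\<^bsub>S\<^esub> \<oplus>\<^bsub>S\<^esub> h (B \<one>\<^bsub>S\<^esub>) \<otimes>\<^bsub>S\<^esub> z = (h (A \<one>\<^bsub>S\<^esub>) \<oplus>\<^bsub>S\<^esub> h (B \<one>\<^bsub>S\<^esub>) \<otimes>\<^bsub>S\<^esub> z) \<ominus>\<^bsub>S\<^esub> h u"
    using A B u z by (simp add: R.minus_eq S.minus_eq S.a_ac)
  also have "\<dots> = \<zero>\<^bsub>S\<^esub>" using u eq[OF S.one_closed, symmetric] by (simp add: S.r_right_minus_eq)
  finally obtain v where v: "v \<in> carrier R" "v \<notin> p" "v \<otimes> (A \<one>\<^bsub>S\<^esub> \<ominus> u) = \<zero>" "v \<otimes> B \<one>\<^bsub>S\<^esub> = \<zero>"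
    using D(4)[of "A \<one>\<^bsub>S\<^esub> \<ominus> u" "B \<one>\<^bsub>S\<^esub>"] A B u by auto
  have "h (A z) \<otimes>\<^bsub>S\<^esub> \<one>\<^bsub>S\<^esub> \<oplus>\<^bsub>S\<^esub> h (B z \<ominus> u) \<otimes>\<^bsub>S\<^esub> z = (h (A z) \<oplus>\<^bsub>S\<^esub> h (B z) \<otimes>\<^bsub>S\<^esub> z) \<ominus>\<^bsub>S\<^esub> h u \<otimes>\<^bsub>S\<^esub> z"
    using A B u z by (simp add: R.minus_eq S.minus_eq S.a_ac S.l_distr S.l_minus)
  also have "\<dots> = \<zero>\<^bsub>S\<^esub>" using u z eq[OF z, symmetric] by (simp add: S.r_right_minus_eq)
  finally obtain v' where v': "v' \<in> carrier R" "v' \<notin> p" "v' \<otimes> A z = \<zero>" "v' \<otimes> (B z \<ominus> u) = \<zero>"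
    using D(4)[of "A z" "B z \<ominus> u"] A B u z by auto
  note cl = v(1) v'(1) u A[OF S.one_closed] B[OF S.one_closed] A[OF z] B[OF z]
  let ?c = "v \<otimes> v'"
  have "?c \<otimes> A \<one>\<^bsub>S\<^esub> = ?c \<otimes> u"
    by (rule R.linear_combination[OF v(3), of _ _ v'], rule R.ring_identityI[of _ "[v, v', u, A \<one>\<^bsub>S\<^esub>]"], (rule R.reify_rules)+)
      (use cl in \<open>simp_all add: R.in_carrier_simps norm_simps\<close>)
  moreover have "?c \<otimes> B z = ?c \<otimes> u"
    by (rule R.linear_combination[OF v'(4), of _ _ v], rule R.ring_identityI[of _ "[v, v', u, B z]"], (rule R.reify_rules)+)
      (use cl in \<open>simp_all add: R.in_carrier_simps norm_simps\<close>)
  moreover have "?c \<otimes> A z = \<zero>" using v'(3) cl by (simp add: R.m_assoc)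
  moreover have "?c \<otimes> B \<one>\<^bsub>S\<^esub> = \<zero>" using v(4) cl by (simp add: R.m_ac)
  moreover have "?c \<otimes> u \<notin> p" using cl v(2) v'(2) u R.primeideal_mult_notin[OF p] by simp
  moreover have "h (?c \<otimes> u) \<otimes>\<^bsub>S\<^esub> s = h (?c \<otimes> A s) \<oplus>\<^bsub>S\<^esub> h (?c \<otimes> B s) \<otimes>\<^bsub>S\<^esub> z" if s: "s \<in> carrier S" for s
    using eq[OF s] cl A[OF s] B[OF s] s z by (simp add: S.m_assoc flip: S.r_distr)
  ultimately have "local_coords p (?c \<otimes> u) z (\<lambda>s. ?c \<otimes> A s) (\<lambda>s. ?c \<otimes> B s)"
    unfolding local_coords_def using cl z AB by (simp add: linear_form_scale)
  then show ?thesis by (rule that)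
qed

end

section \<open>Involutions of quadratic type\<close>

locale involution_extension = ring_hom_cring R S h for R (structure) and S (structure) and h +
  fixes \<sigma> :: "'c \<Rightarrow> 'c"
  assumes sigma_closed [simp]: "s \<in> carrier S \<Longrightarrow> \<sigma> s \<in> carrier S"
    and sigma_add [simp]: "s \<in> carrier S \<Longrightarrow> t \<in> carrier S \<Longrightarrow> \<sigma> (s \<oplus>\<^bsub>S\<^esub> t) = \<sigma> s \<oplus>\<^bsub>S\<^esub> \<sigma> t"
    and sigma_mult [simp]: "s \<in> carrier S \<Longrightarrow> t \<in> carrier S \<Longrightarrow> \<sigma> (s \<otimes>\<^bsub>S\<^esub> t) = \<sigma> s \<otimes>\<^bsub>S\<^esub> \<sigma> t"
    and sigma_h [simp]: "r \<in> carrier R \<Longrightarrow> \<sigma> (h r) = h r"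
    and sigma_sigma [simp]: "s \<in> carrier S \<Longrightarrow> \<sigma> (\<sigma> s) = s"
begin

lemma sigma_one [simp]: "\<sigma> \<one>\<^bsub>S\<^esub> = \<one>\<^bsub>S\<^esub>"
  using sigma_h[of \<one>] by simp

lemma sigma_zero [simp]: "\<sigma> \<zero>\<^bsub>S\<^esub> = \<zero>\<^bsub>S\<^esub>"
  using sigma_h[of \<zero>] by simp

lemma sigma_minus [simp]: "s \<in> carrier S \<Longrightarrow> \<sigma> (\<ominus>\<^bsub>S\<^esub> s) = \<ominus>\<^bsub>S\<^esub> \<sigma> s"
  using S.minus_equality[of "\<sigma> (\<ominus>\<^bsub>S\<^esub> s)" "\<sigma> s"] sigma_add[of "\<ominus>\<^bsub>S\<^esub> s" s] by (simp add: S.l_neg)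

lemma sigma_diff [simp]:
  "s \<in> carrier S \<Longrightarrow> t \<in> carrier S \<Longrightarrow> \<sigma> (s \<ominus>\<^bsub>S\<^esub> t) = \<sigma> s \<ominus>\<^bsub>S\<^esub> \<sigma> t"
  by (simp add: S.minus_eq)

text \<open>With \<open>a = B(z\<^sup>2) / f\<close> and \<open>b = A(z\<^sup>2) / f\<close> one has \<open>z\<^sup>2 = az + b\<close>; the condition added here is
  \<open>\<sigma>(z) = a - z\<close>.\<close>

definition quad_coords :: "'a set \<Rightarrow> 'a \<Rightarrow> 'c \<Rightarrow> ('c \<Rightarrow> 'a) \<Rightarrow> ('c \<Rightarrow> 'a) \<Rightarrow> bool" where
  "quad_coords p f z A B \<longleftrightarrow> local_coords p f z A B \<and> h f \<otimes>\<^bsub>S\<^esub> (z \<oplus>\<^bsub>S\<^esub> \<sigma> z) = h (B (z \<otimes>\<^bsub>S\<^esub> z))"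

lemma quad_coordsD:
  assumes "quad_coords p f z A B"
  shows "f \<in> carrier R" "f \<notin> p" "z \<in> carrier S" "linear_form A" "linear_form B"
    "\<And>s. s \<in> carrier S \<Longrightarrow> h f \<otimes>\<^bsub>S\<^esub> s = h (A s) \<oplus>\<^bsub>S\<^esub> h (B s) \<otimes>\<^bsub>S\<^esub> z"
    "A \<one>\<^bsub>S\<^esub> = f" "A z = \<zero>" "B \<one>\<^bsub>S\<^esub> = \<zero>" "B z = f"
    "h f \<otimes>\<^bsub>S\<^esub> (z \<oplus>\<^bsub>S\<^esub> \<sigma> z) = h (B (z \<otimes>\<^bsub>S\<^esub> z))"
    "\<And>s. s \<in> carrier S \<Longrightarrow> A s \<in> carrier R" "\<And>s. s \<in> carrier S \<Longrightarrow> B s \<in> carrier R"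
  using assms linear_formD(1)[of A] linear_formD(1)[of B] unfolding quad_coords_def local_coords_def
  by simp_all

lemma sigma_coords:
  assumes q: "quad_coords p f z A B" and s: "s \<in> carrier S"
  shows "h f \<otimes>\<^bsub>S\<^esub> \<sigma> s = h (A s) \<oplus>\<^bsub>S\<^esub> h (B s) \<otimes>\<^bsub>S\<^esub> \<sigma> z"
proof -
  note D = quad_coordsD[OF q]
  show ?thesis using arg_cong[OF D(6)[OF s], of \<sigma>] D(1,3,12,13) s by simp
qed

lemma trace_local:
  assumes q: "quad_coords p f z A B" and s: "s \<in> carrier S"
  shows "\<exists>r\<in>carrier R. h (f \<otimes> f) \<otimes>\<^bsub>S\<^esub> (s \<oplus>\<^bsub>S\<^esub> \<sigma> s) = h r"
proof -
  note D = quad_coordsD[OF q]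
  let ?b = "B (z \<otimes>\<^bsub>S\<^esub> z)"
  have b: "?b \<in> carrier R" using D(3,13) by simp
  have 1: "h f \<otimes>\<^bsub>S\<^esub> (s \<oplus>\<^bsub>S\<^esub> \<sigma> s) = h (A s) \<oplus>\<^bsub>S\<^esub> h (A s) \<oplus>\<^bsub>S\<^esub> h (B s) \<otimes>\<^bsub>S\<^esub> (z \<oplus>\<^bsub>S\<^esub> \<sigma> z)"
    by (rule S.linear_combination2[OF D(6)[OF s] sigma_coords[OF q s], of _ _ "\<one>\<^bsub>S\<^esub>" "\<one>\<^bsub>S\<^esub>"],
        rule S.ring_identityI[of _ "[h f, s, \<sigma> s, h (A s), h (B s), z, \<sigma> z]"], (rule S.reify_rules)+)
      (use D(1,3,12,13) s in \<open>simp_all add: S.in_carrier_simps norm_simps\<close>)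
  have "h f \<otimes>\<^bsub>S\<^esub> h f \<otimes>\<^bsub>S\<^esub> (s \<oplus>\<^bsub>S\<^esub> \<sigma> s) = h f \<otimes>\<^bsub>S\<^esub> (h (A s) \<oplus>\<^bsub>S\<^esub> h (A s)) \<oplus>\<^bsub>S\<^esub> h (B s) \<otimes>\<^bsub>S\<^esub> h ?b"
    by (rule S.linear_combination2[OF 1 D(11), of _ _ "h f" "h (B s)"],
        rule S.ring_identityI[of _ "[h f, s, \<sigma> s, h (A s), h (B s), z, \<sigma> z, h ?b]"], (rule S.reify_rules)+)
      (use D(1,3,12,13) s b in \<open>simp_all add: S.in_carrier_simps norm_simps\<close>)
  then show ?thesis
    using D(1,3,12,13) s b by (intro bexI[of _ "f \<otimes> (A s \<oplus> A s) \<oplus> B s \<otimes> ?b"]) simp_all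
qed

lemma norm_local:
  assumes q: "quad_coords p f z A B" and s: "s \<in> carrier S"
  shows "\<exists>r\<in>carrier R. h (f \<otimes> f \<otimes> f) \<otimes>\<^bsub>S\<^esub> (s \<otimes>\<^bsub>S\<^esub> \<sigma> s) = h r"
proof -
  note D = quad_coordsD[OF q]
  let ?b = "B (z \<otimes>\<^bsub>S\<^esub> z)" and ?a = "A (z \<otimes>\<^bsub>S\<^esub> z)"
  have b: "?b \<in> carrier R" "?a \<in> carrier R" "z \<otimes>\<^bsub>S\<^esub> z \<in> carrier S" using D(3,12,13) by simp_all
  have "h f \<otimes>\<^bsub>S\<^esub> h f \<otimes>\<^bsub>S\<^esub> h f \<otimes>\<^bsub>S\<^esub> (s \<otimes>\<^bsub>S\<^esub> \<sigma> s) = h f \<otimes>\<^bsub>S\<^esub> ((h f \<otimes>\<^bsub>S\<^esub> s) \<otimes>\<^bsub>S\<^esub> (h f \<otimes>\<^bsub>S\<^esub> \<sigma> s))"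
    using D(1,3) s by (simp add: S.m_ac)
  also have "\<dots> = h f \<otimes>\<^bsub>S\<^esub> ((h (A s) \<oplus>\<^bsub>S\<^esub> h (B s) \<otimes>\<^bsub>S\<^esub> z) \<otimes>\<^bsub>S\<^esub> (h (A s) \<oplus>\<^bsub>S\<^esub> h (B s) \<otimes>\<^bsub>S\<^esub> \<sigma> z))"
    unfolding D(6)[OF s] sigma_coords[OF q s] ..
  also have "\<dots> = h f \<otimes>\<^bsub>S\<^esub> (h (A s) \<otimes>\<^bsub>S\<^esub> h (A s)) \<oplus>\<^bsub>S\<^esub> h (A s) \<otimes>\<^bsub>S\<^esub> h (B s) \<otimes>\<^bsub>S\<^esub> h ?b \<ominus>\<^bsub>S\<^esub> h (B s) \<otimes>\<^bsub>S\<^esub> h (B s) \<otimes>\<^bsub>S\<^esub> h ?a"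
    by (rule S.linear_combination2[OF D(11) D(6)[OF b(3)], of _ _ "h (A s) \<otimes>\<^bsub>S\<^esub> h (B s) \<oplus>\<^bsub>S\<^esub> h (B s) \<otimes>\<^bsub>S\<^esub> h (B s) \<otimes>\<^bsub>S\<^esub> z" "\<ominus>\<^bsub>S\<^esub> (h (B s) \<otimes>\<^bsub>S\<^esub> h (B s))"],
        rule S.ring_identityI[of _ "[h f, h (A s), h (B s), z, \<sigma> z, h ?b, h ?a]"], (rule S.reify_rules)+)
      (use D(1,3,12,13) s b in \<open>simp_all add: S.in_carrier_simps norm_simps\<close>)
  finally show ?thesis
    using D(1,3,12,13) s b by (intro bexI[of _ "f \<otimes> (A s \<otimes> A s) \<oplus> A s \<otimes> B s \<otimes> ?b \<ominus> B s \<otimes> B s \<otimes> ?a"]) (simp_all add: R.minus_eq S.minus_eq)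
qed

lemma range_quotient_ideal:
  assumes y: "y \<in> carrier S"
  shows "ideal {r \<in> carrier R. \<exists>t\<in>carrier R. h r \<otimes>\<^bsub>S\<^esub> y = h t} R"
proof (rule R.idealI_comm)
  show "\<zero> \<in> {r \<in> carrier R. \<exists>t\<in>carrier R. h r \<otimes>\<^bsub>S\<^esub> y = h t}"
    using y by (auto intro!: bexI[of _ \<zero>])
next
  fix a b assume "a \<in> {r \<in> carrier R. \<exists>t\<in>carrier R. h r \<otimes>\<^bsub>S\<^esub> y = h t}" "b \<in> {r \<in> carrier R. \<exists>t\<in>carrier R. h r \<otimes>\<^bsub>S\<^esub> y = h t}"
  then obtain t u where "a \<in> carrier R" "b \<in> carrier R" "t \<in> carrier R" "u \<in> carrier R"
    "h a \<otimes>\<^bsub>S\<^esub> y = h t" "h b \<otimes>\<^bsub>S\<^esub> y = h u" by auto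
  then show "a \<oplus> b \<in> {r \<in> carrier R. \<exists>t\<in>carrier R. h r \<otimes>\<^bsub>S\<^esub> y = h t}"
    using y by (auto simp: S.l_distr intro!: bexI[of _ "t \<oplus> u"])
next
  fix a r assume "a \<in> {r \<in> carrier R. \<exists>t\<in>carrier R. h r \<otimes>\<^bsub>S\<^esub> y = h t}" and r: "r \<in> carrier R"
  then obtain t where "a \<in> carrier R" "t \<in> carrier R" "h a \<otimes>\<^bsub>S\<^esub> y = h t" by auto
  then show "r \<otimes> a \<in> {r \<in> carrier R. \<exists>t\<in>carrier R. h r \<otimes>\<^bsub>S\<^esub> y = h t}"
    using y r by (auto simp: S.m_assoc intro!: bexI[of _ "r \<otimes> t"])
qed auto

lemma local_in_range:
  assumes y: "y \<in> carrier S"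
    and loc: "\<And>\<mm>. maximalideal \<mm> R \<Longrightarrow> \<exists>f\<in>carrier R - \<mm>. \<exists>r\<in>carrier R. h f \<otimes>\<^bsub>S\<^esub> y = h r"
  shows "\<exists>r\<in>carrier R. y = h r"
proof -
  have "\<one> \<in> {r \<in> carrier R. \<exists>t\<in>carrier R. h r \<otimes>\<^bsub>S\<^esub> y = h t}"
  proof (rule R.one_in_idealI[OF range_quotient_ideal[OF y]])
    fix \<mm> assume "maximalideal \<mm> R"
    from loc[OF this] show "\<exists>r\<in>{r \<in> carrier R. \<exists>t\<in>carrier R. h r \<otimes>\<^bsub>S\<^esub> y = h t}. r \<notin> \<mm>" by auto
  qed
  then show ?thesis using y by auto
qed

text \<open>The contraction to \<open>S\<close> of the ideal of \<open>S\<^sub>\<mm>\<close> generated by \<open>\<mm>\<close> is described by the coordinates, so a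
  maximal ideal of \<open>S\<close> over \<open>\<mm>\<close> exists.\<close>

lemma maximalideal_over:
  assumes m: "maximalideal \<mm> R" and q: "quad_coords \<mm> f z A B"
  obtains Q where "maximalideal Q S" "\<And>r. r \<in> \<mm> \<Longrightarrow> h r \<in> Q" "\<And>r. r \<in> carrier R \<Longrightarrow> r \<notin> \<mm> \<Longrightarrow> h r \<notin> Q"
proof -
  interpret m: maximalideal \<mm> R by fact
  note D = quad_coordsD[OF q]
  note id = R.idealD[OF m.is_ideal]
  have p: "primeideal \<mm> R" by (rule R.maximalideal_prime[OF m])
  let ?J = "{s \<in> carrier S. A s \<in> \<mm> \<and> B s \<in> \<mm>}"
  have hrA: "C (h r \<otimes>\<^bsub>S\<^esub> s) = r \<otimes> C s" if "C = A \<or> C = B" "r \<in> carrier R" "s \<in> carrier S" for C r s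
    using that linear_formD(3)[OF D(4)] linear_formD(3)[OF D(5)] by auto
  have Aadd: "C (s \<oplus>\<^bsub>S\<^esub> t) = C s \<oplus> C t" if "C = A \<or> C = B" "s \<in> carrier S" "t \<in> carrier S" for C s t
    using that linear_formD(2)[OF D(4)] linear_formD(2)[OF D(5)] by auto
  have "ideal ?J S"
  proof (rule S.idealI_comm)
    have C0: "C \<zero>\<^bsub>S\<^esub> = \<zero>" if "C = A \<or> C = B" for C
      using hrA[OF that, of \<zero> "\<zero>\<^bsub>S\<^esub>"] that D(12,13)[OF S.zero_closed] by auto
    show "\<zero>\<^bsub>S\<^esub> \<in> ?J" using id(1) C0[of A] C0[of B] by simp
  next
    fix s t assume "s \<in> ?J" "t \<in> ?J"
    then show "s \<oplus>\<^bsub>S\<^esub> t \<in> ?J" using Aadd[of A s t] Aadd[of B s t] id(2) by simp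
  next
    fix s t assume s: "s \<in> ?J" and t: "t \<in> carrier S"
    have "C (t \<otimes>\<^bsub>S\<^esub> s) \<in> \<mm>" if C: "C = A \<or> C = B" for C
    proof (rule ccontr)
      assume neg: "C (t \<otimes>\<^bsub>S\<^esub> s) \<notin> \<mm>"
      have sc: "s \<in> carrier S" "A s \<in> carrier R" "B s \<in> carrier R" using s D by auto
      have Cc: "C u \<in> carrier R" if "u \<in> carrier S" for u using C D(12,13) that by auto
      have "h f \<otimes>\<^bsub>S\<^esub> (t \<otimes>\<^bsub>S\<^esub> s) = t \<otimes>\<^bsub>S\<^esub> (h f \<otimes>\<^bsub>S\<^esub> s)" using D(1) t sc by (simp add: S.m_ac)
      also have "\<dots> = h (A s) \<otimes>\<^bsub>S\<^esub> t \<oplus>\<^bsub>S\<^esub> h (B s) \<otimes>\<^bsub>S\<^esub> (z \<otimes>\<^bsub>S\<^esub> t)"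
        unfolding D(6)[OF sc(1)] using D(3) t sc by (simp add: S.r_distr S.m_ac)
      finally have "f \<otimes> C (t \<otimes>\<^bsub>S\<^esub> s) = A s \<otimes> C t \<oplus> B s \<otimes> C (z \<otimes>\<^bsub>S\<^esub> t)"
        using hrA[OF C] Aadd[OF C] D(1,3) t sc by (metis hom_closed S.m_closed)
      also have "\<dots> \<in> \<mm>" using s t sc D(3) Cc by (intro id(2) id(6)) auto
      finally show False using R.primeideal_mult_notin[OF p D(1) _ D(2) neg] Cc t sc by simp
    qed
    then show "t \<otimes>\<^bsub>S\<^esub> s \<in> ?J" using s t by simp
  qed auto
  moreover have "\<one>\<^bsub>S\<^esub> \<notin> ?J" using D(2,7) by simp
  ultimately obtain Q where Q: "maximalideal Q S" "?J \<subseteq> Q" by (rule S.exists_maximalideal)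
  interpret Q: maximalideal Q S by fact
  have over: "h r \<in> Q" if "r \<in> \<mm>" for r
  proof -
    have r: "r \<in> carrier R" using that m.Icarr by simp
    have "A (h r \<otimes>\<^bsub>S\<^esub> \<one>\<^bsub>S\<^esub>) = r \<otimes> f" "B (h r \<otimes>\<^bsub>S\<^esub> \<one>\<^bsub>S\<^esub>) = \<zero>" using r hrA[of A r "\<one>\<^bsub>S\<^esub>"] hrA[of B r "\<one>\<^bsub>S\<^esub>"] D(7,9) by simp_all
    then have "h r \<in> ?J" using r that D(1) id(1,6) by simp
    then show ?thesis using Q(2) by auto
  qed
  moreover have "h r \<notin> Q" if r: "r \<in> carrier R" "r \<notin> \<mm>" for r
  proof
    assume hr: "h r \<in> Q"
    obtain c where c: "c \<in> carrier R" "r \<otimes> c \<ominus> \<one> \<in> \<mm>" using R.maximalideal_inverse[OF m r] .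
    have "\<one>\<^bsub>S\<^esub> = h r \<otimes>\<^bsub>S\<^esub> h c \<ominus>\<^bsub>S\<^esub> (h r \<otimes>\<^bsub>S\<^esub> h c \<ominus>\<^bsub>S\<^esub> \<one>\<^bsub>S\<^esub>)"
      by (rule S.ring_identityI[of _ "[h r, h c]"], (rule S.reify_rules)+)
        (use r c in \<open>simp_all add: S.in_carrier_simps norm_simps\<close>)
    also have "h r \<otimes>\<^bsub>S\<^esub> h c \<ominus>\<^bsub>S\<^esub> \<one>\<^bsub>S\<^esub> = h (r \<otimes> c \<ominus> \<one>)" using r c by (simp add: R.minus_eq S.minus_eq)
    also have "h r \<otimes>\<^bsub>S\<^esub> h c \<ominus>\<^bsub>S\<^esub> \<dots> \<in> Q"
      using hr c(1) over[OF c(2)] by (intro S.idealD(4,6)[OF Q.is_ideal]) simp_all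
    finally show False using S.primeideal_one_notin[OF S.maximalideal_prime[OF Q(1)]] by simp
  qed
  ultimately show ?thesis using that Q(1) by simp
qed

text \<open>The vanishing of those derivations of \<open>S\<close> into the residue field of \<open>Q\<close> that lift to an \<open>R\<close>-linear map \<open>d\<close>
  from \<open>S\<close> to \<open>S\<close>; for the lift the Leibniz rule holds only modulo \<open>Q\<close>.\<close>

definition no_derivations :: "'c set \<Rightarrow> bool" where
  "no_derivations Q \<longleftrightarrow> (\<forall>d\<in>carrier S \<rightarrow> carrier S.
    (\<forall>s\<in>carrier S. \<forall>t\<in>carrier S. d (s \<oplus>\<^bsub>S\<^esub> t) = d s \<oplus>\<^bsub>S\<^esub> d t) \<longrightarrow>
    (\<forall>r\<in>carrier R. \<forall>s\<in>carrier S. d (h r \<otimes>\<^bsub>S\<^esub> s) = h r \<otimes>\<^bsub>S\<^esub> d s) \<longrightarrow>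
    (\<forall>s\<in>carrier S. \<forall>t\<in>carrier S. d (s \<otimes>\<^bsub>S\<^esub> t) \<ominus>\<^bsub>S\<^esub> (s \<otimes>\<^bsub>S\<^esub> d t \<oplus>\<^bsub>S\<^esub> t \<otimes>\<^bsub>S\<^esub> d s) \<in> Q) \<longrightarrow>
    (\<forall>s\<in>carrier S. d s \<in> Q))"

text \<open>If \<open>z - \<sigma>(z)\<close>, which is \<open>2z - a\<close> up to a unit for \<open>z\<^sup>2 = az + b\<close>, were in \<open>Q\<close>, then the second
  coordinate would be a nonzero derivation into the residue field.\<close>

lemma different_notin:
  assumes Q: "primeideal Q S" and q: "quad_coords p f z A B" and f: "h f \<notin> Q" and nd: "no_derivations Q"
  shows "z \<ominus>\<^bsub>S\<^esub> \<sigma> z \<notin> Q"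
proof
  assume zQ: "z \<ominus>\<^bsub>S\<^esub> \<sigma> z \<in> Q"
  interpret Q: primeideal Q S by fact
  note D = quad_coordsD[OF q]
  note id = S.idealD[OF Q.is_ideal]
  let ?b = "B (z \<otimes>\<^bsub>S\<^esub> z)"
  have b: "?b \<in> carrier R" using D(3,13) by simp
  have "h f \<otimes>\<^bsub>S\<^esub> (z \<oplus>\<^bsub>S\<^esub> z) \<ominus>\<^bsub>S\<^esub> h ?b = h f \<otimes>\<^bsub>S\<^esub> (z \<ominus>\<^bsub>S\<^esub> \<sigma> z)"
    by (rule S.linear_combination[OF D(11), of _ _ "\<one>\<^bsub>S\<^esub>"],
        rule S.ring_identityI[of _ "[h f, z, \<sigma> z, h ?b]"], (rule S.reify_rules)+)
      (use D(1,3,12,13) b in \<open>simp_all add: S.in_carrier_simps norm_simps\<close>)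
  then have diff: "h f \<otimes>\<^bsub>S\<^esub> (z \<oplus>\<^bsub>S\<^esub> z) \<ominus>\<^bsub>S\<^esub> h ?b \<in> Q" using id(5)[OF zQ] D(1) by simp
  have leib: "h (B (s \<otimes>\<^bsub>S\<^esub> t)) \<ominus>\<^bsub>S\<^esub> (s \<otimes>\<^bsub>S\<^esub> h (B t) \<oplus>\<^bsub>S\<^esub> t \<otimes>\<^bsub>S\<^esub> h (B s)) \<in> Q"
    if s: "s \<in> carrier S" and t: "t \<in> carrier S" for s t
  proof (rule ccontr)
    assume neg: "\<not> ?thesis"
    note c = D(12,13)[OF s] D(12,13)[OF t] D(1,3) b s t
    have "h (f \<otimes> f) \<otimes>\<^bsub>S\<^esub> (s \<otimes>\<^bsub>S\<^esub> t) = (h f \<otimes>\<^bsub>S\<^esub> s) \<otimes>\<^bsub>S\<^esub> (h f \<otimes>\<^bsub>S\<^esub> t)"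
      using c by (simp add: S.m_ac)
    also have "\<dots> = (h (A s) \<oplus>\<^bsub>S\<^esub> h (B s) \<otimes>\<^bsub>S\<^esub> z) \<otimes>\<^bsub>S\<^esub> (h (A t) \<oplus>\<^bsub>S\<^esub> h (B t) \<otimes>\<^bsub>S\<^esub> z)"
      unfolding D(6)[OF s] D(6)[OF t] ..
    also have "\<dots> = h (A s) \<otimes>\<^bsub>S\<^esub> h (A t) \<otimes>\<^bsub>S\<^esub> \<one>\<^bsub>S\<^esub> \<oplus>\<^bsub>S\<^esub> ((h (A s) \<otimes>\<^bsub>S\<^esub> h (B t) \<oplus>\<^bsub>S\<^esub> h (A t) \<otimes>\<^bsub>S\<^esub> h (B s)) \<otimes>\<^bsub>S\<^esub> z \<oplus>\<^bsub>S\<^esub> (h (B s) \<otimes>\<^bsub>S\<^esub> h (B t)) \<otimes>\<^bsub>S\<^esub> (z \<otimes>\<^bsub>S\<^esub> z))"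
      by (rule S.ring_identityI[of _ "[h (A s), h (B s), h (A t), h (B t), z]"], (rule S.reify_rules)+)
        (use c in \<open>simp_all add: S.in_carrier_simps norm_simps\<close>)
    also have "\<dots> = h (A s \<otimes> A t) \<otimes>\<^bsub>S\<^esub> \<one>\<^bsub>S\<^esub> \<oplus>\<^bsub>S\<^esub> (h (A s \<otimes> B t \<oplus> A t \<otimes> B s) \<otimes>\<^bsub>S\<^esub> z \<oplus>\<^bsub>S\<^esub> h (B s \<otimes> B t) \<otimes>\<^bsub>S\<^esub> (z \<otimes>\<^bsub>S\<^esub> z))"
      using c by simp
    finally have E: "h (f \<otimes> f) \<otimes>\<^bsub>S\<^esub> (s \<otimes>\<^bsub>S\<^esub> t) = \<dots>" .
    have lB: "B (h r \<otimes>\<^bsub>S\<^esub> x) = r \<otimes> B x" "B (x \<oplus>\<^bsub>S\<^esub> y) = B x \<oplus> B y" if "r \<in> carrier R" "x \<in> carrier S" "y \<in> carrier S" for r x y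
      using that linear_formD[OF D(5)] by auto
    have "(f \<otimes> f) \<otimes> B (s \<otimes>\<^bsub>S\<^esub> t) = B (h (f \<otimes> f) \<otimes>\<^bsub>S\<^esub> (s \<otimes>\<^bsub>S\<^esub> t))"
      using c by (subst lB(1)) auto
    also have "\<dots> = (A s \<otimes> A t) \<otimes> B \<one>\<^bsub>S\<^esub> \<oplus> ((A s \<otimes> B t \<oplus> A t \<otimes> B s) \<otimes> B z \<oplus> (B s \<otimes> B t) \<otimes> ?b)"
      unfolding E using c by (simp only: lB hom_closed R.m_closed R.a_closed S.m_closed S.a_closed S.one_closed)
    finally have EB: "(f \<otimes> f) \<otimes> B (s \<otimes>\<^bsub>S\<^esub> t) = (A s \<otimes> B t \<oplus> A t \<otimes> B s) \<otimes> f \<oplus> (B s \<otimes> B t) \<otimes> ?b"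
      using D(9,10) c by simp
    have cst: "B (s \<otimes>\<^bsub>S\<^esub> t) \<in> carrier R" using D(13) c by simp
    have E1: "h f \<otimes>\<^bsub>S\<^esub> h f \<otimes>\<^bsub>S\<^esub> h (B (s \<otimes>\<^bsub>S\<^esub> t)) = (h (A s) \<otimes>\<^bsub>S\<^esub> h (B t) \<oplus>\<^bsub>S\<^esub> h (A t) \<otimes>\<^bsub>S\<^esub> h (B s)) \<otimes>\<^bsub>S\<^esub> h f \<oplus>\<^bsub>S\<^esub> (h (B s) \<otimes>\<^bsub>S\<^esub> h (B t)) \<otimes>\<^bsub>S\<^esub> h ?b"
      using arg_cong[OF EB, of h] c cst by simp
    have E2: "h f \<otimes>\<^bsub>S\<^esub> h f \<otimes>\<^bsub>S\<^esub> (s \<otimes>\<^bsub>S\<^esub> h (B t) \<oplus>\<^bsub>S\<^esub> t \<otimes>\<^bsub>S\<^esub> h (B s)) = h f \<otimes>\<^bsub>S\<^esub> ((h (A s) \<oplus>\<^bsub>S\<^esub> h (B s) \<otimes>\<^bsub>S\<^esub> z) \<otimes>\<^bsub>S\<^esub> h (B t) \<oplus>\<^bsub>S\<^esub> (h (A t) \<oplus>\<^bsub>S\<^esub> h (B t) \<otimes>\<^bsub>S\<^esub> z) \<otimes>\<^bsub>S\<^esub> h (B s))"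
      by (rule S.linear_combination2[OF D(6)[OF s] D(6)[OF t], of _ _ "h f \<otimes>\<^bsub>S\<^esub> h (B t)" "h f \<otimes>\<^bsub>S\<^esub> h (B s)"],
        rule S.ring_identityI[of _ "[h f, s, t, h (B t), h (B s), h (A s), h (A t), z]"], (rule S.reify_rules)+)
        (use c in \<open>simp_all add: S.in_carrier_simps norm_simps\<close>)
    have "h f \<otimes>\<^bsub>S\<^esub> h f \<otimes>\<^bsub>S\<^esub> (h (B (s \<otimes>\<^bsub>S\<^esub> t)) \<ominus>\<^bsub>S\<^esub> (s \<otimes>\<^bsub>S\<^esub> h (B t) \<oplus>\<^bsub>S\<^esub> t \<otimes>\<^bsub>S\<^esub> h (B s)))
        = (\<ominus>\<^bsub>S\<^esub> (h (B s) \<otimes>\<^bsub>S\<^esub> h (B t))) \<otimes>\<^bsub>S\<^esub> (h f \<otimes>\<^bsub>S\<^esub> (z \<oplus>\<^bsub>S\<^esub> z) \<ominus>\<^bsub>S\<^esub> h ?b)"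
      by (rule S.linear_combination2[OF E1 E2, of _ _ "\<one>\<^bsub>S\<^esub>" "\<ominus>\<^bsub>S\<^esub> \<one>\<^bsub>S\<^esub>"],
        rule S.ring_identityI[of _ "[h f, s, t, h (B t), h (B s), h (A s), h (A t), z, h ?b, h (B (s \<otimes>\<^bsub>S\<^esub> t))]"], (rule S.reify_rules)+)
        (use c cst in \<open>simp_all add: S.in_carrier_simps norm_simps\<close>)
    also have "\<dots> \<in> Q" using id(5)[OF diff] c by simp
    finally show False
      using S.primeideal_mult_notin[OF Q S.m_closed _ S.primeideal_mult_notin[OF Q _ _ f f] neg] c cst by simp
  qed
  have "\<forall>s\<in>carrier S. h (B s) \<in> Q"
    using nd[unfolded no_derivations_def, rule_format, of "\<lambda>s. h (B s)"] leib D(13) linear_formD[OF D(5)]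
    by simp
  then show False using D(3,10) f by auto
qed

end

text \<open>All that the rest of the proof uses of a quadratic etale extension with its standard involution, apart
  from the finite generation of \<open>S\<close>.\<close>

locale etale_involution = involution_extension +
  assumes coords_exist: "\<And>\<mm>. maximalideal \<mm> R \<Longrightarrow> \<exists>f z A B. quad_coords \<mm> f z A B"
    and unramified: "\<And>Q. maximalideal Q S \<Longrightarrow> no_derivations Q"
begin

lemma norm_in_range:
  assumes s: "s \<in> carrier S" shows "\<exists>r\<in>carrier R. s \<otimes>\<^bsub>S\<^esub> \<sigma> s = h r"
proof (rule local_in_range)
  fix \<mm> assume m: "maximalideal \<mm> R"
  then obtain f z A B where q: "quad_coords \<mm> f z A B" using coords_exist by metis
  note D = quad_coordsD[OF q] and pm = R.primeideal_mult_notin[OF R.maximalideal_prime[OF m]]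
  have "f \<otimes> f \<otimes> f \<in> carrier R - \<mm>" using D(1,2) pm by simp
  then show "\<exists>f\<in>carrier R - \<mm>. \<exists>r\<in>carrier R. h f \<otimes>\<^bsub>S\<^esub> (s \<otimes>\<^bsub>S\<^esub> \<sigma> s) = h r"
    using norm_local[OF q s] by (rule bexI[rotated])
qed (use s in simp)

lemma trace_in_range:
  assumes s: "s \<in> carrier S" shows "\<exists>r\<in>carrier R. s \<oplus>\<^bsub>S\<^esub> \<sigma> s = h r"
proof (rule local_in_range)
  fix \<mm> assume m: "maximalideal \<mm> R"
  then obtain f z A B where q: "quad_coords \<mm> f z A B" using coords_exist by metis
  note D = quad_coordsD[OF q] and pm = R.primeideal_mult_notin[OF R.maximalideal_prime[OF m]]
  have "f \<otimes> f \<in> carrier R - \<mm>" using D(1,2) pm by simp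
  then show "\<exists>f\<in>carrier R - \<mm>. \<exists>r\<in>carrier R. h f \<otimes>\<^bsub>S\<^esub> (s \<oplus>\<^bsub>S\<^esub> \<sigma> s) = h r"
    using trace_local[OF q s] by (rule bexI[rotated])
qed (use s in simp)

text \<open>The element \<open>\<delta>\<close> is \<open>z - \<sigma>(z)\<close>, a square root of the discriminant.\<close>

lemma maximalideal_over_with_unit:
  assumes m: "maximalideal \<mm> R"
  obtains Q \<delta> where "maximalideal Q S" "\<And>r. r \<in> \<mm> \<Longrightarrow> h r \<in> Q"
    "\<delta> \<in> carrier S" "\<delta> \<oplus>\<^bsub>S\<^esub> \<sigma> \<delta> = \<zero>\<^bsub>S\<^esub>" "\<delta> \<notin> Q"
proof -
  obtain f z A B where q: "quad_coords \<mm> f z A B" using coords_exist[OF m] by metis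
  note D = quad_coordsD[OF q]
  obtain Q where Q: "maximalideal Q S" "\<And>r. r \<in> \<mm> \<Longrightarrow> h r \<in> Q" "\<And>r. r \<in> carrier R \<Longrightarrow> r \<notin> \<mm> \<Longrightarrow> h r \<notin> Q"
    by (rule maximalideal_over[OF m q]) blast
  have "z \<ominus>\<^bsub>S\<^esub> \<sigma> z \<notin> Q"
    by (rule different_notin[OF S.maximalideal_prime[OF Q(1)] q Q(3)[OF D(1,2)] unramified[OF Q(1)]])
  moreover have "(z \<ominus>\<^bsub>S\<^esub> \<sigma> z) \<oplus>\<^bsub>S\<^esub> \<sigma> (z \<ominus>\<^bsub>S\<^esub> \<sigma> z) = \<zero>\<^bsub>S\<^esub>"
    using D(3) by (simp add: S.minus_eq S.a_ac S.r_neg S.r_neg1 S.r_neg2)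
  ultimately show ?thesis using D(3) by (intro that[OF Q(1,2), of "z \<ominus>\<^bsub>S\<^esub> \<sigma> z"]) simp_all
qed

text \<open>The traces form an ideal of \<open>R\<close>. If it were contained in \<open>\<mm>\<close>, then \<open>\<mm>\<close> would contain \<open>2\<close> and the trace of
  \<open>fz\<close>, hence the different \<open>f(z - \<sigma>(z))\<close> would vanish over \<open>\<mm>\<close>.\<close>

lemma trace_one:
  obtains l where "l \<in> carrier S" "l \<oplus>\<^bsub>S\<^esub> \<sigma> l = \<one>\<^bsub>S\<^esub>"
proof -
  let ?I = "{r \<in> carrier R. \<exists>t\<in>carrier S. h r = t \<oplus>\<^bsub>S\<^esub> \<sigma> t}"
  have "ideal ?I R"
  proof (rule R.idealI_comm)
    show "\<zero> \<in> ?I" by (auto intro!: bexI[of _ "\<zero>\<^bsub>S\<^esub>"])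
  next
    fix a b assume "a \<in> ?I" "b \<in> ?I"
    then obtain t u where "a \<in> carrier R" "b \<in> carrier R" "t \<in> carrier S" "u \<in> carrier S"
      "h a = t \<oplus>\<^bsub>S\<^esub> \<sigma> t" "h b = u \<oplus>\<^bsub>S\<^esub> \<sigma> u" by auto
    then show "a \<oplus> b \<in> ?I" by (auto simp: S.a_ac intro!: bexI[of _ "t \<oplus>\<^bsub>S\<^esub> u"])
  next
    fix a r assume "a \<in> ?I" and r: "r \<in> carrier R"
    then obtain t where "a \<in> carrier R" "t \<in> carrier S" "h a = t \<oplus>\<^bsub>S\<^esub> \<sigma> t" by auto
    then show "r \<otimes> a \<in> ?I" using r by (auto simp: S.r_distr intro!: bexI[of _ "h r \<otimes>\<^bsub>S\<^esub> t"])
  qed auto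
  moreover have "\<exists>r\<in>?I. r \<notin> \<mm>" if m: "maximalideal \<mm> R" for \<mm>
  proof (rule ccontr)
    assume "\<not> ?thesis"
    then have sub: "\<And>r. r \<in> ?I \<Longrightarrow> r \<in> \<mm>" by auto
    obtain f z A B where q: "quad_coords \<mm> f z A B" using coords_exist[OF m] by metis
    note D = quad_coordsD[OF q]
    obtain Q where Q: "maximalideal Q S" "\<And>r. r \<in> \<mm> \<Longrightarrow> h r \<in> Q" "\<And>r. r \<in> carrier R \<Longrightarrow> r \<notin> \<mm> \<Longrightarrow> h r \<notin> Q"
      by (rule maximalideal_over[OF m q]) blast
    interpret Q: maximalideal Q S by fact
    note id = S.idealD[OF Q.is_ideal] and prQ = S.maximalideal_prime[OF Q(1)]
    let ?b = "B (z \<otimes>\<^bsub>S\<^esub> z)"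
    have b: "?b \<in> carrier R" using D(3,13) by simp
    have "h ?b = (h f \<otimes>\<^bsub>S\<^esub> z) \<oplus>\<^bsub>S\<^esub> \<sigma> (h f \<otimes>\<^bsub>S\<^esub> z)" using D(1,3) by (simp add: S.r_distr flip: D(11))
    then have "?b \<in> ?I" using b D(1,3) by (intro CollectI conjI bexI[of _ "h f \<otimes>\<^bsub>S\<^esub> z"]) simp_all
    then have bQ: "h ?b \<in> Q" using Q(2) sub by simp
    have "\<one> \<oplus> \<one> \<in> ?I" by (auto intro!: bexI[of _ "\<one>\<^bsub>S\<^esub>"])
    then have 2: "h (\<one> \<oplus> \<one>) \<in> Q" by (intro Q(2) sub)
    have "h f \<otimes>\<^bsub>S\<^esub> (z \<ominus>\<^bsub>S\<^esub> \<sigma> z) = (h f \<otimes>\<^bsub>S\<^esub> z) \<otimes>\<^bsub>S\<^esub> (\<one>\<^bsub>S\<^esub> \<oplus>\<^bsub>S\<^esub> \<one>\<^bsub>S\<^esub>) \<ominus>\<^bsub>S\<^esub> h ?b"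
      by (rule S.linear_combination[OF D(11), of _ _ "\<ominus>\<^bsub>S\<^esub> \<one>\<^bsub>S\<^esub>"],
        rule S.ring_identityI[of _ "[h f, z, \<sigma> z, h ?b]"], (rule S.reify_rules)+)
      (use D(1,3,12,13) b in \<open>simp_all add: S.in_carrier_simps norm_simps\<close>)
    also have "\<dots> \<in> Q" using 2 bQ D(1,3) by (intro id(4) id(5)) simp_all
    finally show False
      using S.primeideal_mult_notin[OF prQ _ _ Q(3)[OF D(1,2)] different_notin[OF prQ q Q(3)[OF D(1,2)] unramified[OF Q(1)]]] D(1,3)
      by simp
  qed
  ultimately have "\<one> \<in> ?I" by (rule R.one_in_idealI)
  then show ?thesis using that by auto
qed

end

section \<open>Localization of modules\<close>

locale localized_module = module R M for R (structure) and M (structure) +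
  fixes W :: "'a set"
  assumes W_subset: "W \<subseteq> carrier R" and W_one: "\<one> \<in> W"
    and W_mult: "w \<in> W \<Longrightarrow> v \<in> W \<Longrightarrow> w \<otimes> v \<in> W"
begin

abbreviation frac where "frac \<equiv> fraction R W M"

lemma W_carr: "w \<in> W \<Longrightarrow> w \<in> carrier R"
  using W_subset by auto

lemma smult_eq_mult:
  assumes "a \<odot>\<^bsub>M\<^esub> x = b \<odot>\<^bsub>M\<^esub> y" "a \<in> carrier R" "b \<in> carrier R" "c \<in> carrier R"
    "x \<in> carrier M" "y \<in> carrier M"
  shows "(c \<otimes> a) \<odot>\<^bsub>M\<^esub> x = (c \<otimes> b) \<odot>\<^bsub>M\<^esub> y"
  using assms by (simp add: smult_assoc1)

lemma frac_rel_iff: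
  "((x, w), (y, v)) \<in> frac_rel R W M \<longleftrightarrow> x \<in> carrier M \<and> y \<in> carrier M \<and> w \<in> W \<and> v \<in> W \<and>
    (\<exists>u\<in>W. (u \<otimes> v) \<odot>\<^bsub>M\<^esub> x = (u \<otimes> w) \<odot>\<^bsub>M\<^esub> y)"
  unfolding frac_rel_def by (auto simp: smult_assoc1 W_carr)

lemma frac_rel_equiv: "equiv (carrier M \<times> W) (frac_rel R W M)"
proof (rule equivI)
  show "refl_on (carrier M \<times> W) (frac_rel R W M)"
    by (rule refl_onI) (use W_one in \<open>auto simp: frac_rel_iff\<close>)
  show "frac_rel R W M \<subseteq> (carrier M \<times> W) \<times> (carrier M \<times> W)"
    by (auto simp: frac_rel_def)
  show "sym (frac_rel R W M)"
  proof (rule symI)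
    fix p q assume "(p, q) \<in> frac_rel R W M"
    then show "(q, p) \<in> frac_rel R W M"
      by (cases p; cases q) (auto simp: frac_rel_iff dest: sym)
  qed
  show "trans (frac_rel R W M)"
  proof (rule transI)
    fix p q s assume "(p, q) \<in> frac_rel R W M" "(q, s) \<in> frac_rel R W M"
    moreover obtain x w y v z t where pqs: "p = (x, w)" "q = (y, v)" "s = (z, t)"
      by (cases p; cases q; cases s)
    ultimately obtain u1 u2 where c: "x \<in> carrier M" "y \<in> carrier M" "z \<in> carrier M"
        "w \<in> W" "v \<in> W" "t \<in> W" "u1 \<in> W" "u2 \<in> W"
      and e1: "(u1 \<otimes> v) \<odot>\<^bsub>M\<^esub> x = (u1 \<otimes> w) \<odot>\<^bsub>M\<^esub> y" and e2: "(u2 \<otimes> t) \<odot>\<^bsub>M\<^esub> y = (u2 \<otimes> v) \<odot>\<^bsub>M\<^esub> z"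
      by (auto simp: frac_rel_iff)
    note cc = c(1-3) c(4-8)[THEN W_carr]
    have "((u2 \<otimes> t) \<otimes> (u1 \<otimes> v)) \<odot>\<^bsub>M\<^esub> x = ((u2 \<otimes> t) \<otimes> (u1 \<otimes> w)) \<odot>\<^bsub>M\<^esub> y"
      by (rule smult_eq_mult[OF e1]) (use cc in auto)
    also have "(u2 \<otimes> t) \<otimes> (u1 \<otimes> w) = (u1 \<otimes> w) \<otimes> (u2 \<otimes> t)" using cc by (simp add: R.m_ac)
    also have "\<dots> \<odot>\<^bsub>M\<^esub> y = ((u1 \<otimes> w) \<otimes> (u2 \<otimes> v)) \<odot>\<^bsub>M\<^esub> z"
      by (rule smult_eq_mult[OF e2]) (use cc in auto)
    finally have "(((u1 \<otimes> u2) \<otimes> v) \<otimes> t) \<odot>\<^bsub>M\<^esub> x = (((u1 \<otimes> u2) \<otimes> v) \<otimes> w) \<odot>\<^bsub>M\<^esub> z"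
      using cc by (simp add: R.m_ac)
    then show "(p, s) \<in> frac_rel R W M"
      unfolding pqs frac_rel_iff using c W_mult by (intro conjI bexI[of _ "(u1 \<otimes> u2) \<otimes> v"]) auto
  qed
qed

lemma frac_eq_iff:
  assumes "x \<in> carrier M" "w \<in> W" "y \<in> carrier M" "v \<in> W"
  shows "frac x w = frac y v \<longleftrightarrow> (\<exists>u\<in>W. (u \<otimes> v) \<odot>\<^bsub>M\<^esub> x = (u \<otimes> w) \<odot>\<^bsub>M\<^esub> y)"
  unfolding fraction_def using assms
  by (subst eq_equiv_class_iff[OF frac_rel_equiv]) (auto simp: frac_rel_iff)

lemma frac_eqI:
  assumes "x \<in> carrier M" "w \<in> W" "y \<in> carrier M" "v \<in> W" "u \<in> W"
    and "(u \<otimes> v) \<odot>\<^bsub>M\<^esub> x = (u \<otimes> w) \<odot>\<^bsub>M\<^esub> y"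
  shows "frac x w = frac y v"
  using frac_eq_iff[OF assms(1-4)] assms(5,6) by (auto intro!: bexI[of _ u])

lemma frac_cancel:
  assumes "x \<in> carrier M" "w \<in> W" "v \<in> W"
  shows "frac (v \<odot>\<^bsub>M\<^esub> x) (v \<otimes> w) = frac x w"
  by (rule frac_eqI[of _ _ _ _ \<one>])
    (use assms W_one W_mult W_carr in \<open>auto simp: smult_assoc1[symmetric] R.m_ac\<close>)

lemma localization_carrier: "carrier (localization R W M) = {frac x w | x w. x \<in> carrier M \<and> w \<in> W}"
  by (auto simp: localization_def quotient_def fraction_def)

lemma frac_closed: "x \<in> carrier M \<Longrightarrow> w \<in> W \<Longrightarrow> frac x w \<in> carrier (localization R W M)"
  by (auto simp: localization_carrier)

lemma localization_add:
  assumes "x \<in> carrier M" "w \<in> W" "y \<in> carrier M" "v \<in> W"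
  shows "frac x w \<oplus>\<^bsub>localization R W M\<^esub> frac y v = frac (v \<odot>\<^bsub>M\<^esub> x \<oplus>\<^bsub>M\<^esub> w \<odot>\<^bsub>M\<^esub> y) (w \<otimes> v)"
proof -
  have "congruent2 (frac_rel R W M) (frac_rel R W M)
     (\<lambda>p q. case p of (x, w) \<Rightarrow> case q of (y, v) \<Rightarrow> frac (v \<odot>\<^bsub>M\<^esub> x \<oplus>\<^bsub>M\<^esub> w \<odot>\<^bsub>M\<^esub> y) (w \<otimes> v))"
  proof (rule congruent2I', clarify)
    fix x w x' w' y v y' v'
    assume "((x, w), (x', w')) \<in> frac_rel R W M" "((y, v), (y', v')) \<in> frac_rel R W M"
    then obtain u t where c: "x \<in> carrier M" "y \<in> carrier M" "x' \<in> carrier M" "y' \<in> carrier M"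
        "w \<in> W" "v \<in> W" "w' \<in> W" "v' \<in> W" "u \<in> W" "t \<in> W"
      and e1: "(u \<otimes> w') \<odot>\<^bsub>M\<^esub> x = (u \<otimes> w) \<odot>\<^bsub>M\<^esub> x'" and e2: "(t \<otimes> v') \<odot>\<^bsub>M\<^esub> y = (t \<otimes> v) \<odot>\<^bsub>M\<^esub> y'"
      by (auto simp: frac_rel_iff)
    note cc = c(1-4) c(5-10)[THEN W_carr]
    have "((t \<otimes> v' \<otimes> v) \<otimes> (u \<otimes> w')) \<odot>\<^bsub>M\<^esub> x = ((t \<otimes> v' \<otimes> v) \<otimes> (u \<otimes> w)) \<odot>\<^bsub>M\<^esub> x'"
      by (rule smult_eq_mult[OF e1]) (use cc in auto)
    moreover have "((u \<otimes> w' \<otimes> w) \<otimes> (t \<otimes> v')) \<odot>\<^bsub>M\<^esub> y = ((u \<otimes> w' \<otimes> w) \<otimes> (t \<otimes> v)) \<odot>\<^bsub>M\<^esub> y'"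
      by (rule smult_eq_mult[OF e2]) (use cc in auto)
    ultimately have "((u \<otimes> t) \<otimes> (w' \<otimes> v')) \<odot>\<^bsub>M\<^esub> (v \<odot>\<^bsub>M\<^esub> x \<oplus>\<^bsub>M\<^esub> w \<odot>\<^bsub>M\<^esub> y)
        = ((u \<otimes> t) \<otimes> (w \<otimes> v)) \<odot>\<^bsub>M\<^esub> (v' \<odot>\<^bsub>M\<^esub> x' \<oplus>\<^bsub>M\<^esub> w' \<odot>\<^bsub>M\<^esub> y')"
      using cc by (simp add: smult_r_distr smult_assoc1[symmetric] R.m_ac)
    then show "frac (v \<odot>\<^bsub>M\<^esub> x \<oplus>\<^bsub>M\<^esub> w \<odot>\<^bsub>M\<^esub> y) (w \<otimes> v) = frac (v' \<odot>\<^bsub>M\<^esub> x' \<oplus>\<^bsub>M\<^esub> w' \<odot>\<^bsub>M\<^esub> y') (w' \<otimes> v')"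
      by (intro frac_eqI[of _ _ _ _ "u \<otimes> t"]) (use c cc W_mult in auto)
  qed
  from UN_equiv_class2[OF frac_rel_equiv frac_rel_equiv this, of "(x, w)" "(y, v)"] assms
  show ?thesis by (simp add: localization_def fraction_def[symmetric] split_def)
qed

lemma localization_zero: "\<zero>\<^bsub>localization R W M\<^esub> = frac \<zero>\<^bsub>M\<^esub> \<one>"
  by (simp add: localization_def)

lemma abelian_group_localization: "abelian_group (localization R W M)"
proof (rule abelian_groupI)
  let ?L = "localization R W M"
  fix P assume "P \<in> carrier ?L"
  then obtain x w where P: "x \<in> carrier M" "w \<in> W" "P = frac x w" by (auto simp: localization_carrier)
  note c = P(1,2) W_carr[OF P(2)] W_one
  show "\<zero>\<^bsub>?L\<^esub> \<oplus>\<^bsub>?L\<^esub> P = P"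
    using c by (simp add: P(3) localization_zero localization_add)
  have "frac (\<ominus>\<^bsub>M\<^esub> x) w \<oplus>\<^bsub>?L\<^esub> P = frac (w \<odot>\<^bsub>M\<^esub> (\<ominus>\<^bsub>M\<^esub> x) \<oplus>\<^bsub>M\<^esub> w \<odot>\<^bsub>M\<^esub> x) (w \<otimes> w)"
    using c by (simp add: P(3) localization_add)
  also have "w \<odot>\<^bsub>M\<^esub> (\<ominus>\<^bsub>M\<^esub> x) \<oplus>\<^bsub>M\<^esub> w \<odot>\<^bsub>M\<^esub> x = \<zero>\<^bsub>M\<^esub>"
    using c by (simp add: smult_r_distr[symmetric] M.l_neg)
  also have "frac \<zero>\<^bsub>M\<^esub> (w \<otimes> w) = frac \<zero>\<^bsub>M\<^esub> \<one>"
    by (rule frac_eqI[of _ _ _ _ \<one>]) (use c W_mult in auto)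
  finally show "\<exists>y\<in>carrier ?L. y \<oplus>\<^bsub>?L\<^esub> P = \<zero>\<^bsub>?L\<^esub>"
    unfolding localization_zero using c by (intro bexI[of _ "frac (\<ominus>\<^bsub>M\<^esub> x) w"]) (auto intro: frac_closed)
  fix Q assume "Q \<in> carrier ?L"
  then obtain y v where Q: "y \<in> carrier M" "v \<in> W" "Q = frac y v" by (auto simp: localization_carrier)
  note d = Q(1,2) W_carr[OF Q(2)]
  show "P \<oplus>\<^bsub>?L\<^esub> Q \<in> carrier ?L"
    using c d W_mult by (auto simp: P(3) Q(3) localization_add intro!: frac_closed)
  show "P \<oplus>\<^bsub>?L\<^esub> Q = Q \<oplus>\<^bsub>?L\<^esub> P"
    using c d by (simp add: P(3) Q(3) localization_add R.m_comm M.a_comm)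
  fix N assume "N \<in> carrier ?L"
  then obtain z t where N: "z \<in> carrier M" "t \<in> W" "N = frac z t" by (auto simp: localization_carrier)
  note e = N(1,2) W_carr[OF N(2)]
  show "(P \<oplus>\<^bsub>?L\<^esub> Q) \<oplus>\<^bsub>?L\<^esub> N = P \<oplus>\<^bsub>?L\<^esub> (Q \<oplus>\<^bsub>?L\<^esub> N)"
    using c d e W_mult
    by (simp add: P(3) Q(3) N(3) localization_add smult_r_distr smult_assoc1[symmetric] R.m_ac M.a_ac)
next
  show "\<zero>\<^bsub>localization R W M\<^esub> \<in> carrier (localization R W M)"
    unfolding localization_zero using W_one by (intro frac_closed) auto
qed

lemma localization_map_frac:
  assumes f: "\<And>x. x \<in> carrier M \<Longrightarrow> f x \<in> carrier M"
    "\<And>r x. r \<in> carrier R \<Longrightarrow> x \<in> carrier M \<Longrightarrow> f (r \<odot>\<^bsub>M\<^esub> x) = r \<odot>\<^bsub>M\<^esub> f x"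
    and x: "x \<in> carrier M" "w \<in> W"
  shows "localization_map R W M f (frac x w) = frac (f x) w"
proof -
  have "congruent (frac_rel R W M) (\<lambda>p. case p of (x, w) \<Rightarrow> frac (f x) w)"
  proof (rule congruentI, clarify)
    fix x w y v assume "((x, w), (y, v)) \<in> frac_rel R W M"
    then obtain u where c: "x \<in> carrier M" "y \<in> carrier M" "w \<in> W" "v \<in> W" "u \<in> W"
      and eq: "(u \<otimes> v) \<odot>\<^bsub>M\<^esub> x = (u \<otimes> w) \<odot>\<^bsub>M\<^esub> y" by (auto simp: frac_rel_iff)
    have "(u \<otimes> v) \<odot>\<^bsub>M\<^esub> f x = (u \<otimes> w) \<odot>\<^bsub>M\<^esub> f y"
      using arg_cong[OF eq, of f] c W_carr by (simp add: f)
    then show "frac (f x) w = frac (f y) v" using c f by (intro frac_eqI[of _ _ _ _ u]) auto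
  qed
  from UN_equiv_class[OF frac_rel_equiv this, of "(x, w)"] x
  show ?thesis by (simp add: localization_map_def fraction_def[symmetric])
qed

end

lemma (in cring) module_regular: "module R (regular_module R)"
proof (rule moduleI)
  show "abelian_group (regular_module R)"
    by (rule abelian_groupI)
      (auto simp: regular_module_def a_ac intro!: bexI[of _ "\<ominus> _"] l_neg)
qed (auto simp: regular_module_def l_distr r_distr m_assoc is_cring)

context localized_module
begin

sublocale reg: localized_module R "regular_module R" W
  by (intro localized_module.intro localized_module_axioms.intro module_regular W_subset W_one W_mult)

lemma carrier_regular: "carrier (regular_module R) = carrier R"
  by (simp add: regular_module_def)

lemma localization_smult:
  assumes "a \<in> carrier R" "w \<in> W" "x \<in> carrier M" "v \<in> W"
  shows "reg.frac a w \<odot>\<^bsub>localization R W M\<^esub> frac x v = frac (a \<odot>\<^bsub>M\<^esub> x) (w \<otimes> v)"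
proof -
  have "congruent2 (frac_rel R W (regular_module R)) (frac_rel R W M)
     (\<lambda>p q. case p of (a, w) \<Rightarrow> case q of (x, v) \<Rightarrow> frac (a \<odot>\<^bsub>M\<^esub> x) (w \<otimes> v))"
  proof (rule congruent2I', clarify)
    fix a w a' w' x v x' v'
    assume "((a, w), (a', w')) \<in> frac_rel R W (regular_module R)" "((x, v), (x', v')) \<in> frac_rel R W M"
    then obtain u t where c: "a \<in> carrier R" "a' \<in> carrier R" "x \<in> carrier M" "x' \<in> carrier M"
        "w \<in> W" "v \<in> W" "w' \<in> W" "v' \<in> W" "u \<in> W" "t \<in> W"
      and e1: "(u \<otimes> w') \<otimes> a = (u \<otimes> w) \<otimes> a'" and e2: "(t \<otimes> v') \<odot>\<^bsub>M\<^esub> x = (t \<otimes> v) \<odot>\<^bsub>M\<^esub> x'"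
      by (auto simp: frac_rel_iff reg.frac_rel_iff) (auto simp: regular_module_def)
    note cc = c(1-4) c(5-10)[THEN W_carr]
    have "((u \<otimes> t) \<otimes> (w' \<otimes> v')) \<odot>\<^bsub>M\<^esub> (a \<odot>\<^bsub>M\<^esub> x) = (((u \<otimes> w') \<otimes> a) \<otimes> (t \<otimes> v')) \<odot>\<^bsub>M\<^esub> x"
      using cc by (simp add: smult_assoc1[symmetric] R.m_ac)
    also have "\<dots> = (((u \<otimes> w') \<otimes> a) \<otimes> (t \<otimes> v)) \<odot>\<^bsub>M\<^esub> x'"
      by (rule smult_eq_mult[OF e2]) (use cc in auto)
    also have "\<dots> = ((u \<otimes> t) \<otimes> (w \<otimes> v)) \<odot>\<^bsub>M\<^esub> (a' \<odot>\<^bsub>M\<^esub> x')"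
      unfolding e1 using cc by (simp add: smult_assoc1[symmetric] R.m_ac)
    finally show "frac (a \<odot>\<^bsub>M\<^esub> x) (w \<otimes> v) = frac (a' \<odot>\<^bsub>M\<^esub> x') (w' \<otimes> v')"
      by (intro frac_eqI[of _ _ _ _ "u \<otimes> t"]) (use c cc W_mult in auto)
  qed
  from UN_equiv_class2[OF reg.frac_rel_equiv frac_rel_equiv this, of "(a, w)" "(x, v)"] assms
    carrier_regular
  show ?thesis by (simp add: localization_def fraction_def[symmetric] split_def)
qed

lemma smult_regular: "a \<odot>\<^bsub>regular_module R\<^esub> x = a \<otimes> x"
  by (simp add: regular_module_def)

lemma fraction_ring_carrier:
  "carrier (fraction_ring R W) = {reg.frac a w | a w. a \<in> carrier R \<and> w \<in> W}"
  by (simp add: reg.localization_carrier carrier_regular)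

end


locale localized_algebra = localized_module R M W + algebra R M
  for R (structure) and M (structure) and W
begin

lemma localization_mult:
  assumes "x \<in> carrier M" "w \<in> W" "y \<in> carrier M" "v \<in> W"
  shows "frac x w \<otimes>\<^bsub>localization R W M\<^esub> frac y v = frac (x \<otimes>\<^bsub>M\<^esub> y) (w \<otimes> v)"
proof -
  note [simp] = cring.cring_simprules(5)[OF M_cring]
  have sm: "(a \<otimes> b) \<odot>\<^bsub>M\<^esub> (x \<otimes>\<^bsub>M\<^esub> y) = (a \<odot>\<^bsub>M\<^esub> x) \<otimes>\<^bsub>M\<^esub> (b \<odot>\<^bsub>M\<^esub> y)"
    if "a \<in> carrier R" "b \<in> carrier R" "x \<in> carrier M" "y \<in> carrier M" for a b x y
  proof -
    have "x \<otimes>\<^bsub>M\<^esub> (b \<odot>\<^bsub>M\<^esub> y) = (b \<odot>\<^bsub>M\<^esub> y) \<otimes>\<^bsub>M\<^esub> x" "y \<otimes>\<^bsub>M\<^esub> x = x \<otimes>\<^bsub>M\<^esub> y"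
      using that by (simp_all add: cring.cring_simprules(14)[OF M_cring])
    then have "x \<otimes>\<^bsub>M\<^esub> (b \<odot>\<^bsub>M\<^esub> y) = b \<odot>\<^bsub>M\<^esub> (x \<otimes>\<^bsub>M\<^esub> y)"
      using that by (simp add: smult_assoc2)
    then show ?thesis using that by (simp add: smult_assoc2 smult_assoc1)
  qed
  have "congruent2 (frac_rel R W M) (frac_rel R W M)
     (\<lambda>p q. case p of (x, w) \<Rightarrow> case q of (y, v) \<Rightarrow> frac (x \<otimes>\<^bsub>M\<^esub> y) (w \<otimes> v))"
  proof (rule congruent2I', clarify)
    fix x w x' w' y v y' v'
    assume "((x, w), (x', w')) \<in> frac_rel R W M" "((y, v), (y', v')) \<in> frac_rel R W M"
    then obtain u t where c: "x \<in> carrier M" "y \<in> carrier M" "x' \<in> carrier M" "y' \<in> carrier M"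
        "w \<in> W" "v \<in> W" "w' \<in> W" "v' \<in> W" "u \<in> W" "t \<in> W"
      and e1: "(u \<otimes> w') \<odot>\<^bsub>M\<^esub> x = (u \<otimes> w) \<odot>\<^bsub>M\<^esub> x'" and e2: "(t \<otimes> v') \<odot>\<^bsub>M\<^esub> y = (t \<otimes> v) \<odot>\<^bsub>M\<^esub> y'"
      by (auto simp: frac_rel_iff)
    note cc = c(1-4) c(5-10)[THEN W_carr]
    have "((u \<otimes> w') \<otimes> (t \<otimes> v')) \<odot>\<^bsub>M\<^esub> (x \<otimes>\<^bsub>M\<^esub> y) = ((u \<otimes> w) \<otimes> (t \<otimes> v)) \<odot>\<^bsub>M\<^esub> (x' \<otimes>\<^bsub>M\<^esub> y')"
      using cc by (simp add: sm e1 e2)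
    then have "((u \<otimes> t) \<otimes> (w' \<otimes> v')) \<odot>\<^bsub>M\<^esub> (x \<otimes>\<^bsub>M\<^esub> y) = ((u \<otimes> t) \<otimes> (w \<otimes> v)) \<odot>\<^bsub>M\<^esub> (x' \<otimes>\<^bsub>M\<^esub> y')"
      using cc by (simp add: R.m_ac)
    then show "frac (x \<otimes>\<^bsub>M\<^esub> y) (w \<otimes> v) = frac (x' \<otimes>\<^bsub>M\<^esub> y') (w' \<otimes> v')"
      by (intro frac_eqI[of _ _ _ _ "u \<otimes> t"]) (use c W_mult in auto)
  qed
  from UN_equiv_class2[OF frac_rel_equiv frac_rel_equiv this, of "(x, w)" "(y, v)"] assms
  show ?thesis by (simp add: localization_def fraction_def[symmetric] split_def)
qed

end

lemma (in abelian_group) finsum_pair: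
  assumes "b1 \<noteq> b2" "f b1 \<in> carrier G" "f b2 \<in> carrier G"
  shows "(\<Oplus>b\<in>{b1, b2}. f b) = f b1 \<oplus> f b2"
  using assms by (subst finsum_insert) auto

context localized_module
begin

lemma is_basis_pairD:
  assumes bas: "is_basis (fraction_ring R W) (localization R W M) B" and card: "card B = 2"
  obtains x1 x2 where "x1 \<in> carrier M" "x2 \<in> carrier M"
    "\<And>s. s \<in> carrier M \<Longrightarrow> \<exists>w\<in>W. \<exists>r1\<in>carrier R. \<exists>r2\<in>carrier R. w \<odot>\<^bsub>M\<^esub> s = r1 \<odot>\<^bsub>M\<^esub> x1 \<oplus>\<^bsub>M\<^esub> r2 \<odot>\<^bsub>M\<^esub> x2"
    "\<And>r1 r2. r1 \<in> carrier R \<Longrightarrow> r2 \<in> carrier R \<Longrightarrow> r1 \<odot>\<^bsub>M\<^esub> x1 \<oplus>\<^bsub>M\<^esub> r2 \<odot>\<^bsub>M\<^esub> x2 = \<zero>\<^bsub>M\<^esub>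
      \<Longrightarrow> \<exists>u\<in>W. u \<otimes> r1 = \<zero> \<and> u \<otimes> r2 = \<zero>"
proof -
  let ?L = "localization R W M" and ?R = "fraction_ring R W"
  interpret L: abelian_group ?L by (rule abelian_group_localization)
  obtain b1 b2 where B: "B = {b1, b2}" "b1 \<noteq> b2" using card by (auto simp: card_2_iff)
  have "b1 \<in> carrier ?L" "b2 \<in> carrier ?L" using bas B(1) by (auto simp: is_basis_def)
  then obtain x1 w1 x2 w2 where x: "x1 \<in> carrier M" "x2 \<in> carrier M" and w: "w1 \<in> W" "w2 \<in> W"
    and b: "b1 = frac x1 w1" "b2 = frac x2 w2" by (auto simp: localization_carrier)
  have expand: "(\<Oplus>\<^bsub>?L\<^esub>b\<in>B. c b \<odot>\<^bsub>?L\<^esub> b)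
      = frac ((v2 \<otimes> w2) \<odot>\<^bsub>M\<^esub> (a1 \<odot>\<^bsub>M\<^esub> x1) \<oplus>\<^bsub>M\<^esub> (v1 \<otimes> w1) \<odot>\<^bsub>M\<^esub> (a2 \<odot>\<^bsub>M\<^esub> x2)) ((v1 \<otimes> w1) \<otimes> (v2 \<otimes> w2))"
    if "c b1 = reg.frac a1 v1" "c b2 = reg.frac a2 v2" "a1 \<in> carrier R" "a2 \<in> carrier R" "v1 \<in> W" "v2 \<in> W"
    for c a1 v1 a2 v2
  proof -
    have s: "c b1 \<odot>\<^bsub>?L\<^esub> b1 = frac (a1 \<odot>\<^bsub>M\<^esub> x1) (v1 \<otimes> w1)" "c b2 \<odot>\<^bsub>?L\<^esub> b2 = frac (a2 \<odot>\<^bsub>M\<^esub> x2) (v2 \<otimes> w2)"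
      unfolding that(1,2) unfolding b using that(3-) x w by (simp_all add: localization_smult)
    show ?thesis unfolding B(1)
      by (subst L.finsum_pair[OF B(2)], unfold s)
        (use that(3-) x w in \<open>simp_all add: localization_add frac_closed W_mult\<close>)
  qed
  have gen: "\<exists>w\<in>W. \<exists>r1\<in>carrier R. \<exists>r2\<in>carrier R. w \<odot>\<^bsub>M\<^esub> s = r1 \<odot>\<^bsub>M\<^esub> x1 \<oplus>\<^bsub>M\<^esub> r2 \<odot>\<^bsub>M\<^esub> x2" if s: "s \<in> carrier M" for s
  proof -
    have "frac s \<one> \<in> carrier ?L" using s W_one by (intro frac_closed)
    then obtain c where c: "c \<in> B \<rightarrow>\<^sub>E carrier ?R" "frac s \<one> = (\<Oplus>\<^bsub>?L\<^esub>b\<in>B. c b \<odot>\<^bsub>?L\<^esub> b)"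
      using bas unfolding is_basis_def by (elim conjE ballE ex1E) auto
    have "c b1 \<in> carrier ?R" "c b2 \<in> carrier ?R" using c(1) B(1) by auto
    then obtain a1 v1 a2 v2 where a: "c b1 = reg.frac a1 v1" "c b2 = reg.frac a2 v2" "a1 \<in> carrier R" "a2 \<in> carrier R" "v1 \<in> W" "v2 \<in> W"
      by (auto simp: fraction_ring_carrier)
    let ?v = "(v1 \<otimes> w1) \<otimes> (v2 \<otimes> w2)"
    note cc = a(3,4) x s a(5,6)[THEN W_carr] w[THEN W_carr]
    obtain u where u: "u \<in> W" "(u \<otimes> ?v) \<odot>\<^bsub>M\<^esub> s
        = (u \<otimes> \<one>) \<odot>\<^bsub>M\<^esub> ((v2 \<otimes> w2) \<odot>\<^bsub>M\<^esub> (a1 \<odot>\<^bsub>M\<^esub> x1) \<oplus>\<^bsub>M\<^esub> (v1 \<otimes> w1) \<odot>\<^bsub>M\<^esub> (a2 \<odot>\<^bsub>M\<^esub> x2))"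
      using c(2) unfolding expand[OF a] by (subst (asm) frac_eq_iff) (use cc a w W_one W_mult in auto)
    then have "(u \<otimes> ?v) \<odot>\<^bsub>M\<^esub> s = (u \<otimes> (v2 \<otimes> w2) \<otimes> a1) \<odot>\<^bsub>M\<^esub> x1 \<oplus>\<^bsub>M\<^esub> (u \<otimes> (v1 \<otimes> w1) \<otimes> a2) \<odot>\<^bsub>M\<^esub> x2"
      using cc W_carr[OF u(1)] by (simp add: smult_r_distr smult_assoc1)
    moreover have "u \<otimes> ?v \<in> W" using u(1) a w W_mult by simp
    moreover have "u \<otimes> (v2 \<otimes> w2) \<otimes> a1 \<in> carrier R" "u \<otimes> (v1 \<otimes> w1) \<otimes> a2 \<in> carrier R"
      using cc W_carr[OF u(1)] by simp_all
    ultimately show ?thesis by (intro bexI)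
  qed
  have ind: "\<exists>u\<in>W. u \<otimes> r1 = \<zero> \<and> u \<otimes> r2 = \<zero>"
    if r: "r1 \<in> carrier R" "r2 \<in> carrier R" and eq: "r1 \<odot>\<^bsub>M\<^esub> x1 \<oplus>\<^bsub>M\<^esub> r2 \<odot>\<^bsub>M\<^esub> x2 = \<zero>\<^bsub>M\<^esub>" for r1 r2
  proof -
    define c where "c a1 a2 = (\<lambda>b\<in>B. if b = b1 then reg.frac a1 \<one> else reg.frac a2 \<one>)" for a1 a2
    have cv: "c a1 a2 b1 = reg.frac a1 \<one>" "c a1 a2 b2 = reg.frac a2 \<one>" for a1 a2
      using B by (auto simp: c_def)
    have cB: "c a1 a2 \<in> B \<rightarrow>\<^sub>E carrier ?R" if "a1 \<in> carrier R" "a2 \<in> carrier R" for a1 a2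
      using that W_one by (auto simp: c_def intro!: reg.frac_closed simp: carrier_regular)
    have z: "frac \<zero>\<^bsub>M\<^esub> (w1 \<otimes> w2) = \<zero>\<^bsub>?L\<^esub>"
      unfolding localization_zero by (rule frac_eqI[of _ _ _ _ \<one>]) (use w[THEN W_carr] w W_one W_mult in auto)
    note cc = x r w[THEN W_carr]
    have "(\<Oplus>\<^bsub>?L\<^esub>b\<in>B. c (r1 \<otimes> w1) (r2 \<otimes> w2) b \<odot>\<^bsub>?L\<^esub> b)
        = frac ((w1 \<otimes> w2) \<odot>\<^bsub>M\<^esub> (r1 \<odot>\<^bsub>M\<^esub> x1 \<oplus>\<^bsub>M\<^esub> r2 \<odot>\<^bsub>M\<^esub> x2)) (w1 \<otimes> w2)"
      by (subst expand[OF cv]) (use cc W_one in \<open>simp_all add: smult_r_distr smult_assoc1[symmetric] R.m_ac\<close>)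
    then have 1: "(\<Oplus>\<^bsub>?L\<^esub>b\<in>B. c (r1 \<otimes> w1) (r2 \<otimes> w2) b \<odot>\<^bsub>?L\<^esub> b) = \<zero>\<^bsub>?L\<^esub>"
      using cc z by (simp add: eq)
    have 2: "(\<Oplus>\<^bsub>?L\<^esub>b\<in>B. c \<zero> \<zero> b \<odot>\<^bsub>?L\<^esub> b) = \<zero>\<^bsub>?L\<^esub>"
      by (subst expand[OF cv]) (use cc W_one z in simp_all)
    have "c (r1 \<otimes> w1) (r2 \<otimes> w2) = c \<zero> \<zero>"
    proof -
      have "\<exists>!c. c \<in> B \<rightarrow>\<^sub>E carrier ?R \<and> \<zero>\<^bsub>?L\<^esub> = (\<Oplus>\<^bsub>?L\<^esub>b\<in>B. c b \<odot>\<^bsub>?L\<^esub> b)"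
        using bas L.zero_closed unfolding is_basis_def by simp
      then obtain d where d: "\<And>c. c \<in> B \<rightarrow>\<^sub>E carrier ?R \<Longrightarrow> \<zero>\<^bsub>?L\<^esub> = (\<Oplus>\<^bsub>?L\<^esub>b\<in>B. c b \<odot>\<^bsub>?L\<^esub> b) \<Longrightarrow> c = d"
        by (elim ex1E) iprover
      show ?thesis
        using d[OF cB 1[symmetric]] d[OF cB 2[symmetric]] cc by simp
    qed
    then have "reg.frac (r1 \<otimes> w1) \<one> = reg.frac \<zero> \<one>" "reg.frac (r2 \<otimes> w2) \<one> = reg.frac \<zero> \<one>"
      using cv[of "r1 \<otimes> w1" "r2 \<otimes> w2"] cv[of \<zero> \<zero>] by simp_all
    then obtain u1 u2 where u: "u1 \<in> W" "u2 \<in> W" "u1 \<otimes> (r1 \<otimes> w1) = \<zero>" "u2 \<otimes> (r2 \<otimes> w2) = \<zero>"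
      using cc W_one by (auto simp: reg.frac_eq_iff carrier_regular smult_regular W_carr)
    note uc = u(1,2)[THEN W_carr]
    have "((u2 \<otimes> w2) \<otimes> (u1 \<otimes> w1)) \<otimes> r1 = (u2 \<otimes> w2) \<otimes> (u1 \<otimes> (r1 \<otimes> w1))"
      "((u2 \<otimes> w2) \<otimes> (u1 \<otimes> w1)) \<otimes> r2 = (u1 \<otimes> w1) \<otimes> (u2 \<otimes> (r2 \<otimes> w2))"
      using cc uc by (simp_all add: R.m_ac)
    moreover have "(u2 \<otimes> w2) \<otimes> (u1 \<otimes> w1) \<in> W" using u w W_mult by simp
    ultimately show ?thesis using cc uc u(3,4)
      by (intro bexI[of _ "(u2 \<otimes> w2) \<otimes> (u1 \<otimes> w1)"]) simp_all
  qed
  show ?thesis using that x gen ind by simp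
qed

end

section \<open>Free and projective modules\<close>

definition unit_vector :: "('r, 'a) ring_scheme \<Rightarrow> nat \<Rightarrow> nat \<Rightarrow> nat \<Rightarrow> 'r" where
  "unit_vector R n i = (\<lambda>j\<in>{..<n}. if j = i then \<one>\<^bsub>R\<^esub> else \<zero>\<^bsub>R\<^esub>)"

lemma module_homD:
  assumes "f \<in> module_hom R M N"
  shows "x \<in> carrier M \<Longrightarrow> f x \<in> carrier N"
    "x \<in> carrier M \<Longrightarrow> y \<in> carrier M \<Longrightarrow> f (x \<oplus>\<^bsub>M\<^esub> y) = f x \<oplus>\<^bsub>N\<^esub> f y"
    "r \<in> carrier R \<Longrightarrow> x \<in> carrier M \<Longrightarrow> f (r \<odot>\<^bsub>M\<^esub> x) = r \<odot>\<^bsub>N\<^esub> f x"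
  using assms by (auto simp: module_hom_def hom_def)

lemma module_homI:
  assumes "\<And>x. x \<in> carrier M \<Longrightarrow> f x \<in> carrier N"
    "\<And>x y. x \<in> carrier M \<Longrightarrow> y \<in> carrier M \<Longrightarrow> f (x \<oplus>\<^bsub>M\<^esub> y) = f x \<oplus>\<^bsub>N\<^esub> f y"
    "\<And>r x. r \<in> carrier R \<Longrightarrow> x \<in> carrier M \<Longrightarrow> f (r \<odot>\<^bsub>M\<^esub> x) = r \<odot>\<^bsub>N\<^esub> f x"
  shows "f \<in> module_hom R M N"
  using assms by (auto simp: module_hom_def hom_def)

lemma (in module) module_hom_free_expand:
  assumes f: "f \<in> module_hom R (free_module R n) M" and v: "v \<in> {..<n} \<rightarrow>\<^sub>E carrier R"
  shows "f v = (\<Oplus>\<^bsub>M\<^esub>i\<in>{..<n}. v i \<odot>\<^bsub>M\<^esub> f (unit_vector R n i))"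
proof -
  let ?F = "free_module R n"
  let ?t = "\<lambda>k. \<lambda>j\<in>{..<n}. if j < k then v j else \<zero>"
  note fD = module_homD[OF f]
  have cF: "carrier ?F = {..<n} \<rightarrow>\<^sub>E carrier R" by (simp add: free_module_def)
  have vj: "v j \<in> carrier R" if "j < n" for j using v that by auto
  have tc: "?t k \<in> carrier ?F" for k unfolding cF by (auto simp: vj)
  have uc: "unit_vector R n i \<in> carrier ?F" for i unfolding cF unit_vector_def by auto
  have "k \<le> n \<Longrightarrow> f (?t k) = (\<Oplus>\<^bsub>M\<^esub>i\<in>{..<k}. v i \<odot>\<^bsub>M\<^esub> f (unit_vector R n i))" for k
  proof (induction k)
    case 0
    have "\<zero> \<odot>\<^bsub>?F\<^esub> ?t 0 = ?t 0" by (auto simp: free_module_def fun_eq_iff)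
    then have "f (?t 0) = \<zero> \<odot>\<^bsub>M\<^esub> f (?t 0)" using fD(3)[OF R.zero_closed tc[of 0]] by (simp only:)
    also have "\<dots> = \<zero>\<^bsub>M\<^esub>" by (rule smult_l_null[OF fD(1)[OF tc]])
    finally show ?case by (simp only: lessThan_0 M.finsum_empty)
  next
    case (Suc k)
    then have k: "k < n" by simp
    have "?t (Suc k) = ?t k \<oplus>\<^bsub>?F\<^esub> v k \<odot>\<^bsub>?F\<^esub> unit_vector R n k"
      using vj k by (auto simp: free_module_def unit_vector_def fun_eq_iff less_Suc_eq)
    moreover have "v k \<odot>\<^bsub>?F\<^esub> unit_vector R n k \<in> carrier ?F"
      using vj[OF k] uc[of k] unfolding cF by (auto simp: free_module_def)
    ultimately have "f (?t (Suc k)) = f (?t k) \<oplus>\<^bsub>M\<^esub> v k \<odot>\<^bsub>M\<^esub> f (unit_vector R n k)"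
      using fD(2)[OF tc[of k]] fD(3)[OF vj[OF k] uc] by simp
    also have "\<dots> = (\<Oplus>\<^bsub>M\<^esub>i\<in>{..<Suc k}. v i \<odot>\<^bsub>M\<^esub> f (unit_vector R n i))"
      unfolding lessThan_Suc Suc.IH[OF less_imp_le[OF k]]
      using k vj fD(1)[OF uc]
      by (subst M.finsum_insert) (auto simp: M.a_comm M.finsum_closed)
    finally show ?case .
  qed
  from this[of n] have "f (?t n) = (\<Oplus>\<^bsub>M\<^esub>i\<in>{..<n}. v i \<odot>\<^bsub>M\<^esub> f (unit_vector R n i))" by simp
  moreover have "?t n = v" using v by (auto simp: fun_eq_iff PiE_def extensional_def)
  ultimately show ?thesis by simp
qed

context algebra
begin

abbreviation emb where "emb \<equiv> (\<lambda>r. r \<odot>\<^bsub>M\<^esub> \<one>\<^bsub>M\<^esub>)"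

lemma one_M_closed: "\<one>\<^bsub>M\<^esub> \<in> carrier M"
  by (rule cring.cring_simprules(6)[OF M_cring])

lemma smult_eq_emb:
  assumes "r \<in> carrier R" "x \<in> carrier M" shows "r \<odot>\<^bsub>M\<^esub> x = emb r \<otimes>\<^bsub>M\<^esub> x"
  using assms one_M_closed by (simp add: smult_assoc2 cring.cring_simprules(12)[OF M_cring])

lemma emb_hom: "ring_hom_cring R M emb"
proof (intro ring_hom_cring.intro ring_hom_cring_axioms.intro R_cring M_cring ring_hom_memI)
  fix x y assume "x \<in> carrier R" "y \<in> carrier R"
  then show "emb (x \<otimes>\<^bsub>R\<^esub> y) = emb x \<otimes>\<^bsub>M\<^esub> emb y"
    using smult_eq_emb[of x "emb y"] one_M_closed by (simp add: smult_assoc1)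
qed (use one_M_closed in \<open>auto simp: smult_l_distr\<close>)

end

lemma dual_basis_exists:
  fixes R :: "('r, 'a) ring_scheme" and M :: "('r, 's, 'b) module_scheme"
  assumes alg: "algebra R M" and "fg_projective R M"
  obtains n \<xi> g where "ring_hom_cring.dual_basis R M (\<lambda>r. r \<odot>\<^bsub>M\<^esub> \<one>\<^bsub>M\<^esub>) n \<xi> g"
proof -
  let ?e = "\<lambda>r. r \<odot>\<^bsub>M\<^esub> \<one>\<^bsub>M\<^esub>"
  interpret emb: ring_hom_cring R M ?e by (rule algebra.emb_hom[OF alg])
  interpret alg: algebra R M by (rule alg)
  obtain n \<iota> \<pi> where i: "\<iota> \<in> module_hom R M (free_module R n)" and p: "\<pi> \<in> module_hom R (free_module R n) M"
    and pi: "\<And>x. x \<in> carrier M \<Longrightarrow> \<pi> (\<iota> x) = x"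
    using assms unfolding fg_projective_def by auto
  note iD = module_homD[OF i] and pD = module_homD[OF p]
  have cF: "carrier (free_module R n) = {..<n} \<rightarrow>\<^sub>E carrier R" by (simp add: free_module_def)
  have ic: "\<iota> s j \<in> carrier R" if "s \<in> carrier M" "j < n" for s j
    using iD(1)[OF that(1)] that(2) unfolding cF by auto
  have uc: "unit_vector R n j \<in> carrier (free_module R n)" for j
    unfolding cF unit_vector_def by auto
  have "emb.linear_form (\<lambda>s. \<iota> s j)" if "j < n" for j
    unfolding emb.linear_form_def
  proof (intro conjI ballI)
    fix r s assume rs: "r \<in> carrier R" "s \<in> carrier M"
    then show "\<iota> (?e r \<otimes>\<^bsub>M\<^esub> s) j = r \<otimes>\<^bsub>R\<^esub> \<iota> s j"
      using iD(3)[OF rs] that rs by (simp add: alg.smult_eq_emb[symmetric]) (simp add: free_module_def)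
  next
    fix s t assume "s \<in> carrier M" "t \<in> carrier M"
    then show "\<iota> (s \<oplus>\<^bsub>M\<^esub> t) j = \<iota> s j \<oplus>\<^bsub>R\<^esub> \<iota> t j"
      using iD(2) that by (simp add: free_module_def)
  qed (use ic that in auto)
  moreover have "s = (\<Oplus>\<^bsub>M\<^esub>j\<in>{..<n}. ?e (\<iota> s j) \<otimes>\<^bsub>M\<^esub> \<pi> (unit_vector R n j))" if s: "s \<in> carrier M" for s
  proof -
    have "s = \<pi> (\<iota> s)" using pi[OF s] by simp
    also have "\<dots> = (\<Oplus>\<^bsub>M\<^esub>j\<in>{..<n}. \<iota> s j \<odot>\<^bsub>M\<^esub> \<pi> (unit_vector R n j))"
      by (rule alg.module_hom_free_expand[OF p iD(1)[OF s, unfolded cF]])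
    also have "\<dots> = (\<Oplus>\<^bsub>M\<^esub>j\<in>{..<n}. ?e (\<iota> s j) \<otimes>\<^bsub>M\<^esub> \<pi> (unit_vector R n j))"
      by (rule emb.S.finsum_cong') (use ic[OF s] pD(1)[OF uc] in \<open>auto simp: alg.smult_eq_emb[symmetric]\<close>)
    finally show ?thesis .
  qed
  ultimately have "emb.dual_basis n (\<lambda>j s. \<iota> s j) (\<lambda>j. \<pi> (unit_vector R n j))"
    unfolding emb.dual_basis_def using pD(1)[OF uc] by simp
  then show ?thesis by (rule that)
qed

section \<open>Unramifiedness\<close>

text \<open>A derivation \<open>d\<close> modulo \<open>Q\<close> induces \<open>(s, t) \<mapsto> s d(t)\<close>, which kills the relations defining the
  Kaehler differentials.\<close>

lemma kaehler_trivial_no_derivations: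
  fixes R :: "('r, 'a) ring_scheme" and M :: "('r, 's, 'b) module_scheme"
  assumes alg: "algebra R M" and triv: "trivial_group (kaehler_differentials R M)" and Q: "ideal Q M"
    and d: "\<And>s. s \<in> carrier M \<Longrightarrow> d s \<in> carrier M"
    "\<And>s t. s \<in> carrier M \<Longrightarrow> t \<in> carrier M \<Longrightarrow> d (s \<oplus>\<^bsub>M\<^esub> t) = d s \<oplus>\<^bsub>M\<^esub> d t"
    "\<And>r s. r \<in> carrier R \<Longrightarrow> s \<in> carrier M \<Longrightarrow> d (r \<odot>\<^bsub>M\<^esub> s) = r \<odot>\<^bsub>M\<^esub> d s"
    "\<And>s t. s \<in> carrier M \<Longrightarrow> t \<in> carrier M \<Longrightarrow> d (s \<otimes>\<^bsub>M\<^esub> t) \<ominus>\<^bsub>M\<^esub> (s \<otimes>\<^bsub>M\<^esub> d t \<oplus>\<^bsub>M\<^esub> t \<otimes>\<^bsub>M\<^esub> d s) \<in> Q"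
    and s: "s \<in> carrier M"
  shows "d s \<in> Q"
proof -
  let ?e = "\<lambda>r. r \<odot>\<^bsub>M\<^esub> \<one>\<^bsub>M\<^esub>"
  interpret emb: ring_hom_cring R M ?e by (rule algebra.emb_hom[OF alg])
  interpret alg: algebra R M by (rule alg)
  note id = emb.S.idealD[OF Q]
  let ?F = "free_Abelian_group (carrier M \<times> carrier M)"
  define Rel where "Rel = tensor_relations R M M \<union>
       {frag_of (s, t \<otimes>\<^bsub>M\<^esub> u) - frag_of (s \<otimes>\<^bsub>M\<^esub> t, u) - frag_of (s \<otimes>\<^bsub>M\<^esub> u, t) | s t u.
          s \<in> carrier M \<and> t \<in> carrier M \<and> u \<in> carrier M}"
  have cgM: "comm_group (add_monoid M)" by (rule emb.S.a_comm_group)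
  have "(\<lambda>(s, t). s \<otimes>\<^bsub>M\<^esub> d t) ` (carrier M \<times> carrier M) \<subseteq> carrier (add_monoid M)"
    using d(1) by auto
  then obtain \<Phi> where Ph: "\<Phi> \<in> hom ?F (add_monoid M)"
    and Pf: "\<And>x. x \<in> carrier M \<times> carrier M \<Longrightarrow> \<Phi> (frag_of x) = (case x of (s, t) \<Rightarrow> s \<otimes>\<^bsub>M\<^esub> d t)"
    by (rule comm_group.free_Abelian_group_universal[OF cgM]) (rule that)
  interpret Ph: group_hom ?F "add_monoid M" \<Phi>
    by (intro group_hom.intro group_hom_axioms.intro group_free_Abelian_group comm_group.axioms(2)[OF cgM] Ph)
  have Pdiff: "Poly_Mapping.keys (x - y) \<subseteq> carrier M \<times> carrier M \<and> \<Phi> (x - y) = \<Phi> x \<ominus>\<^bsub>M\<^esub> \<Phi> y"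
    if "Poly_Mapping.keys x \<subseteq> carrier M \<times> carrier M" "Poly_Mapping.keys y \<subseteq> carrier M \<times> carrier M" for x y
  proof -
    have "\<Phi> (x \<otimes>\<^bsub>?F\<^esub> inv\<^bsub>?F\<^esub> y) = \<Phi> x \<oplus>\<^bsub>M\<^esub> \<ominus>\<^bsub>M\<^esub> \<Phi> y"
      using that Ph.hom_mult[of x "inv\<^bsub>?F\<^esub> y"] Ph.hom_inv[of y] Ph.G.inv_closed[of y]
      by (simp add: a_inv_def)
    moreover have "Poly_Mapping.keys (x - y) \<subseteq> carrier M \<times> carrier M"
      using that keys_diff[of x y] by blast
    ultimately show ?thesis using that by (simp add: a_minus_def)
  qed
  have P3: "Poly_Mapping.keys (frag_of (a, b) - frag_of (a', b') - frag_of (a'', b'')) \<subseteq> carrier M \<times> carrier M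
      \<and> \<Phi> (frag_of (a, b) - frag_of (a', b') - frag_of (a'', b'')) = a \<otimes>\<^bsub>M\<^esub> d b \<ominus>\<^bsub>M\<^esub> a' \<otimes>\<^bsub>M\<^esub> d b' \<ominus>\<^bsub>M\<^esub> a'' \<otimes>\<^bsub>M\<^esub> d b''"
    if "a \<in> carrier M" "b \<in> carrier M" "a' \<in> carrier M" "b' \<in> carrier M" "a'' \<in> carrier M" "b'' \<in> carrier M"
    for a b a' b' a'' b''
  proof -
    have 1: "Poly_Mapping.keys (frag_of (a, b) - frag_of (a', b')) \<subseteq> carrier M \<times> carrier M
      \<and> \<Phi> (frag_of (a, b) - frag_of (a', b')) = a \<otimes>\<^bsub>M\<^esub> d b \<ominus>\<^bsub>M\<^esub> a' \<otimes>\<^bsub>M\<^esub> d b'"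
      using Pdiff[of "frag_of (a, b)" "frag_of (a', b')"] that by (simp add: Pf)
    show ?thesis using Pdiff[of "frag_of (a, b) - frag_of (a', b')" "frag_of (a'', b'')"] 1 that by (simp add: Pf)
  qed
  have P2: "Poly_Mapping.keys (frag_of (a, b) - frag_of (a', b')) \<subseteq> carrier M \<times> carrier M
      \<and> \<Phi> (frag_of (a, b) - frag_of (a', b')) = a \<otimes>\<^bsub>M\<^esub> d b \<ominus>\<^bsub>M\<^esub> a' \<otimes>\<^bsub>M\<^esub> d b'"
    if "a \<in> carrier M" "b \<in> carrier M" "a' \<in> carrier M" "b' \<in> carrier M" for a b a' b'
    using Pdiff[of "frag_of (a, b)" "frag_of (a', b')"] that by (simp add: Pf)
  have rel: "Poly_Mapping.keys x \<subseteq> carrier M \<times> carrier M \<and> \<Phi> x \<in> Q" if x: "x \<in> Rel" for x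
  proof -
    consider (1) a a' b where "x = frag_of (a \<oplus>\<^bsub>M\<^esub> a', b) - frag_of (a, b) - frag_of (a', b)"
        "a \<in> carrier M" "a' \<in> carrier M" "b \<in> carrier M"
      | (2) a b b' where "x = frag_of (a, b \<oplus>\<^bsub>M\<^esub> b') - frag_of (a, b) - frag_of (a, b')"
        "a \<in> carrier M" "b' \<in> carrier M" "b \<in> carrier M"
      | (3) r a b where "x = frag_of (r \<odot>\<^bsub>M\<^esub> a, b) - frag_of (a, r \<odot>\<^bsub>M\<^esub> b)"
        "r \<in> carrier R" "a \<in> carrier M" "b \<in> carrier M"
      | (4) s t u where "x = frag_of (s, t \<otimes>\<^bsub>M\<^esub> u) - frag_of (s \<otimes>\<^bsub>M\<^esub> t, u) - frag_of (s \<otimes>\<^bsub>M\<^esub> u, t)"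
        "s \<in> carrier M" "t \<in> carrier M" "u \<in> carrier M"
      using x unfolding Rel_def tensor_relations_def by auto
    then show ?thesis
    proof cases
      case 1
      have "(a \<oplus>\<^bsub>M\<^esub> a') \<otimes>\<^bsub>M\<^esub> d b \<ominus>\<^bsub>M\<^esub> a \<otimes>\<^bsub>M\<^esub> d b \<ominus>\<^bsub>M\<^esub> a' \<otimes>\<^bsub>M\<^esub> d b = \<zero>\<^bsub>M\<^esub>"
        by (rule emb.S.ring_identityI[of _ "[a, a', d b]"], (rule emb.S.reify_rules)+)
          (use 1 d(1) in \<open>simp_all add: emb.S.in_carrier_simps norm_simps\<close>)
      then show ?thesis using P3[of "a \<oplus>\<^bsub>M\<^esub> a'" b a b a' b] 1 id(1) by simp
    next
      case 2
      have "a \<otimes>\<^bsub>M\<^esub> (d b \<oplus>\<^bsub>M\<^esub> d b') \<ominus>\<^bsub>M\<^esub> a \<otimes>\<^bsub>M\<^esub> d b \<ominus>\<^bsub>M\<^esub> a \<otimes>\<^bsub>M\<^esub> d b' = \<zero>\<^bsub>M\<^esub>"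
        by (rule emb.S.ring_identityI[of _ "[a, d b, d b']"], (rule emb.S.reify_rules)+)
          (use 2 d(1) in \<open>simp_all add: emb.S.in_carrier_simps norm_simps\<close>)
      then show ?thesis using P3[of a "b \<oplus>\<^bsub>M\<^esub> b'" a b a b'] 2 id(1) d(2) by simp
    next
      case 3
      have "a \<otimes>\<^bsub>M\<^esub> (r \<odot>\<^bsub>M\<^esub> d b) = (r \<odot>\<^bsub>M\<^esub> a) \<otimes>\<^bsub>M\<^esub> d b"
        using 3 d(1) by (simp add: alg.smult_eq_emb[of r a] alg.smult_eq_emb[of r "d b"] emb.S.m_ac)
      then have "(r \<odot>\<^bsub>M\<^esub> a) \<otimes>\<^bsub>M\<^esub> d b \<ominus>\<^bsub>M\<^esub> a \<otimes>\<^bsub>M\<^esub> (r \<odot>\<^bsub>M\<^esub> d b) = \<zero>\<^bsub>M\<^esub>"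
        using 3 d(1) by (simp add: emb.S.minus_eq emb.S.r_neg)
      then show ?thesis using P2[of "r \<odot>\<^bsub>M\<^esub> a" b a "r \<odot>\<^bsub>M\<^esub> b"] 3 id(1) d(3) by simp
    next
      case 4
      have "s \<otimes>\<^bsub>M\<^esub> d (t \<otimes>\<^bsub>M\<^esub> u) \<ominus>\<^bsub>M\<^esub> (s \<otimes>\<^bsub>M\<^esub> t) \<otimes>\<^bsub>M\<^esub> d u \<ominus>\<^bsub>M\<^esub> (s \<otimes>\<^bsub>M\<^esub> u) \<otimes>\<^bsub>M\<^esub> d t
          = s \<otimes>\<^bsub>M\<^esub> (d (t \<otimes>\<^bsub>M\<^esub> u) \<ominus>\<^bsub>M\<^esub> (t \<otimes>\<^bsub>M\<^esub> d u \<oplus>\<^bsub>M\<^esub> u \<otimes>\<^bsub>M\<^esub> d t))"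
        by (rule emb.S.ring_identityI[of _ "[s, t, u, d t, d u, d (t \<otimes>\<^bsub>M\<^esub> u)]"], (rule emb.S.reify_rules)+)
          (use 4 d(1) in \<open>simp_all add: emb.S.in_carrier_simps norm_simps\<close>)
      also have "\<dots> \<in> Q" using id(5)[OF d(4)[OF 4(3,4)] 4(2)] .
      finally show ?thesis using P3[of s "t \<otimes>\<^bsub>M\<^esub> u" "s \<otimes>\<^bsub>M\<^esub> t" u "s \<otimes>\<^bsub>M\<^esub> u" t] 4 by simp
    qed
  qed
  have gen: "Poly_Mapping.keys x \<subseteq> carrier M \<times> carrier M \<and> \<Phi> x \<in> Q" if "x \<in> generate ?F Rel" for x
    using that
  proof (induction rule: generate.induct)
    case one
    then show ?case using Ph.hom_one id(1) by simp
  next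
    case (incl x)
    then show ?case by (rule rel)
  next
    case (inv x)
    note r = rel[OF inv]
    have "\<Phi> (inv\<^bsub>?F\<^esub> x) = \<ominus>\<^bsub>M\<^esub> \<Phi> x" using Ph.hom_inv[of x] r by (simp add: a_inv_def)
    then show ?case using Ph.G.inv_closed[of x] r id(3) by simp
  next
    case (eng x y)
    have "\<Phi> (x \<otimes>\<^bsub>?F\<^esub> y) = \<Phi> x \<oplus>\<^bsub>M\<^esub> \<Phi> y" using Ph.hom_mult[of x y] eng.IH by simp
    then show ?case using Ph.G.m_closed[of x y] eng.IH id(2) by simp
  qed
  have kd: "kaehler_differentials R M = ?F Mod generate ?F Rel"
    by (simp add: kaehler_differentials_def Rel_def Let_def)
  have one: "\<one>\<^bsub>?F Mod generate ?F Rel\<^esub> = generate ?F Rel" by (simp add: FactGroup_def)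
  have "frag_of (\<one>\<^bsub>M\<^esub>, s) \<in> carrier ?F" using s alg.one_M_closed by simp
  then have "generate ?F Rel #>\<^bsub>?F\<^esub> frag_of (\<one>\<^bsub>M\<^esub>, s) \<in> carrier (?F Mod generate ?F Rel)"
    unfolding carrier_FactGroup by (rule imageI)
  then have "generate ?F Rel #>\<^bsub>?F\<^esub> frag_of (\<one>\<^bsub>M\<^esub>, s) = generate ?F Rel"
    using triv unfolding kd trivial_group_def one by simp
  moreover have "\<one>\<^bsub>?F\<^esub> \<otimes>\<^bsub>?F\<^esub> frag_of (\<one>\<^bsub>M\<^esub>, s) \<in> generate ?F Rel #>\<^bsub>?F\<^esub> frag_of (\<one>\<^bsub>M\<^esub>, s)"
    unfolding r_coset_def using generate.one[of ?F Rel] by (intro UN_I) auto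
  ultimately have "frag_of (\<one>\<^bsub>M\<^esub>, s) \<in> generate ?F Rel" by simp
  then have "\<Phi> (frag_of (\<one>\<^bsub>M\<^esub>, s)) \<in> Q" using gen by simp
  then show ?thesis using s d(1) by (simp add: Pf)
qed

section \<open>The standard involution in local coordinates\<close>

lemma (in cring) powers_notin_prime:
  assumes p: "primeideal p R" and f: "f \<in> carrier R" "f \<notin> p" and u: "u \<in> powers R f"
  shows "u \<notin> p"
proof -
  have "f [^] (n :: nat) \<notin> p" for n
  proof (induction n)
    case 0
    then show ?case using primeideal_one_notin[OF p] by simp
  next
    case (Suc n)
    then show ?case using primeideal_mult_notin[OF p] f by simp
  qed
  then show ?thesis using u by (auto simp: powers_def)
qed

lemma (in cring) powers_closed:
  assumes f: "f \<in> carrier R"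
  shows "powers R f \<subseteq> carrier R" "\<one> \<in> powers R f" "f \<in> powers R f"
    "u \<in> powers R f \<Longrightarrow> v \<in> powers R f \<Longrightarrow> u \<otimes> v \<in> powers R f"
proof -
  show "powers R f \<subseteq> carrier R" using f by (auto simp: powers_def)
  have "\<one> = f [^] (0 :: nat)" "f = f [^] (1 :: nat)" using f by simp_all
  then show "\<one> \<in> powers R f" "f \<in> powers R f" unfolding powers_def by fast+
  assume "u \<in> powers R f" "v \<in> powers R f"
  then obtain n m :: nat where "u = f [^] n" "v = f [^] m" by (auto simp: powers_def)
  then have "u \<otimes> v = f [^] (n + m)" using f by (simp add: nat_pow_mult)
  then show "u \<otimes> v \<in> powers R f" unfolding powers_def by fast
qed

text \<open>A sum over \<open>{1, z}\<close> has two terms only because \<open>1\<close> and \<open>z\<close> stay different in the localization: otherwise \<open>uf = 0\<close>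
  for some power \<open>u\<close> of \<open>f\<close>, although \<open>f\<close> is not in \<open>p\<close>.\<close>

lemma local_coords_is_basis:
  fixes R :: "('r, 'a) ring_scheme" and S :: "('r, 's, 'b) module_scheme"
  assumes alg: "algebra R S" and p: "primeideal p R"
    and lc: "ring_hom_cring.local_coords R S (\<lambda>r. r \<odot>\<^bsub>S\<^esub> \<one>\<^bsub>S\<^esub>) p f z A B"
  defines "W \<equiv> powers R f"
  shows "is_basis (fraction_ring R W) (localization R W S) {fraction R W S \<one>\<^bsub>S\<^esub> \<one>\<^bsub>R\<^esub>, fraction R W S z \<one>\<^bsub>R\<^esub>}"
proof -
  let ?e = "\<lambda>r. r \<odot>\<^bsub>S\<^esub> \<one>\<^bsub>S\<^esub>"
  interpret emb: ring_hom_cring R S ?e by (rule algebra.emb_hom[OF alg])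
  interpret alg: algebra R S by (rule alg)
  have f: "f \<in> carrier R" "f \<notin> p" and z: "z \<in> carrier S" and AB: "emb.linear_form A" "emb.linear_form B"
    and ex: "\<And>s. s \<in> carrier S \<Longrightarrow> f \<odot>\<^bsub>S\<^esub> s = A s \<odot>\<^bsub>S\<^esub> \<one>\<^bsub>S\<^esub> \<oplus>\<^bsub>S\<^esub> B s \<odot>\<^bsub>S\<^esub> z"
    and v: "A \<one>\<^bsub>S\<^esub> = f" "A z = \<zero>\<^bsub>R\<^esub>" "B \<one>\<^bsub>S\<^esub> = \<zero>\<^bsub>R\<^esub>" "B z = f"
    using lc emb.linear_formD(1) unfolding emb.local_coords_def by (auto simp: alg.smult_eq_emb[symmetric])
  have lin: "C s \<in> carrier R" "C (s \<oplus>\<^bsub>S\<^esub> t) = C s \<oplus>\<^bsub>R\<^esub> C t" "C (r \<odot>\<^bsub>S\<^esub> s) = r \<otimes>\<^bsub>R\<^esub> C s"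
    if "C = A \<or> C = B" "r \<in> carrier R" "s \<in> carrier S" "t \<in> carrier S" for C r s t
    using that emb.linear_formD[OF AB(1)] emb.linear_formD[OF AB(2)] by (auto simp: alg.smult_eq_emb[of r s])
  note P = emb.R.powers_closed[OF f(1), folded W_def]
  interpret L: localized_module R S W
    by (intro localized_module.intro localized_module_axioms.intro alg.module P)
  interpret LG: abelian_group "localization R W S" by (rule L.abelian_group_localization)
  note Wc = L.W_carr
  let ?L = "localization R W S" and ?R = "fraction_ring R W"
  let ?o = "L.frac \<one>\<^bsub>S\<^esub> \<one>\<^bsub>R\<^esub>" and ?z = "L.frac z \<one>\<^bsub>R\<^esub>"
  have o: "\<one>\<^bsub>S\<^esub> \<in> carrier S" by simp
  have ne: "?o \<noteq> ?z"
  proof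
    assume "?o = ?z"
    then obtain u where u: "u \<in> W" "u \<odot>\<^bsub>S\<^esub> \<one>\<^bsub>S\<^esub> = u \<odot>\<^bsub>S\<^esub> z"
      using z P(2) by (auto simp: L.frac_eq_iff Wc)
    have "A (u \<odot>\<^bsub>S\<^esub> \<one>\<^bsub>S\<^esub>) = u \<otimes>\<^bsub>R\<^esub> f" "A (u \<odot>\<^bsub>S\<^esub> z) = \<zero>\<^bsub>R\<^esub>"
      using lin(3)[of A u "\<one>\<^bsub>S\<^esub>" "\<one>\<^bsub>S\<^esub>"] lin(3)[of A u z z] v Wc[OF u(1)] z by simp_all
    then have "u \<otimes>\<^bsub>R\<^esub> f = \<zero>\<^bsub>R\<^esub>" using u(2) by simp
    moreover have "u \<notin> p" using emb.R.powers_notin_prime[OF p f] u(1) unfolding W_def by simp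
    ultimately show False
      using emb.R.primeideal_mult_notin[OF p Wc[OF u(1)] f(1) _ f(2)]
        emb.R.idealD(1)[OF primeideal.axioms(1)[OF p]] by simp
  qed
  have oz: "?o \<in> carrier ?L" "?z \<in> carrier ?L" using P z by (auto intro!: L.frac_closed)
  have expand: "(\<Oplus>\<^bsub>?L\<^esub>b\<in>{?o, ?z}. c b \<odot>\<^bsub>?L\<^esub> b)
      = L.frac (v2 \<odot>\<^bsub>S\<^esub> (a1 \<odot>\<^bsub>S\<^esub> \<one>\<^bsub>S\<^esub>) \<oplus>\<^bsub>S\<^esub> v1 \<odot>\<^bsub>S\<^esub> (a2 \<odot>\<^bsub>S\<^esub> z)) (v1 \<otimes>\<^bsub>R\<^esub> v2)"
    if "c ?o = L.reg.frac a1 v1" "c ?z = L.reg.frac a2 v2" "a1 \<in> carrier R" "a2 \<in> carrier R" "v1 \<in> W" "v2 \<in> W"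
    for c a1 v1 a2 v2
  proof -
    have s: "c ?o \<odot>\<^bsub>?L\<^esub> ?o = L.frac (a1 \<odot>\<^bsub>S\<^esub> \<one>\<^bsub>S\<^esub>) v1" "c ?z \<odot>\<^bsub>?L\<^esub> ?z = L.frac (a2 \<odot>\<^bsub>S\<^esub> z) v2"
      unfolding that(1,2) using that(3-) z P Wc by (simp_all add: L.localization_smult)
    show ?thesis
      by (subst LG.finsum_pair[OF ne], unfold s)
        (use that(3-) z in \<open>simp_all add: L.localization_add L.frac_closed\<close>)
  qed
  have "\<exists>!c. c \<in> {?o, ?z} \<rightarrow>\<^sub>E carrier ?R \<and> x = (\<Oplus>\<^bsub>?L\<^esub>b\<in>{?o, ?z}. c b \<odot>\<^bsub>?L\<^esub> b)" if x: "x \<in> carrier ?L" for x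
  proof -
    obtain s w where s: "s \<in> carrier S" "w \<in> W" "x = L.frac s w" using x by (auto simp: L.localization_carrier)
    note wc = Wc[OF s(2)]
    have As: "A s \<in> carrier R" "B s \<in> carrier R" using lin(1)[of _ f s s] s f by auto
    have wf: "w \<otimes>\<^bsub>R\<^esub> f \<in> W" using P s(2) by simp
    let ?a = "L.reg.frac (A s) (w \<otimes>\<^bsub>R\<^esub> f)" and ?b = "L.reg.frac (B s) (w \<otimes>\<^bsub>R\<^esub> f)"
    let ?c = "\<lambda>b\<in>{?o, ?z}. if b = ?o then ?a else ?b"
    show ?thesis
    proof (rule ex1I[of _ ?c], intro conjI)
      show "?c \<in> {?o, ?z} \<rightarrow>\<^sub>E carrier ?R"
        using As wf by (auto intro!: L.reg.frac_closed simp: L.carrier_regular)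
      have "(\<Oplus>\<^bsub>?L\<^esub>b\<in>{?o, ?z}. ?c b \<odot>\<^bsub>?L\<^esub> b)
        = L.frac ((w \<otimes>\<^bsub>R\<^esub> f) \<odot>\<^bsub>S\<^esub> (A s \<odot>\<^bsub>S\<^esub> \<one>\<^bsub>S\<^esub>) \<oplus>\<^bsub>S\<^esub> (w \<otimes>\<^bsub>R\<^esub> f) \<odot>\<^bsub>S\<^esub> (B s \<odot>\<^bsub>S\<^esub> z)) ((w \<otimes>\<^bsub>R\<^esub> f) \<otimes>\<^bsub>R\<^esub> (w \<otimes>\<^bsub>R\<^esub> f))"
        by (rule expand) (use ne As wf in auto)
      also have "\<dots> = L.frac ((w \<otimes>\<^bsub>R\<^esub> f) \<odot>\<^bsub>S\<^esub> (f \<odot>\<^bsub>S\<^esub> s)) ((w \<otimes>\<^bsub>R\<^esub> f) \<otimes>\<^bsub>R\<^esub> (w \<otimes>\<^bsub>R\<^esub> f))"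
        unfolding ex[OF s(1)] using As wc f z by (simp add: alg.smult_r_distr)
      also have "\<dots> = L.frac (f \<odot>\<^bsub>S\<^esub> s) (w \<otimes>\<^bsub>R\<^esub> f)"
        by (rule L.frac_cancel) (use s f wf in auto)
      also have "\<dots> = x"
        using L.frac_cancel[OF s(1,2) P(3)] wc f s(3) by (simp add: emb.R.m_comm)
      finally show "x = (\<Oplus>\<^bsub>?L\<^esub>b\<in>{?o, ?z}. ?c b \<odot>\<^bsub>?L\<^esub> b)" ..
    next
      fix c assume c: "c \<in> {?o, ?z} \<rightarrow>\<^sub>E carrier ?R \<and> x = (\<Oplus>\<^bsub>?L\<^esub>b\<in>{?o, ?z}. c b \<odot>\<^bsub>?L\<^esub> b)"
      then have "c ?o \<in> carrier ?R" "c ?z \<in> carrier ?R" by auto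
      then obtain a1 v1 a2 v2 where a: "c ?o = L.reg.frac a1 v1" "c ?z = L.reg.frac a2 v2"
          "a1 \<in> carrier R" "a2 \<in> carrier R" "v1 \<in> W" "v2 \<in> W"
        by (auto simp: L.fraction_ring_carrier)
      note vc = a(3,4) Wc[OF a(5)] Wc[OF a(6)]
      let ?y = "v2 \<odot>\<^bsub>S\<^esub> (a1 \<odot>\<^bsub>S\<^esub> \<one>\<^bsub>S\<^esub>) \<oplus>\<^bsub>S\<^esub> v1 \<odot>\<^bsub>S\<^esub> (a2 \<odot>\<^bsub>S\<^esub> z)"
      have yc: "?y \<in> carrier S" using vc z by simp
      have "L.frac s w = L.frac ?y (v1 \<otimes>\<^bsub>R\<^esub> v2)" using c s(3) expand[OF a] by simp
      then obtain u where u: "u \<in> W" "(u \<otimes>\<^bsub>R\<^esub> (v1 \<otimes>\<^bsub>R\<^esub> v2)) \<odot>\<^bsub>S\<^esub> s = (u \<otimes>\<^bsub>R\<^esub> w) \<odot>\<^bsub>S\<^esub> ?y"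
        using s(1,2) yc a(5,6) P(4) by (auto simp: L.frac_eq_iff)
      note uc = Wc[OF u(1)]
      have C: "(u \<otimes>\<^bsub>R\<^esub> (v1 \<otimes>\<^bsub>R\<^esub> v2)) \<otimes>\<^bsub>R\<^esub> C s = (u \<otimes>\<^bsub>R\<^esub> w) \<otimes>\<^bsub>R\<^esub> (v2 \<otimes>\<^bsub>R\<^esub> (a1 \<otimes>\<^bsub>R\<^esub> C \<one>\<^bsub>S\<^esub>) \<oplus>\<^bsub>R\<^esub> v1 \<otimes>\<^bsub>R\<^esub> (a2 \<otimes>\<^bsub>R\<^esub> C z))"
        if "C = A \<or> C = B" for C
        using arg_cong[OF u(2), of C] uc vc wc s(1) z yc
        by (simp add: lin[OF that])
      have 1: "(u \<otimes>\<^bsub>R\<^esub> v2) \<otimes>\<^bsub>R\<^esub> (w \<otimes>\<^bsub>R\<^esub> f) \<otimes>\<^bsub>R\<^esub> a1 = (u \<otimes>\<^bsub>R\<^esub> v2) \<otimes>\<^bsub>R\<^esub> v1 \<otimes>\<^bsub>R\<^esub> A s"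
        using C[of A] uc vc wc f(1) As by (simp add: v emb.R.m_ac)
      have 2: "(u \<otimes>\<^bsub>R\<^esub> v1) \<otimes>\<^bsub>R\<^esub> (w \<otimes>\<^bsub>R\<^esub> f) \<otimes>\<^bsub>R\<^esub> a2 = (u \<otimes>\<^bsub>R\<^esub> v1) \<otimes>\<^bsub>R\<^esub> v2 \<otimes>\<^bsub>R\<^esub> B s"
        using C[of B] uc vc wc f(1) As by (simp add: v emb.R.m_ac)
      have "c ?o = ?a" unfolding a(1)
        by (rule L.reg.frac_eqI[of _ _ _ _ "u \<otimes>\<^bsub>R\<^esub> v2"])
          (use a u P wf As 1 in \<open>simp_all add: L.carrier_regular L.smult_regular\<close>)
      moreover have "c ?z = ?b" unfolding a(2)
        by (rule L.reg.frac_eqI[of _ _ _ _ "u \<otimes>\<^bsub>R\<^esub> v1"])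
          (use a u P wf As 2 in \<open>simp_all add: L.carrier_regular L.smult_regular\<close>)
      ultimately show "c = ?c"
        using c ne by (intro PiE_ext[of c "{?o, ?z}" "\<lambda>_. carrier ?R" ?c]) (auto intro!: L.reg.frac_closed simp: As wf L.carrier_regular)
    qed
  qed
  then show ?thesis using oz unfolding is_basis_def by simp
qed

text \<open>The formula \<open>\<sigma>(z) = a - z\<close> holds in the localization, hence in \<open>S\<close> after multiplication by some power of \<open>f\<close>,
  and this power can be absorbed into the coordinates.\<close>

lemma standard_involution_quad_coords:
  fixes R :: "('r, 'a) ring_scheme" and S :: "('r, 's, 'b) module_scheme"
  assumes alg: "algebra R S" and p: "primeideal p R" and si: "standard_involution R S \<sigma>"
    and inv: "involution_extension R S (\<lambda>r. r \<odot>\<^bsub>S\<^esub> \<one>\<^bsub>S\<^esub>) \<sigma>"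
    and lc: "ring_hom_cring.local_coords R S (\<lambda>r. r \<odot>\<^bsub>S\<^esub> \<one>\<^bsub>S\<^esub>) p f z A B"
  shows "\<exists>f A B. involution_extension.quad_coords R S (\<lambda>r. r \<odot>\<^bsub>S\<^esub> \<one>\<^bsub>S\<^esub>) \<sigma> p f z A B"
proof -
  let ?e = "\<lambda>r. r \<odot>\<^bsub>S\<^esub> \<one>\<^bsub>S\<^esub>"
  define W where "W = powers R f"
  note basis = local_coords_is_basis[OF alg p lc, folded W_def]
  interpret inv: involution_extension R S ?e \<sigma> by (rule inv)
  interpret alg: algebra R S by (rule alg)
  have f: "f \<in> carrier R" "f \<notin> p" and z: "z \<in> carrier S" and AB: "inv.linear_form A" "inv.linear_form B"
    and ex: "\<And>s. s \<in> carrier S \<Longrightarrow> f \<odot>\<^bsub>S\<^esub> s = A s \<odot>\<^bsub>S\<^esub> \<one>\<^bsub>S\<^esub> \<oplus>\<^bsub>S\<^esub> B s \<odot>\<^bsub>S\<^esub> z"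
    using lc inv.linear_formD(1) unfolding inv.local_coords_def by (auto simp: alg.smult_eq_emb[symmetric])
  note P = inv.R.powers_closed[OF f(1), folded W_def]
  interpret L: localized_algebra R S W
    by (intro localized_algebra.intro localized_module.intro localized_module_axioms.intro alg.module P alg)
  interpret LG: abelian_group "localization R W S" by (rule L.abelian_group_localization)
  note Wc = L.W_carr
  let ?L = "localization R W S" and ?R = "fraction_ring R W"
  let ?o = "L.frac \<one>\<^bsub>S\<^esub> \<one>\<^bsub>R\<^esub>" and ?z = "L.frac z \<one>\<^bsub>R\<^esub>"
  let ?zz = "z \<otimes>\<^bsub>S\<^esub> z"
  let ?a = "L.reg.frac (B ?zz) f" and ?b = "L.reg.frac (A ?zz) f"
  have zz: "?zz \<in> carrier S" using z by simp
  have ab: "A ?zz \<in> carrier R" "B ?zz \<in> carrier R" using inv.linear_formD(1) AB zz by auto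
  have one: "\<one>\<^bsub>?L\<^esub> = ?o" by (simp add: localization_def)
  have "?a \<odot>\<^bsub>?L\<^esub> ?z \<oplus>\<^bsub>?L\<^esub> ?b \<odot>\<^bsub>?L\<^esub> ?o = L.frac (f \<odot>\<^bsub>S\<^esub> (B ?zz \<odot>\<^bsub>S\<^esub> z) \<oplus>\<^bsub>S\<^esub> f \<odot>\<^bsub>S\<^esub> (A ?zz \<odot>\<^bsub>S\<^esub> \<one>\<^bsub>S\<^esub>)) (f \<otimes>\<^bsub>R\<^esub> f)"
    using ab z f P by (simp add: L.localization_smult L.localization_add)
  also have "f \<odot>\<^bsub>S\<^esub> (B ?zz \<odot>\<^bsub>S\<^esub> z) \<oplus>\<^bsub>S\<^esub> f \<odot>\<^bsub>S\<^esub> (A ?zz \<odot>\<^bsub>S\<^esub> \<one>\<^bsub>S\<^esub>) = f \<odot>\<^bsub>S\<^esub> (f \<odot>\<^bsub>S\<^esub> ?zz)"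
    unfolding ex[OF zz] using ab z f by (simp add: alg.smult_r_distr inv.S.a_comm)
  also have "L.frac (f \<odot>\<^bsub>S\<^esub> (f \<odot>\<^bsub>S\<^esub> ?zz)) (f \<otimes>\<^bsub>R\<^esub> f) = L.frac (f \<odot>\<^bsub>S\<^esub> ?zz) f"
    using L.frac_cancel[of "f \<odot>\<^bsub>S\<^esub> ?zz" f f] zz f P by simp
  also have "\<dots> = L.frac ?zz \<one>\<^bsub>R\<^esub>"
    using L.frac_cancel[of ?zz "\<one>\<^bsub>R\<^esub>" f] zz f P by simp
  also have "\<dots> = ?z \<otimes>\<^bsub>?L\<^esub> ?z" using z P by (simp add: L.localization_mult)
  finally have zrel: "?z \<otimes>\<^bsub>?L\<^esub> ?z = ?a \<odot>\<^bsub>?L\<^esub> ?z \<oplus>\<^bsub>?L\<^esub> ?b \<odot>\<^bsub>?L\<^esub> \<one>\<^bsub>?L\<^esub>" unfolding one ..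
  have cl: "?z \<in> carrier ?L" "?a \<in> carrier ?R" "?b \<in> carrier ?R"
    using z ab P by (auto intro!: L.frac_closed L.reg.frac_closed simp: L.carrier_regular)
  have slin: "\<sigma> (r \<odot>\<^bsub>S\<^esub> s) = r \<odot>\<^bsub>S\<^esub> \<sigma> s" if "r \<in> carrier R" "s \<in> carrier S" for r s
    using si that unfolding standard_involution_def by simp
  have "localization_map R W S \<sigma> ?z = ?a \<odot>\<^bsub>?L\<^esub> \<one>\<^bsub>?L\<^esub> \<ominus>\<^bsub>?L\<^esub> ?z"
  proof -
    have "\<forall>f\<in>carrier R. \<forall>z\<in>carrier (localization R (powers R f) S). \<forall>a\<in>carrier (fraction_ring R (powers R f)).
        \<forall>b\<in>carrier (fraction_ring R (powers R f)).
           is_basis (fraction_ring R (powers R f)) (localization R (powers R f) S) {\<one>\<^bsub>localization R (powers R f) S\<^esub>, z} \<longrightarrow>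
           z \<otimes>\<^bsub>localization R (powers R f) S\<^esub> z = a \<odot>\<^bsub>localization R (powers R f) S\<^esub> z \<oplus>\<^bsub>localization R (powers R f) S\<^esub> b \<odot>\<^bsub>localization R (powers R f) S\<^esub> \<one>\<^bsub>localization R (powers R f) S\<^esub> \<longrightarrow>
           localization_map R (powers R f) S \<sigma> z = a \<odot>\<^bsub>localization R (powers R f) S\<^esub> \<one>\<^bsub>localization R (powers R f) S\<^esub> \<ominus>\<^bsub>localization R (powers R f) S\<^esub> z"
      using si unfolding standard_involution_def Let_def by (elim conjE)
    from this[rule_format, OF f(1), folded W_def, OF cl] show ?thesis
      using basis zrel by (simp add: one)
  qed
  moreover have "localization_map R W S \<sigma> ?z = L.frac (\<sigma> z) \<one>\<^bsub>R\<^esub>"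
    by (rule L.localization_map_frac) (use slin z P in auto)
  ultimately have "L.frac (\<sigma> z) \<one>\<^bsub>R\<^esub> \<oplus>\<^bsub>?L\<^esub> ?z = (?a \<odot>\<^bsub>?L\<^esub> ?o \<ominus>\<^bsub>?L\<^esub> ?z) \<oplus>\<^bsub>?L\<^esub> ?z" by (simp add: one)
  also have aoc: "?a \<odot>\<^bsub>?L\<^esub> ?o = L.frac (B ?zz \<odot>\<^bsub>S\<^esub> \<one>\<^bsub>S\<^esub>) f"
    using ab f P by (simp add: L.localization_smult)
  also have "(L.frac (B ?zz \<odot>\<^bsub>S\<^esub> \<one>\<^bsub>S\<^esub>) f \<ominus>\<^bsub>?L\<^esub> ?z) \<oplus>\<^bsub>?L\<^esub> ?z = L.frac (B ?zz \<odot>\<^bsub>S\<^esub> \<one>\<^bsub>S\<^esub>) f"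
    using cl(1) L.frac_closed[of "B ?zz \<odot>\<^bsub>S\<^esub> \<one>\<^bsub>S\<^esub>" f] ab P(3)
    by (simp add: LG.minus_eq LG.a_assoc LG.l_neg)
  also have "L.frac (\<sigma> z) \<one>\<^bsub>R\<^esub> \<oplus>\<^bsub>?L\<^esub> ?z = L.frac (\<sigma> z \<oplus>\<^bsub>S\<^esub> z) \<one>\<^bsub>R\<^esub>"
    using z P by (simp add: L.localization_add)
  finally obtain u where u: "u \<in> W" "(u \<otimes>\<^bsub>R\<^esub> f) \<odot>\<^bsub>S\<^esub> (\<sigma> z \<oplus>\<^bsub>S\<^esub> z) = u \<odot>\<^bsub>S\<^esub> (B ?zz \<odot>\<^bsub>S\<^esub> \<one>\<^bsub>S\<^esub>)"
    using z ab P by (auto simp: L.frac_eq_iff Wc)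
  note uc = Wc[OF u(1)]
  have "u \<notin> p" using inv.R.powers_notin_prime[OF p f] u(1) unfolding W_def by simp
  then have ufp: "u \<otimes>\<^bsub>R\<^esub> f \<notin> p" using inv.R.primeideal_mult_notin[OF p uc f(1) _ f(2)] by simp
  have "?e (u \<otimes>\<^bsub>R\<^esub> f) \<otimes>\<^bsub>S\<^esub> (z \<oplus>\<^bsub>S\<^esub> \<sigma> z) = ?e (u \<otimes>\<^bsub>R\<^esub> B ?zz)"
  proof -
    have "z \<oplus>\<^bsub>S\<^esub> \<sigma> z = \<sigma> z \<oplus>\<^bsub>S\<^esub> z" using z by (simp add: inv.S.a_comm)
    then have "?e (u \<otimes>\<^bsub>R\<^esub> f) \<otimes>\<^bsub>S\<^esub> (z \<oplus>\<^bsub>S\<^esub> \<sigma> z) = (u \<otimes>\<^bsub>R\<^esub> f) \<odot>\<^bsub>S\<^esub> (\<sigma> z \<oplus>\<^bsub>S\<^esub> z)"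
      using uc f(1) z alg.smult_eq_emb[of "u \<otimes>\<^bsub>R\<^esub> f" "\<sigma> z \<oplus>\<^bsub>S\<^esub> z"] by simp
    also note u(2)
    finally show ?thesis using uc ab by (simp add: alg.smult_assoc1)
  qed
  then have "inv.quad_coords p (u \<otimes>\<^bsub>R\<^esub> f) z (\<lambda>s. u \<otimes>\<^bsub>R\<^esub> A s) (\<lambda>s. u \<otimes>\<^bsub>R\<^esub> B s)"
    unfolding inv.quad_coords_def using inv.local_coords_scale[OF lc uc ufp] by simp
  then show ?thesis by (intro exI)
qed

lemma standard_involution_extension:
  fixes R :: "('r, 'a) ring_scheme" and S :: "('r, 's, 'b) module_scheme"
  assumes alg: "algebra R S" and si: "standard_involution R S \<sigma>"
  shows "involution_extension R S (\<lambda>r. r \<odot>\<^bsub>S\<^esub> \<one>\<^bsub>S\<^esub>) \<sigma>"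
proof (intro involution_extension.intro involution_extension_axioms.intro algebra.emb_hom[OF alg])
  have h: "\<sigma> \<in> ring_hom S S" and l: "\<And>r s. r \<in> carrier R \<Longrightarrow> s \<in> carrier S \<Longrightarrow> \<sigma> (r \<odot>\<^bsub>S\<^esub> s) = r \<odot>\<^bsub>S\<^esub> \<sigma> s"
    and i: "\<And>s. s \<in> carrier S \<Longrightarrow> \<sigma> (\<sigma> s) = s"
    using si unfolding standard_involution_def by auto
  show "\<sigma> (r \<odot>\<^bsub>S\<^esub> \<one>\<^bsub>S\<^esub>) = r \<odot>\<^bsub>S\<^esub> \<one>\<^bsub>S\<^esub>" if "r \<in> carrier R" for r
    using l[OF that algebra.one_M_closed[OF alg]] ring_hom_one[OF h] by simp
qed (use si in \<open>auto simp: standard_involution_def dest: ring_hom_closed ring_hom_add ring_hom_mult\<close>)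

lemma quadratic_etale_involution:
  fixes R :: "('r, 'a) ring_scheme" and S :: "('r, 's, 'b) module_scheme"
  assumes qe: "quadratic_etale R S" and si: "standard_involution R S \<sigma>"
  shows "etale_involution R S (\<lambda>r. r \<odot>\<^bsub>S\<^esub> \<one>\<^bsub>S\<^esub>) \<sigma>"
proof -
  let ?e = "\<lambda>r. r \<odot>\<^bsub>S\<^esub> \<one>\<^bsub>S\<^esub>"
  have alg: "algebra R S" and triv: "trivial_group (kaehler_differentials R S)"
    and rank: "projective_of_rank R S 2"
    using qe unfolding quadratic_etale_def etale_def by auto
  note ie = standard_involution_extension[OF alg si]
  interpret inv: involution_extension R S ?e \<sigma> by (rule ie)
  interpret alg: algebra R S by (rule alg)
  obtain n \<xi> g where db: "inv.dual_basis n \<xi> g"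
    using dual_basis_exists[OF alg] rank unfolding projective_of_rank_def by metis
  show ?thesis
  proof (intro etale_involution.intro etale_involution_axioms.intro ie)
    fix \<mm> assume m: "maximalideal \<mm> R"
    have p: "primeideal \<mm> R" by (rule inv.R.maximalideal_prime[OF m])
    interpret L: localized_module R S "carrier R - \<mm>"
      by (intro localized_module.intro localized_module_axioms.intro alg.module)
        (use inv.R.primeideal_one_notin[OF p] inv.R.primeideal_mult_notin[OF p] in auto)
    obtain bas where bas: "card bas = 2" "is_basis (fraction_ring R (carrier R - \<mm>)) (localization R (carrier R - \<mm>) S) bas"
      using rank p unfolding projective_of_rank_def by auto
    obtain x1 x2 where x: "x1 \<in> carrier S" "x2 \<in> carrier S"
      "\<And>s. s \<in> carrier S \<Longrightarrow> \<exists>w\<in>carrier R - \<mm>. \<exists>r1\<in>carrier R. \<exists>r2\<in>carrier R. w \<odot>\<^bsub>S\<^esub> s = r1 \<odot>\<^bsub>S\<^esub> x1 \<oplus>\<^bsub>S\<^esub> r2 \<odot>\<^bsub>S\<^esub> x2"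
      "\<And>r1 r2. r1 \<in> carrier R \<Longrightarrow> r2 \<in> carrier R \<Longrightarrow> r1 \<odot>\<^bsub>S\<^esub> x1 \<oplus>\<^bsub>S\<^esub> r2 \<odot>\<^bsub>S\<^esub> x2 = \<zero>\<^bsub>S\<^esub>
        \<Longrightarrow> \<exists>u\<in>carrier R - \<mm>. u \<otimes>\<^bsub>R\<^esub> r1 = \<zero>\<^bsub>R\<^esub> \<and> u \<otimes>\<^bsub>R\<^esub> r2 = \<zero>\<^bsub>R\<^esub>"
      by (rule L.is_basis_pairD[OF bas(2,1)]) (rule that)
    have "inv.basis_at \<mm> x1 x2"
      unfolding inv.basis_at_def using x(1,2)
    proof (intro conjI ballI impI)
      fix s assume s: "s \<in> carrier S"
      from x(3)[OF s] obtain w r1 r2 where "w \<in> carrier R - \<mm>" "r1 \<in> carrier R" "r2 \<in> carrier R"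
        "w \<odot>\<^bsub>S\<^esub> s = r1 \<odot>\<^bsub>S\<^esub> x1 \<oplus>\<^bsub>S\<^esub> r2 \<odot>\<^bsub>S\<^esub> x2" by (elim bexE)
      then show "\<exists>w\<in>carrier R - \<mm>. \<exists>a\<in>carrier R. \<exists>b\<in>carrier R. ?e w \<otimes>\<^bsub>S\<^esub> s = ?e a \<otimes>\<^bsub>S\<^esub> x1 \<oplus>\<^bsub>S\<^esub> ?e b \<otimes>\<^bsub>S\<^esub> x2"
        using s x(1,2)
        by (intro bexI[of _ w] bexI[of _ r1] bexI[of _ r2]) (simp_all add: alg.smult_eq_emb[symmetric])
    next
      fix a b assume "a \<in> carrier R" "b \<in> carrier R" "?e a \<otimes>\<^bsub>S\<^esub> x1 \<oplus>\<^bsub>S\<^esub> ?e b \<otimes>\<^bsub>S\<^esub> x2 = \<zero>\<^bsub>S\<^esub>"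
      then show "\<exists>w\<in>carrier R - \<mm>. w \<otimes>\<^bsub>R\<^esub> a = \<zero>\<^bsub>R\<^esub> \<and> w \<otimes>\<^bsub>R\<^esub> b = \<zero>\<^bsub>R\<^esub>"
        using x by (simp add: alg.smult_eq_emb[symmetric])
    qed
    then obtain z where "inv.basis_at \<mm> \<one>\<^bsub>S\<^esub> z" by (rule inv.basis_at_one[OF p])
    then obtain f A B where "inv.local_coords \<mm> f z A B" by (rule inv.local_coords_exist[OF p _ db])
    then show "\<exists>f z A B. inv.quad_coords \<mm> f z A B"
      using standard_involution_quad_coords[OF alg p si ie] by metis
  next
    fix Q assume Q: "maximalideal Q S"
    show "inv.no_derivations Q"
      unfolding inv.no_derivations_def
    proof (intro ballI impI)
      fix d s assume d: "d \<in> carrier S \<rightarrow> carrier S"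
        "\<forall>s\<in>carrier S. \<forall>t\<in>carrier S. d (s \<oplus>\<^bsub>S\<^esub> t) = d s \<oplus>\<^bsub>S\<^esub> d t"
        "\<forall>r\<in>carrier R. \<forall>s\<in>carrier S. d (?e r \<otimes>\<^bsub>S\<^esub> s) = ?e r \<otimes>\<^bsub>S\<^esub> d s"
        "\<forall>s\<in>carrier S. \<forall>t\<in>carrier S. d (s \<otimes>\<^bsub>S\<^esub> t) \<ominus>\<^bsub>S\<^esub> (s \<otimes>\<^bsub>S\<^esub> d t \<oplus>\<^bsub>S\<^esub> t \<otimes>\<^bsub>S\<^esub> d s) \<in> Q"
        and s: "s \<in> carrier S"
      have dc: "d s \<in> carrier S" if "s \<in> carrier S" for s using d(1) that by auto
      show "d s \<in> Q"
      proof (rule kaehler_trivial_no_derivations[OF alg triv maximalideal.axioms(1)[OF Q] dc _ _ _ s])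
        show "d (r \<odot>\<^bsub>S\<^esub> s) = r \<odot>\<^bsub>S\<^esub> d s" if "r \<in> carrier R" "s \<in> carrier S" for r s
          using d(3)[rule_format, OF that] dc that by (simp add: alg.smult_eq_emb[symmetric])
      qed (use d(2,4) in auto)
    qed
  qed
qed

section \<open>Polynomial functions with values in the extension\<close>

context etale_involution
begin

text \<open>Sums of functions \<open>p(x) c\<close> with \<open>p\<close> polynomial over \<open>R\<close> and \<open>c\<close> in \<open>S\<close>. In contrast to polynomial
  functions over \<open>S\<close> they are stable under \<open>\<sigma>\<close>.\<close>

inductive_set spoly :: "nat \<Rightarrow> ((nat \<Rightarrow> 'a) \<Rightarrow> 'c) set" for n where
  zero: "(\<lambda>x. \<zero>\<^bsub>S\<^esub>) \<in> spoly n"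
| step: "F \<in> spoly n \<Longrightarrow> R.poly_on n p \<Longrightarrow> c \<in> carrier S \<Longrightarrow> (\<lambda>x. F x \<oplus>\<^bsub>S\<^esub> h (p x) \<otimes>\<^bsub>S\<^esub> c) \<in> spoly n"

definition spoly_on :: "nat \<Rightarrow> ((nat \<Rightarrow> 'a) \<Rightarrow> 'c) \<Rightarrow> bool" where
  "spoly_on n F \<longleftrightarrow> (\<exists>G\<in>spoly n. \<forall>x\<in>{..<n} \<rightarrow> carrier R. F x = G x)"

lemma spoly_closed:
  "F \<in> spoly n \<Longrightarrow> x \<in> {..<n} \<rightarrow> carrier R \<Longrightarrow> F x \<in> carrier S"
  by (induction rule: spoly.induct) (auto simp: R.poly_on_closed)

lemma spoly_on_closed: "spoly_on n F \<Longrightarrow> x \<in> {..<n} \<rightarrow> carrier R \<Longrightarrow> F x \<in> carrier S"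
  using spoly_closed unfolding spoly_on_def by auto

lemma spoly_on_cong:
  assumes "spoly_on n F" "\<And>x. x \<in> {..<n} \<rightarrow> carrier R \<Longrightarrow> G x = F x"
  shows "spoly_on n G"
  using assms unfolding spoly_on_def by fastforce

lemma spoly_on_spoly: "F \<in> spoly n \<Longrightarrow> spoly_on n F"
  unfolding spoly_on_def by auto

lemma spoly_on_step:
  assumes "spoly_on n F" "R.poly_on n p" "c \<in> carrier S"
  shows "spoly_on n (\<lambda>x. F x \<oplus>\<^bsub>S\<^esub> h (p x) \<otimes>\<^bsub>S\<^esub> c)"
proof -
  obtain G where G: "G \<in> spoly n" "\<And>x. x \<in> {..<n} \<rightarrow> carrier R \<Longrightarrow> F x = G x"
    using assms(1) unfolding spoly_on_def by auto
  show ?thesis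
    by (rule spoly_on_cong[OF spoly_on_spoly[OF spoly.step[OF G(1) assms(2,3)]]]) (simp add: G(2))
qed

lemma spoly_on_induct [consumes 1, case_names cong zero step]:
  assumes "spoly_on n F"
    and "\<And>F G. P F \<Longrightarrow> (\<And>x. x \<in> {..<n} \<rightarrow> carrier R \<Longrightarrow> G x = F x) \<Longrightarrow> P G"
    and "P (\<lambda>x. \<zero>\<^bsub>S\<^esub>)"
    and "\<And>F p c. spoly_on n F \<Longrightarrow> P F \<Longrightarrow> R.poly_on n p \<Longrightarrow> c \<in> carrier S \<Longrightarrow> P (\<lambda>x. F x \<oplus>\<^bsub>S\<^esub> h (p x) \<otimes>\<^bsub>S\<^esub> c)"
  shows "P F"
proof -
  have "G \<in> spoly n \<Longrightarrow> P G" for G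
    by (induction rule: spoly.induct) (use assms spoly_on_spoly in auto)
  then show ?thesis using assms(1,2) unfolding spoly_on_def by metis
qed

lemma spoly_on_scaled:
  assumes "R.poly_on n p" "c \<in> carrier S"
  shows "spoly_on n (\<lambda>x. h (p x) \<otimes>\<^bsub>S\<^esub> c)"
  by (rule spoly_on_cong[OF spoly_on_step[OF spoly_on_spoly[OF spoly.zero] assms]])
    (use assms R.poly_on_closed in auto)

lemma spoly_on_const:
  assumes "c \<in> carrier S"
  shows "spoly_on n (\<lambda>x. c)"
  by (rule spoly_on_cong[OF spoly_on_scaled[OF R.poly_on_const[OF R.one_closed] assms]]) (use assms in simp)

lemma spoly_on_add:
  assumes "spoly_on n F" "spoly_on n G"
  shows "spoly_on n (\<lambda>x. F x \<oplus>\<^bsub>S\<^esub> G x)"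
  using assms(2)
proof (induction rule: spoly_on_induct)
  case (cong G G')
  then show ?case by (elim spoly_on_cong) simp
next
  case zero
  show ?case by (rule spoly_on_cong[OF assms(1)]) (use spoly_on_closed[OF assms(1)] in auto)
next
  case (step G p c)
  show ?case
    by (rule spoly_on_cong[OF spoly_on_step[OF step(4,2,3)]])
      (use spoly_on_closed[OF assms(1)] spoly_on_closed[OF step(1)] R.poly_on_closed[OF step(2)] step(3) in
        \<open>auto simp: S.a_assoc\<close>)
qed

lemma spoly_on_scale:
  assumes "spoly_on n F" "R.poly_on n p" "c \<in> carrier S"
  shows "spoly_on n (\<lambda>x. F x \<otimes>\<^bsub>S\<^esub> (h (p x) \<otimes>\<^bsub>S\<^esub> c))"
  using assms(1)
proof (induction rule: spoly_on_induct)
  case (cong G G')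
  then show ?case by (elim spoly_on_cong) simp
next
  case zero
  show ?case by (rule spoly_on_cong[OF spoly_on_const[OF S.zero_closed]]) (use assms R.poly_on_closed in auto)
next
  case (step G q d)
  have "spoly_on n (\<lambda>x. h (q x \<otimes> p x) \<otimes>\<^bsub>S\<^esub> (d \<otimes>\<^bsub>S\<^esub> c))"
    using R.poly_on_mult[OF step(2) assms(2)] step(3) assms(3) by (intro spoly_on_scaled) auto
  from spoly_on_add[OF step(4) this] show ?case
    by (rule spoly_on_cong)
      (use spoly_on_closed[OF step(1)] R.poly_on_closed[OF step(2)] R.poly_on_closed[OF assms(2)] step(3) assms(3) in
        \<open>auto simp: S.l_distr S.r_distr S.m_ac\<close>)
qed

lemma spoly_on_mult:
  assumes "spoly_on n F" "spoly_on n G"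
  shows "spoly_on n (\<lambda>x. F x \<otimes>\<^bsub>S\<^esub> G x)"
  using assms(2)
proof (induction rule: spoly_on_induct)
  case (cong G G')
  then show ?case by (elim spoly_on_cong) simp
next
  case zero
  show ?case by (rule spoly_on_cong[OF spoly_on_const[OF S.zero_closed]]) (use spoly_on_closed[OF assms(1)] in auto)
next
  case (step G p c)
  show ?case
    by (rule spoly_on_cong[OF spoly_on_add[OF step(4) spoly_on_scale[OF assms(1) step(2,3)]]])
      (use spoly_on_closed[OF assms(1)] spoly_on_closed[OF step(1)] R.poly_on_closed[OF step(2)] step(3) in
        \<open>auto simp: S.r_distr\<close>)
qed

lemma spoly_on_minus:
  assumes "spoly_on n F"
  shows "spoly_on n (\<lambda>x. \<ominus>\<^bsub>S\<^esub> F x)"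
  by (rule spoly_on_cong[OF spoly_on_mult[OF spoly_on_const[of "\<ominus>\<^bsub>S\<^esub> \<one>\<^bsub>S\<^esub>"] assms]])
    (use spoly_on_closed[OF assms] in \<open>auto simp: S.l_minus\<close>)

lemma spoly_on_diff:
  assumes "spoly_on n F" "spoly_on n G"
  shows "spoly_on n (\<lambda>x. F x \<ominus>\<^bsub>S\<^esub> G x)"
  unfolding S.minus_eq by (intro spoly_on_add spoly_on_minus assms)

lemma spoly_on_sigma:
  assumes "spoly_on n F"
  shows "spoly_on n (\<lambda>x. \<sigma> (F x))"
  using assms
proof (induction rule: spoly_on_induct)
  case (cong G G')
  then show ?case by (elim spoly_on_cong) simp
next
  case zero
  show ?case by (simp add: spoly_on_const)
next
  case (step G p c)
  have "spoly_on n (\<lambda>x. \<sigma> (G x) \<oplus>\<^bsub>S\<^esub> h (p x) \<otimes>\<^bsub>S\<^esub> \<sigma> c)" using step by (intro spoly_on_step) auto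
  then show ?case
    by (rule spoly_on_cong) (use spoly_on_closed[OF step(1)] R.poly_on_closed[OF step(2)] step(3) in simp)
qed

text \<open>The trace and the norm of such a function are polynomial functions over \<open>R\<close>; this uses only that traces
  and norms of single elements come from \<open>R\<close>.\<close>

lemma spoly_on_trace:
  assumes "spoly_on n F" "c \<in> carrier S"
  shows "\<exists>p. R.poly_on n p \<and> (\<forall>x\<in>{..<n} \<rightarrow> carrier R. F x \<otimes>\<^bsub>S\<^esub> c \<oplus>\<^bsub>S\<^esub> \<sigma> (F x \<otimes>\<^bsub>S\<^esub> c) = h (p x))"
  using assms(1)
proof (induction rule: spoly_on_induct)
  case (cong G G')
  then show ?case by simp
next
  case zero
  show ?case using R.poly_on_const[OF R.zero_closed, of n] assms(2) by (intro exI[of _ "\<lambda>x. \<zero>"]) simp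
next
  case (step G q d)
  then obtain p where p: "R.poly_on n p" "\<And>x. x\<in>{..<n} \<rightarrow> carrier R \<Longrightarrow> G x \<otimes>\<^bsub>S\<^esub> c \<oplus>\<^bsub>S\<^esub> \<sigma> (G x \<otimes>\<^bsub>S\<^esub> c) = h (p x)"
    by auto
  obtain t where t: "t \<in> carrier R" "d \<otimes>\<^bsub>S\<^esub> c \<oplus>\<^bsub>S\<^esub> \<sigma> (d \<otimes>\<^bsub>S\<^esub> c) = h t"
    using trace_in_range[of "d \<otimes>\<^bsub>S\<^esub> c"] step(3) assms(2) by auto
  have "(G x \<oplus>\<^bsub>S\<^esub> h (q x) \<otimes>\<^bsub>S\<^esub> d) \<otimes>\<^bsub>S\<^esub> c \<oplus>\<^bsub>S\<^esub> \<sigma> ((G x \<oplus>\<^bsub>S\<^esub> h (q x) \<otimes>\<^bsub>S\<^esub> d) \<otimes>\<^bsub>S\<^esub> c) = h (p x \<oplus> t \<otimes> q x)"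
    if x: "x \<in> {..<n} \<rightarrow> carrier R" for x
  proof -
    note cl = spoly_on_closed[OF step(1) x] R.poly_on_closed[OF step(2) x] R.poly_on_closed[OF p(1) x] step(3) assms(2) t(1)
    have "(G x \<oplus>\<^bsub>S\<^esub> h (q x) \<otimes>\<^bsub>S\<^esub> d) \<otimes>\<^bsub>S\<^esub> c \<oplus>\<^bsub>S\<^esub> \<sigma> ((G x \<oplus>\<^bsub>S\<^esub> h (q x) \<otimes>\<^bsub>S\<^esub> d) \<otimes>\<^bsub>S\<^esub> c)
      = (G x \<otimes>\<^bsub>S\<^esub> c \<oplus>\<^bsub>S\<^esub> \<sigma> (G x \<otimes>\<^bsub>S\<^esub> c)) \<oplus>\<^bsub>S\<^esub> (d \<otimes>\<^bsub>S\<^esub> c \<oplus>\<^bsub>S\<^esub> \<sigma> (d \<otimes>\<^bsub>S\<^esub> c)) \<otimes>\<^bsub>S\<^esub> h (q x)"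
      using cl by (simp add: S.l_distr S.r_distr S.m_ac S.a_ac)
    then show ?thesis unfolding p(2)[OF x] t(2) using cl by simp
  qed
  then show ?case using R.poly_on_add[OF p(1) R.poly_on_scale[OF t(1) step(2)]]
    by (intro exI[of _ "\<lambda>x. p x \<oplus> t \<otimes> q x"]) simp
qed

lemma spoly_on_norm:
  assumes "spoly_on n F"
  shows "\<exists>p. R.poly_on n p \<and> (\<forall>x\<in>{..<n} \<rightarrow> carrier R. F x \<otimes>\<^bsub>S\<^esub> \<sigma> (F x) = h (p x))"
  using assms(1)
proof (induction rule: spoly_on_induct)
  case (cong G G')
  then show ?case by simp
next
  case zero
  show ?case using R.poly_on_const[OF R.zero_closed, of n] by (intro exI[of _ "\<lambda>x. \<zero>"]) simp
next
  case (step G q d)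
  then obtain p where p: "R.poly_on n p" "\<And>x. x\<in>{..<n} \<rightarrow> carrier R \<Longrightarrow> G x \<otimes>\<^bsub>S\<^esub> \<sigma> (G x) = h (p x)"
    by auto
  obtain t where t: "R.poly_on n t" "\<And>x. x\<in>{..<n} \<rightarrow> carrier R \<Longrightarrow> G x \<otimes>\<^bsub>S\<^esub> \<sigma> d \<oplus>\<^bsub>S\<^esub> \<sigma> (G x \<otimes>\<^bsub>S\<^esub> \<sigma> d) = h (t x)"
    using spoly_on_trace[OF step(1), of "\<sigma> d"] step(3) by auto
  obtain u where u: "u \<in> carrier R" "d \<otimes>\<^bsub>S\<^esub> \<sigma> d = h u" using norm_in_range[OF step(3)] by auto
  have "(G x \<oplus>\<^bsub>S\<^esub> h (q x) \<otimes>\<^bsub>S\<^esub> d) \<otimes>\<^bsub>S\<^esub> \<sigma> (G x \<oplus>\<^bsub>S\<^esub> h (q x) \<otimes>\<^bsub>S\<^esub> d) = h (p x \<oplus> t x \<otimes> q x \<oplus> u \<otimes> (q x \<otimes> q x))"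
    if x: "x \<in> {..<n} \<rightarrow> carrier R" for x
  proof -
    note cl = spoly_on_closed[OF step(1) x] R.poly_on_closed[OF step(2) x] R.poly_on_closed[OF p(1) x]
      step(3) R.poly_on_closed[OF t(1) x] u(1)
    have "(G x \<oplus>\<^bsub>S\<^esub> h (q x) \<otimes>\<^bsub>S\<^esub> d) \<otimes>\<^bsub>S\<^esub> (\<sigma> (G x) \<oplus>\<^bsub>S\<^esub> h (q x) \<otimes>\<^bsub>S\<^esub> \<sigma> d)
      = G x \<otimes>\<^bsub>S\<^esub> \<sigma> (G x) \<oplus>\<^bsub>S\<^esub> (G x \<otimes>\<^bsub>S\<^esub> \<sigma> d \<oplus>\<^bsub>S\<^esub> \<sigma> (G x) \<otimes>\<^bsub>S\<^esub> d) \<otimes>\<^bsub>S\<^esub> h (q x) \<oplus>\<^bsub>S\<^esub> (d \<otimes>\<^bsub>S\<^esub> \<sigma> d) \<otimes>\<^bsub>S\<^esub> (h (q x) \<otimes>\<^bsub>S\<^esub> h (q x))"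
      by (rule S.ring_identityI[of _ "[G x, \<sigma> (G x), h (q x), d, \<sigma> d]"], (rule S.reify_rules)+)
        (use cl in \<open>simp_all add: S.in_carrier_simps norm_simps\<close>)
    moreover have "G x \<otimes>\<^bsub>S\<^esub> \<sigma> d \<oplus>\<^bsub>S\<^esub> \<sigma> (G x) \<otimes>\<^bsub>S\<^esub> d = h (t x)" using t(2)[OF x] cl by simp
    ultimately show ?thesis using p(2)[OF x] u(2) cl by simp
  qed
  moreover have "R.poly_on n (\<lambda>x. p x \<oplus> t x \<otimes> q x \<oplus> u \<otimes> (q x \<otimes> q x))"
    using p(1) t(1) u(1) step(2) by (intro R.poly_on_add R.poly_on_mult R.poly_on_scale)
  ultimately show ?case by (intro exI conjI ballI)
qed

text \<open>The LG property for functions with values in \<open>S\<close>: take norms. A value whose norm lies in \<open>\<mm>\<close> lies, up to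
  \<open>\<sigma>\<close>, in any chosen prime of \<open>S\<close> over \<open>\<mm>\<close>.\<close>

lemma spoly_on_unit:
  assumes LG: "LG_ring R" and F: "spoly_on n F"
    and loc: "\<And>\<mm>. maximalideal \<mm> R \<Longrightarrow> \<exists>Q x. primeideal Q S \<and> (\<forall>r\<in>\<mm>. h r \<in> Q) \<and>
      x \<in> {..<n} \<rightarrow> carrier R \<and> F x \<notin> Q \<and> \<sigma> (F x) \<notin> Q"
  shows "\<exists>x\<in>{..<n} \<rightarrow> carrier R. F x \<in> Units S"
proof -
  obtain p where p: "R.poly_on n p" "\<And>x. x\<in>{..<n} \<rightarrow> carrier R \<Longrightarrow> F x \<otimes>\<^bsub>S\<^esub> \<sigma> (F x) = h (p x)"
    using spoly_on_norm[OF F] by auto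
  have "\<exists>x\<in>{..<n} \<rightarrow> carrier R. p x \<notin> \<mm>" if m: "maximalideal \<mm> R" for \<mm>
  proof -
    obtain Q x where Q: "primeideal Q S" "\<forall>r\<in>\<mm>. h r \<in> Q" and x: "x \<in> {..<n} \<rightarrow> carrier R" "F x \<notin> Q" "\<sigma> (F x) \<notin> Q"
      using loc[OF m] by (elim exE conjE)
    have Fx: "F x \<in> carrier S" by (rule spoly_on_closed[OF F x(1)])
    have "h (p x) \<notin> Q"
      unfolding p(2)[OF x(1), symmetric] using S.primeideal_mult_notin[OF Q(1) Fx _ x(2,3)] Fx by simp
    then have "p x \<notin> \<mm>" using Q(2) by auto
    then show ?thesis using x(1) by (intro bexI)
  qed
  then have "\<exists>x\<in>{..<n} \<rightarrow> carrier R. p x \<in> Units R" by (rule R.LG_ring_poly_on[OF LG p(1)])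
  then obtain x where x: "x\<in>{..<n} \<rightarrow> carrier R" "p x \<in> Units R" by (elim bexE)
  note Fx = spoly_on_closed[OF F x(1)]
  have "F x \<otimes>\<^bsub>S\<^esub> (\<sigma> (F x) \<otimes>\<^bsub>S\<^esub> h (inv p x)) = h (p x) \<otimes>\<^bsub>S\<^esub> h (inv p x)"
    using Fx R.Units_closed[OF x(2)] x(2) p(2)[OF x(1)] by (simp only: S.m_assoc[symmetric] sigma_closed hom_closed R.Units_inv_closed)
  also have "\<dots> = h (p x \<otimes> inv p x)"
    by (rule hom_mult[symmetric]) (use R.Units_closed[OF x(2)] x(2) in simp_all)
  also have "\<dots> = \<one>\<^bsub>S\<^esub>" using x(2) by (simp only: R.Units_r_inv hom_one)
  finally have 1: "F x \<otimes>\<^bsub>S\<^esub> (\<sigma> (F x) \<otimes>\<^bsub>S\<^esub> h (inv p x)) = \<one>\<^bsub>S\<^esub>" .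
  have c: "\<sigma> (F x) \<otimes>\<^bsub>S\<^esub> h (inv p x) \<in> carrier S" using Fx x(2) by simp
  have "F x \<in> Units S" using 1 c Fx S.m_comm[OF Fx c] unfolding Units_def by auto
  then show ?thesis using x(1) by (intro bexI)
qed

text \<open>Coordinate functions: since \<open>S\<close> is a finite \<open>R\<close>-module, \<open>S\<^sup>3\<close> is parametrised by polynomial functions.\<close>

lemma spoly_on_sum:
  fixes k :: nat
  assumes "\<And>i. i < k \<Longrightarrow> spoly_on n (F i)"
  shows "spoly_on n (\<lambda>x. \<Oplus>\<^bsub>S\<^esub>i\<in>{..<k}. F i x)"
  using assms
proof (induction k)
  case 0
  then show ?case by (simp add: spoly_on_const)
next
  case (Suc k)
  have "spoly_on n (\<lambda>x. F k x \<oplus>\<^bsub>S\<^esub> (\<Oplus>\<^bsub>S\<^esub>i\<in>{..<k}. F i x))" using Suc by (intro spoly_on_add) auto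
  then show ?case
    by (rule spoly_on_cong) (use spoly_on_closed[OF Suc.prems] in \<open>simp add: lessThan_Suc S.finsum_insert Pi_def\<close>)
qed

lemma three_coordinates:
  assumes db: "dual_basis n \<xi> g"
  obtains F1 F2 F3 where "spoly_on (3 * n) F1" "spoly_on (3 * n) F2" "spoly_on (3 * n) F3"
    "\<And>a b c. a \<in> carrier S \<Longrightarrow> b \<in> carrier S \<Longrightarrow> c \<in> carrier S \<Longrightarrow>
      \<exists>x\<in>{..<3 * n} \<rightarrow> carrier R. F1 x = a \<and> F2 x = b \<and> F3 x = c"
proof -
  let ?F = "\<lambda>j x. \<Oplus>\<^bsub>S\<^esub>i\<in>{..<n}. h (x (j * n + i)) \<otimes>\<^bsub>S\<^esub> g i"
  have g: "\<And>i. i < n \<Longrightarrow> g i \<in> carrier S" and lin: "\<And>i. i < n \<Longrightarrow> linear_form (\<xi> i)"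
    and sum: "\<And>s. s \<in> carrier S \<Longrightarrow> (\<Oplus>\<^bsub>S\<^esub>i\<in>{..<n}. h (\<xi> i s) \<otimes>\<^bsub>S\<^esub> g i) = s"
    using db unfolding dual_basis_def by auto
  have idx: "j * n + i < 3 * n" if "j < 3" "i < n" for i j
  proof -
    have "j * n \<le> 2 * n" using that(1) by (intro mult_le_mono1) simp
    then show ?thesis using that(2) by linarith
  qed
  have sp: "spoly_on (3 * n) (?F j)" if "j < 3" for j
    using idx[OF that] g by (intro spoly_on_sum spoly_on_scaled R.poly_on_var) auto
  have "\<exists>x\<in>{..<3 * n} \<rightarrow> carrier R. ?F 0 x = a \<and> ?F 1 x = b \<and> ?F 2 x = c"
    if abc: "a \<in> carrier S" "b \<in> carrier S" "c \<in> carrier S" for a b c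
  proof -
    define s where "s j = (if j = 0 then a else if j = 1 then b else c)" for j :: nat
    have s: "s j \<in> carrier S" for j using abc by (simp add: s_def)
    define x where "x k = \<xi> (k mod n) (s (k div n))" for k
    have "x \<in> {..<3 * n} \<rightarrow> carrier R"
    proof
      fix k assume "k \<in> {..<3 * n}"
      then have "k mod n < n" by (cases "n = 0") auto
      then show "x k \<in> carrier R" unfolding x_def using linear_formD(1)[OF lin s] by simp
    qed
    moreover have e: "?F j x = s j" for j
    proof -
      have "?F j x = (\<Oplus>\<^bsub>S\<^esub>i\<in>{..<n}. h (\<xi> i (s j)) \<otimes>\<^bsub>S\<^esub> g i)"
        by (rule S.finsum_cong') (use g linear_formD(1)[OF lin s] in \<open>auto simp: x_def\<close>)
      then show ?thesis using sum[OF s] by simp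
    qed
    ultimately show ?thesis
      using e[of 0] e[of 1] e[of 2] by (intro bexI[of _ x] conjI) (simp_all only: s_def, simp_all)
  qed
  then show ?thesis using that[OF sp[of 0] sp[of 1] sp[of 2]] by simp
qed

end

section \<open>A unit value\<close>

context etale_involution
begin

text \<open>For hyperbolic pairs \<open>(e, f)\<close> and \<open>(e', f')\<close> with \<open>e' = ea + fb + m\<close> and \<open>f' = ea1 + fb1 + m'\<close> this is the
  value of the form at \<open>e'\<close> and \<open>f + mx + m'y + et\<close>; here \<open>q\<close>, \<open>w\<close> and \<open>q'\<close> are the values of the form on \<open>m\<close> and \<open>m'\<close>,
  and \<open>t\<close> is the choice, parametrised by \<open>s\<close>, that makes the second vector isotropic.\<close>

definition neighbour_value where
  "neighbour_value l a b q w q' x y s = \<sigma> a \<oplus>\<^bsub>S\<^esub> \<sigma> b \<otimes>\<^bsub>S\<^esub> (s \<ominus>\<^bsub>S\<^esub> \<sigma> s \<ominus>\<^bsub>S\<^esub> l \<otimes>\<^bsub>S\<^esub>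
      (\<sigma> x \<otimes>\<^bsub>S\<^esub> x \<otimes>\<^bsub>S\<^esub> q \<oplus>\<^bsub>S\<^esub> \<sigma> x \<otimes>\<^bsub>S\<^esub> y \<otimes>\<^bsub>S\<^esub> w \<oplus>\<^bsub>S\<^esub> \<sigma> y \<otimes>\<^bsub>S\<^esub> x \<otimes>\<^bsub>S\<^esub> \<sigma> w \<oplus>\<^bsub>S\<^esub> \<sigma> y \<otimes>\<^bsub>S\<^esub> y \<otimes>\<^bsub>S\<^esub> q'))
    \<oplus>\<^bsub>S\<^esub> q \<otimes>\<^bsub>S\<^esub> x \<oplus>\<^bsub>S\<^esub> w \<otimes>\<^bsub>S\<^esub> y"

lemma neighbour_value_closed:
  assumes "l \<in> carrier S" "a \<in> carrier S" "b \<in> carrier S" "q \<in> carrier S" "w \<in> carrier S" "q' \<in> carrier S"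
    "x \<in> carrier S" "y \<in> carrier S" "s \<in> carrier S"
  shows "neighbour_value l a b q w q' x y s \<in> carrier S"
  using assms unfolding neighbour_value_def by simp

text \<open>Where \<open>c\<close> is an inverse of \<open>b\<close>, this is the choice for which the isotropic vector becomes \<open>e'c + e\<delta>\<close>, so that
  its product with \<open>e'\<close> is \<open>\<sigma>(b)\<delta>\<close>.\<close>

lemma neighbour_value_invertible_b:
  assumes c: "l \<in> carrier S" "a \<in> carrier S" "b \<in> carrier S" "w \<in> carrier S" "q' \<in> carrier S" "c \<in> carrier S" "\<delta> \<in> carrier S"
    and l: "\<sigma> l = \<one>\<^bsub>S\<^esub> \<ominus>\<^bsub>S\<^esub> l" and d: "\<sigma> \<delta> = \<ominus>\<^bsub>S\<^esub> \<delta>"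
  defines "q \<equiv> \<ominus>\<^bsub>S\<^esub> (\<sigma> a \<otimes>\<^bsub>S\<^esub> b \<oplus>\<^bsub>S\<^esub> \<sigma> b \<otimes>\<^bsub>S\<^esub> a)"
  defines "s \<equiv> l \<otimes>\<^bsub>S\<^esub> (a \<otimes>\<^bsub>S\<^esub> c \<oplus>\<^bsub>S\<^esub> \<delta> \<oplus>\<^bsub>S\<^esub> l \<otimes>\<^bsub>S\<^esub> (\<sigma> c \<otimes>\<^bsub>S\<^esub> c \<otimes>\<^bsub>S\<^esub> q))"
  shows "neighbour_value l a b q w q' c \<zero>\<^bsub>S\<^esub> s = \<sigma> b \<otimes>\<^bsub>S\<^esub> \<delta>
    \<oplus>\<^bsub>S\<^esub> (b \<otimes>\<^bsub>S\<^esub> c \<ominus>\<^bsub>S\<^esub> \<one>\<^bsub>S\<^esub>) \<otimes>\<^bsub>S\<^esub> (\<sigma> b \<otimes>\<^bsub>S\<^esub> (\<one>\<^bsub>S\<^esub> \<ominus>\<^bsub>S\<^esub> l) \<otimes>\<^bsub>S\<^esub> \<sigma> a \<otimes>\<^bsub>S\<^esub> \<sigma> c \<ominus>\<^bsub>S\<^esub> \<sigma> a)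
    \<oplus>\<^bsub>S\<^esub> (\<sigma> b \<otimes>\<^bsub>S\<^esub> \<sigma> c \<ominus>\<^bsub>S\<^esub> \<one>\<^bsub>S\<^esub>) \<otimes>\<^bsub>S\<^esub> (\<sigma> b \<otimes>\<^bsub>S\<^esub> (\<one>\<^bsub>S\<^esub> \<ominus>\<^bsub>S\<^esub> l) \<otimes>\<^bsub>S\<^esub> a \<otimes>\<^bsub>S\<^esub> c)"
proof -
  have qc: "q \<in> carrier S" "\<sigma> q = q" unfolding q_def using c by (simp_all add: S.m_ac S.a_ac)
  have sc: "\<sigma> s = (\<one>\<^bsub>S\<^esub> \<ominus>\<^bsub>S\<^esub> l) \<otimes>\<^bsub>S\<^esub> (\<sigma> a \<otimes>\<^bsub>S\<^esub> \<sigma> c \<oplus>\<^bsub>S\<^esub> \<ominus>\<^bsub>S\<^esub> \<delta> \<oplus>\<^bsub>S\<^esub> (\<one>\<^bsub>S\<^esub> \<ominus>\<^bsub>S\<^esub> l) \<otimes>\<^bsub>S\<^esub> (c \<otimes>\<^bsub>S\<^esub> \<sigma> c \<otimes>\<^bsub>S\<^esub> q))"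
    unfolding s_def using c qc by (simp add: l d)
  have "neighbour_value l a b q w q' c \<zero>\<^bsub>S\<^esub> s
      = \<sigma> a \<oplus>\<^bsub>S\<^esub> \<sigma> b \<otimes>\<^bsub>S\<^esub> (s \<ominus>\<^bsub>S\<^esub> \<sigma> s \<ominus>\<^bsub>S\<^esub> l \<otimes>\<^bsub>S\<^esub> (\<sigma> c \<otimes>\<^bsub>S\<^esub> c \<otimes>\<^bsub>S\<^esub> q)) \<oplus>\<^bsub>S\<^esub> q \<otimes>\<^bsub>S\<^esub> c"
    unfolding neighbour_value_def using c qc by (simp add: s_def)
  also have "\<dots> = \<sigma> b \<otimes>\<^bsub>S\<^esub> \<delta>
    \<oplus>\<^bsub>S\<^esub> (b \<otimes>\<^bsub>S\<^esub> c \<ominus>\<^bsub>S\<^esub> \<one>\<^bsub>S\<^esub>) \<otimes>\<^bsub>S\<^esub> (\<sigma> b \<otimes>\<^bsub>S\<^esub> (\<one>\<^bsub>S\<^esub> \<ominus>\<^bsub>S\<^esub> l) \<otimes>\<^bsub>S\<^esub> \<sigma> a \<otimes>\<^bsub>S\<^esub> \<sigma> c \<ominus>\<^bsub>S\<^esub> \<sigma> a)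
    \<oplus>\<^bsub>S\<^esub> (\<sigma> b \<otimes>\<^bsub>S\<^esub> \<sigma> c \<ominus>\<^bsub>S\<^esub> \<one>\<^bsub>S\<^esub>) \<otimes>\<^bsub>S\<^esub> (\<sigma> b \<otimes>\<^bsub>S\<^esub> (\<one>\<^bsub>S\<^esub> \<ominus>\<^bsub>S\<^esub> l) \<otimes>\<^bsub>S\<^esub> a \<otimes>\<^bsub>S\<^esub> c)"
    unfolding sc unfolding s_def q_def
    by (rule S.ring_identityI[of _ "[a, \<sigma> a, b, \<sigma> b, c, \<sigma> c, l, \<delta>]"], (rule S.reify_rules)+)
      (use c in \<open>simp_all add: S.in_carrier_simps norm_simps\<close>)
  finally show ?thesis .
qed

text \<open>Local solvability, in the residue field \<open>K\<close> of a prime of \<open>S\<close> with residue map \<open>\<phi>\<close>. The other prime over the same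
  maximal ideal of \<open>R\<close> enters through \<open>\<phi> \<circ> \<sigma>\<close>. If the two differ, an element \<open>u\<close> separates them and both residues of \<open>y\<close>
  can be chosen independently. If \<open>b\<close> vanishes at one of the primes, then \<open>y\<close> makes the value nonzero there, and \<open>s\<close>
  takes care of the other prime if necessary; if \<open>b\<close> vanishes at neither, the previous lemma applies.\<close>

lemma neighbour_value_nonzero_local:
  fixes K :: "('k, 'kb) ring_scheme"
  assumes dom: "domain K" and hom: "ring_hom_cring S K \<phi>"
    and c: "l \<in> carrier S" "a \<in> carrier S" "b \<in> carrier S" "a1 \<in> carrier S" "b1 \<in> carrier S" "q' \<in> carrier S" "\<delta> \<in> carrier S"
    and l: "\<sigma> l = \<one>\<^bsub>S\<^esub> \<ominus>\<^bsub>S\<^esub> l" and d: "\<sigma> \<delta> = \<ominus>\<^bsub>S\<^esub> \<delta>" "\<phi> \<delta> \<noteq> \<zero>\<^bsub>K\<^esub>"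
    and inv: "\<phi> b \<noteq> \<zero>\<^bsub>K\<^esub> \<Longrightarrow> \<phi> (\<sigma> b) \<noteq> \<zero>\<^bsub>K\<^esub> \<Longrightarrow> \<exists>c\<in>carrier S. \<phi> (b \<otimes>\<^bsub>S\<^esub> c) = \<one>\<^bsub>K\<^esub> \<and> \<phi> (\<sigma> b \<otimes>\<^bsub>S\<^esub> \<sigma> c) = \<one>\<^bsub>K\<^esub>"
    and split: "\<And>s. s \<in> carrier S \<Longrightarrow> \<phi> s = \<zero>\<^bsub>K\<^esub> \<Longrightarrow> \<phi> (\<sigma> s) \<noteq> \<zero>\<^bsub>K\<^esub> \<Longrightarrow> \<exists>u\<in>carrier S. \<phi> u = \<one>\<^bsub>K\<^esub> \<and> \<phi> (\<sigma> u) = \<zero>\<^bsub>K\<^esub>"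
  defines "q \<equiv> \<ominus>\<^bsub>S\<^esub> (\<sigma> a \<otimes>\<^bsub>S\<^esub> b \<oplus>\<^bsub>S\<^esub> \<sigma> b \<otimes>\<^bsub>S\<^esub> a)"
  defines "w \<equiv> \<one>\<^bsub>S\<^esub> \<ominus>\<^bsub>S\<^esub> \<sigma> b \<otimes>\<^bsub>S\<^esub> a1 \<ominus>\<^bsub>S\<^esub> \<sigma> a \<otimes>\<^bsub>S\<^esub> b1"
  shows "\<exists>x\<in>carrier S. \<exists>y\<in>carrier S. \<exists>s\<in>carrier S.
    \<phi> (neighbour_value l a b q w q' x y s) \<noteq> \<zero>\<^bsub>K\<^esub> \<and> \<phi> (\<sigma> (neighbour_value l a b q w q' x y s)) \<noteq> \<zero>\<^bsub>K\<^esub>"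
proof -
  interpret K: domain K by (rule dom)
  interpret phi: ring_hom_cring S K \<phi> by (rule hom)
  have qw: "q \<in> carrier S" "w \<in> carrier S" unfolding q_def w_def using c by simp_all
  note hc = neighbour_value_closed[OF c(1,2,3) qw c(6)]
  show ?thesis
  proof (cases "\<phi> b \<noteq> \<zero>\<^bsub>K\<^esub> \<and> \<phi> (\<sigma> b) \<noteq> \<zero>\<^bsub>K\<^esub>")
    case True
    then obtain c' where c': "c' \<in> carrier S" "\<phi> (b \<otimes>\<^bsub>S\<^esub> c') = \<one>\<^bsub>K\<^esub>" "\<phi> (\<sigma> b \<otimes>\<^bsub>S\<^esub> \<sigma> c') = \<one>\<^bsub>K\<^esub>"
      using inv by auto
    let ?s = "l \<otimes>\<^bsub>S\<^esub> (a \<otimes>\<^bsub>S\<^esub> c' \<oplus>\<^bsub>S\<^esub> \<delta> \<oplus>\<^bsub>S\<^esub> l \<otimes>\<^bsub>S\<^esub> (\<sigma> c' \<otimes>\<^bsub>S\<^esub> c' \<otimes>\<^bsub>S\<^esub> q))"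
    let ?H = "neighbour_value l a b q w q' c' \<zero>\<^bsub>S\<^esub> ?s"
    have sc: "?s \<in> carrier S" using c c' qw by simp
    let ?k = "b \<otimes>\<^bsub>S\<^esub> c' \<ominus>\<^bsub>S\<^esub> \<one>\<^bsub>S\<^esub>" and ?k' = "\<sigma> b \<otimes>\<^bsub>S\<^esub> \<sigma> c' \<ominus>\<^bsub>S\<^esub> \<one>\<^bsub>S\<^esub>"
    let ?u = "\<sigma> b \<otimes>\<^bsub>S\<^esub> (\<one>\<^bsub>S\<^esub> \<ominus>\<^bsub>S\<^esub> l) \<otimes>\<^bsub>S\<^esub> \<sigma> a \<otimes>\<^bsub>S\<^esub> \<sigma> c' \<ominus>\<^bsub>S\<^esub> \<sigma> a" and ?u' = "\<sigma> b \<otimes>\<^bsub>S\<^esub> (\<one>\<^bsub>S\<^esub> \<ominus>\<^bsub>S\<^esub> l) \<otimes>\<^bsub>S\<^esub> a \<otimes>\<^bsub>S\<^esub> c'"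
    have H: "?H = \<sigma> b \<otimes>\<^bsub>S\<^esub> \<delta> \<oplus>\<^bsub>S\<^esub> ?k \<otimes>\<^bsub>S\<^esub> ?u \<oplus>\<^bsub>S\<^esub> ?k' \<otimes>\<^bsub>S\<^esub> ?u'"
      unfolding q_def by (rule neighbour_value_invertible_b[OF c(1-3) qw(2) c(6) c'(1) c(7) l d(1)])
    have uc: "?u \<in> carrier S" "?u' \<in> carrier S" "?k \<in> carrier S" "?k' \<in> carrier S" using c c' by simp_all
    have k0: "\<phi> ?k = \<zero>\<^bsub>K\<^esub>" "\<phi> ?k' = \<zero>\<^bsub>K\<^esub>" using c c' unfolding S.minus_eq
      by (simp_all only: phi.hom_add phi.hom_a_inv phi.hom_one S.m_closed S.a_inv_closed S.one_closed sigma_closed K.r_neg K.one_closed)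
    have sk: "\<sigma> ?k = ?k'" "\<sigma> ?k' = ?k" using c c' by simp_all
    have "\<phi> ?H = \<phi> (\<sigma> b) \<otimes>\<^bsub>K\<^esub> \<phi> \<delta>"
      unfolding H using uc c
      by (simp only: phi.hom_add phi.hom_mult S.a_closed S.m_closed sigma_closed k0 K.l_null phi.hom_closed K.r_zero K.m_closed)
    then have 1: "\<phi> ?H \<noteq> \<zero>\<^bsub>K\<^esub>" using True d(2) c by (simp add: K.integral_iff)
    have "\<sigma> ?H = b \<otimes>\<^bsub>S\<^esub> \<ominus>\<^bsub>S\<^esub> \<delta> \<oplus>\<^bsub>S\<^esub> ?k' \<otimes>\<^bsub>S\<^esub> \<sigma> ?u \<oplus>\<^bsub>S\<^esub> ?k \<otimes>\<^bsub>S\<^esub> \<sigma> ?u'"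
      unfolding H using uc c d(1) sk
      by (simp only: sigma_add sigma_mult S.a_closed S.m_closed sigma_closed sigma_sigma)
    then have "\<phi> (\<sigma> ?H) = \<phi> b \<otimes>\<^bsub>K\<^esub> \<phi> (\<ominus>\<^bsub>S\<^esub> \<delta>)"
      using uc c
      by (simp only: phi.hom_add phi.hom_mult S.a_closed S.m_closed S.a_inv_closed sigma_closed k0 K.l_null phi.hom_closed K.r_zero K.m_closed)
    then have 2: "\<phi> (\<sigma> ?H) \<noteq> \<zero>\<^bsub>K\<^esub>" using True d(2) c by (simp add: K.integral_iff)
    show ?thesis by (rule bexI[OF _ c'(1)], rule bexI[OF _ S.zero_closed], rule bexI[OF _ sc], rule conjI[OF 1 2])
  next
    case False
    have sep: "\<exists>u\<in>carrier S. \<phi> u = \<one>\<^bsub>K\<^esub> \<and> \<phi> (\<sigma> u) = \<zero>\<^bsub>K\<^esub>"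
      if "z \<in> carrier S" "(\<phi> z = \<zero>\<^bsub>K\<^esub>) \<noteq> (\<phi> (\<sigma> z) = \<zero>\<^bsub>K\<^esub>)" for z
      using split[of z] split[of "\<sigma> z"] that by (cases "\<phi> z = \<zero>\<^bsub>K\<^esub>") auto
    have "\<exists>y\<in>carrier S. \<phi> y = (if \<phi> (\<sigma> a) = \<zero>\<^bsub>K\<^esub> then \<one>\<^bsub>K\<^esub> else \<zero>\<^bsub>K\<^esub>) \<and>
        \<phi> (\<sigma> y) = (if \<phi> a = \<zero>\<^bsub>K\<^esub> then \<one>\<^bsub>K\<^esub> else \<zero>\<^bsub>K\<^esub>)"
    proof (cases "(\<phi> a = \<zero>\<^bsub>K\<^esub>) = (\<phi> (\<sigma> a) = \<zero>\<^bsub>K\<^esub>)")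
      case True
      then show ?thesis
        by (cases "\<phi> a = \<zero>\<^bsub>K\<^esub>") (auto intro: bexI[of _ "\<one>\<^bsub>S\<^esub>"] bexI[of _ "\<zero>\<^bsub>S\<^esub>"])
    next
      case False
      obtain u where u: "u \<in> carrier S" "\<phi> u = \<one>\<^bsub>K\<^esub>" "\<phi> (\<sigma> u) = \<zero>\<^bsub>K\<^esub>" using sep[OF c(2) False] by auto
      show ?thesis
      proof (cases "\<phi> a = \<zero>\<^bsub>K\<^esub>")
        case True
        then show ?thesis using False u by (intro bexI[of _ "\<sigma> u"]) auto
      next
        case neq: False
        then show ?thesis using False u by (intro bexI[of _ u]) auto
      qed
    qed
    then obtain y where y: "y \<in> carrier S" "\<phi> y = (if \<phi> (\<sigma> a) = \<zero>\<^bsub>K\<^esub> then \<one>\<^bsub>K\<^esub> else \<zero>\<^bsub>K\<^esub>)"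
        "\<phi> (\<sigma> y) = (if \<phi> a = \<zero>\<^bsub>K\<^esub> then \<one>\<^bsub>K\<^esub> else \<zero>\<^bsub>K\<^esub>)" by auto
    let ?H = "\<lambda>s. neighbour_value l a b q w q' \<zero>\<^bsub>S\<^esub> y s"
    let ?T = "\<lambda>s. s \<ominus>\<^bsub>S\<^esub> \<sigma> s \<ominus>\<^bsub>S\<^esub> l \<otimes>\<^bsub>S\<^esub> (\<sigma> y \<otimes>\<^bsub>S\<^esub> y \<otimes>\<^bsub>S\<^esub> q')"
    have H: "?H s = \<sigma> a \<oplus>\<^bsub>S\<^esub> \<sigma> b \<otimes>\<^bsub>S\<^esub> ?T s \<oplus>\<^bsub>S\<^esub> w \<otimes>\<^bsub>S\<^esub> y" if "s \<in> carrier S" for s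
      unfolding neighbour_value_def using that c qw y(1) by simp
    have Tc: "?T s \<in> carrier S" if "s \<in> carrier S" for s using that c y(1) by simp
    have p1: "\<phi> (?H s) = \<phi> (\<sigma> a) \<oplus>\<^bsub>K\<^esub> \<phi> (\<sigma> b) \<otimes>\<^bsub>K\<^esub> \<phi> (?T s) \<oplus>\<^bsub>K\<^esub> \<phi> w \<otimes>\<^bsub>K\<^esub> \<phi> y" if s: "s \<in> carrier S" for s
      unfolding H[OF s] using c y(1) qw Tc[OF s]
      by (simp only: phi.hom_add phi.hom_mult S.a_closed S.m_closed sigma_closed)
    have p2: "\<phi> (\<sigma> (?H s)) = \<phi> a \<oplus>\<^bsub>K\<^esub> \<phi> b \<otimes>\<^bsub>K\<^esub> \<phi> (\<sigma> (?T s)) \<oplus>\<^bsub>K\<^esub> \<phi> (\<sigma> w) \<otimes>\<^bsub>K\<^esub> \<phi> (\<sigma> y)" if s: "s \<in> carrier S" for s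
      unfolding H[OF s] using c y(1) qw Tc[OF s]
      by (simp only: sigma_add sigma_mult sigma_sigma phi.hom_add phi.hom_mult S.a_closed S.m_closed sigma_closed)
    have pw: "\<phi> w = \<one>\<^bsub>K\<^esub> \<ominus>\<^bsub>K\<^esub> \<phi> (\<sigma> b) \<otimes>\<^bsub>K\<^esub> \<phi> a1 \<ominus>\<^bsub>K\<^esub> \<phi> (\<sigma> a) \<otimes>\<^bsub>K\<^esub> \<phi> b1"
      "\<phi> (\<sigma> w) = \<one>\<^bsub>K\<^esub> \<ominus>\<^bsub>K\<^esub> \<phi> b \<otimes>\<^bsub>K\<^esub> \<phi> (\<sigma> a1) \<ominus>\<^bsub>K\<^esub> \<phi> a \<otimes>\<^bsub>K\<^esub> \<phi> (\<sigma> b1)"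
      unfolding w_def using c by (simp_all add: S.minus_eq K.minus_eq)
    have n1: "\<phi> (?H s) \<noteq> \<zero>\<^bsub>K\<^esub>" if "\<phi> (\<sigma> b) = \<zero>\<^bsub>K\<^esub>" "s \<in> carrier S" for s
      using that c y(1,2) qw Tc[OF that(2)] unfolding p1[OF that(2)]
      by (cases "\<phi> (\<sigma> a) = \<zero>\<^bsub>K\<^esub>") (simp_all add: pw K.minus_eq)
    have n2: "\<phi> (\<sigma> (?H s)) \<noteq> \<zero>\<^bsub>K\<^esub>" if "\<phi> b = \<zero>\<^bsub>K\<^esub>" "s \<in> carrier S" for s
      using that c y(1,3) qw Tc[OF that(2)] unfolding p2[OF that(2)]
      by (cases "\<phi> a = \<zero>\<^bsub>K\<^esub>") (simp_all add: pw K.minus_eq)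
    have "\<exists>s\<in>carrier S. \<phi> (?H s) \<noteq> \<zero>\<^bsub>K\<^esub> \<and> \<phi> (\<sigma> (?H s)) \<noteq> \<zero>\<^bsub>K\<^esub>"
    proof (cases "\<phi> b = \<zero>\<^bsub>K\<^esub> \<and> \<phi> (\<sigma> b) = \<zero>\<^bsub>K\<^esub>")
      case True
      then show ?thesis using n1[of "\<zero>\<^bsub>S\<^esub>"] n2[of "\<zero>\<^bsub>S\<^esub>"] by (intro bexI[of _ "\<zero>\<^bsub>S\<^esub>"]) simp_all
    next
      case nb: False
      have one: "\<exists>u\<in>carrier S. \<phi> u = \<one>\<^bsub>K\<^esub> \<and> \<phi> (\<sigma> u) = \<zero>\<^bsub>K\<^esub>" using sep[OF c(3)] nb False by auto
      then obtain u where u: "u \<in> carrier S" "\<phi> u = \<one>\<^bsub>K\<^esub>" "\<phi> (\<sigma> u) = \<zero>\<^bsub>K\<^esub>" by auto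
      let ?W = "l \<otimes>\<^bsub>S\<^esub> (\<sigma> y \<otimes>\<^bsub>S\<^esub> y \<otimes>\<^bsub>S\<^esub> q')"
      have Wc: "?W \<in> carrier S" using c y(1) by simp
      show ?thesis
      proof (cases "\<phi> b = \<zero>\<^bsub>K\<^esub>")
        case True
        then have sb: "\<phi> (\<sigma> b) \<noteq> \<zero>\<^bsub>K\<^esub>" using nb by simp
        have "\<phi> (?T u) = \<phi> (?T \<zero>\<^bsub>S\<^esub>) \<oplus>\<^bsub>K\<^esub> \<one>\<^bsub>K\<^esub>"
          using u Wc unfolding S.minus_eq
          by (simp only: phi.hom_add phi.hom_a_inv phi.hom_closed S.a_closed S.a_inv_closed sigma_closed sigma_zero phi.hom_zero S.zero_closed)
            (simp add: K.a_comm)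
        then have "\<phi> (?H u) = \<phi> (?H \<zero>\<^bsub>S\<^esub>) \<oplus>\<^bsub>K\<^esub> \<phi> (\<sigma> b)"
          unfolding p1[OF u(1)] p1[OF S.zero_closed] using c qw y(1) Tc[OF S.zero_closed]
          by (simp add: K.r_distr K.a_ac)
        then have "\<phi> (?H u) \<noteq> \<zero>\<^bsub>K\<^esub> \<or> \<phi> (?H \<zero>\<^bsub>S\<^esub>) \<noteq> \<zero>\<^bsub>K\<^esub>" using sb c by auto
        then show ?thesis using n2[OF True] u(1) by auto
      next
        case nz: False
        then have sb: "\<phi> (\<sigma> b) = \<zero>\<^bsub>K\<^esub>" using False by simp
        have "\<phi> (\<sigma> (?T (\<sigma> u))) = \<phi> (\<sigma> (?T \<zero>\<^bsub>S\<^esub>)) \<oplus>\<^bsub>K\<^esub> \<one>\<^bsub>K\<^esub>"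
          using u Wc unfolding S.minus_eq
          by (simp only: sigma_add sigma_minus sigma_sigma phi.hom_add phi.hom_a_inv phi.hom_closed S.a_closed S.a_inv_closed sigma_closed sigma_zero phi.hom_zero S.zero_closed)
            (simp add: K.a_comm)
        then have "\<phi> (\<sigma> (?H (\<sigma> u))) = \<phi> (\<sigma> (?H \<zero>\<^bsub>S\<^esub>)) \<oplus>\<^bsub>K\<^esub> \<phi> b"
          unfolding p2[OF sigma_closed[OF u(1)]] p2[OF S.zero_closed] using c qw y(1) Tc[OF S.zero_closed]
          by (simp add: K.r_distr K.a_ac)
        then have "\<phi> (\<sigma> (?H (\<sigma> u))) \<noteq> \<zero>\<^bsub>K\<^esub> \<or> \<phi> (\<sigma> (?H \<zero>\<^bsub>S\<^esub>)) \<noteq> \<zero>\<^bsub>K\<^esub>" using nz c by auto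
        then show ?thesis using n1[OF sb] u(1) by auto
      qed
    qed
    then show ?thesis using y(1) by auto
  qed
qed

text \<open>The conditions at the two primes over \<open>\<mm>\<close> amount to one condition on the norm, to which the LG property
  applies.\<close>

lemma neighbour_value_unit_exists:
  assumes LG: "LG_ring R" and db: "dual_basis n \<xi> g"
    and c: "l \<in> carrier S" "a \<in> carrier S" "b \<in> carrier S" "a1 \<in> carrier S" "b1 \<in> carrier S" "q' \<in> carrier S"
    and l: "l \<oplus>\<^bsub>S\<^esub> \<sigma> l = \<one>\<^bsub>S\<^esub>"
  defines "q \<equiv> \<ominus>\<^bsub>S\<^esub> (\<sigma> a \<otimes>\<^bsub>S\<^esub> b \<oplus>\<^bsub>S\<^esub> \<sigma> b \<otimes>\<^bsub>S\<^esub> a)"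
  defines "w \<equiv> \<one>\<^bsub>S\<^esub> \<ominus>\<^bsub>S\<^esub> \<sigma> b \<otimes>\<^bsub>S\<^esub> a1 \<ominus>\<^bsub>S\<^esub> \<sigma> a \<otimes>\<^bsub>S\<^esub> b1"
  shows "\<exists>x\<in>carrier S. \<exists>y\<in>carrier S. \<exists>s\<in>carrier S. neighbour_value l a b q w q' x y s \<in> Units S"
proof -
  have qw: "q \<in> carrier S" "w \<in> carrier S" unfolding q_def w_def using c by simp_all
  have sl: "\<sigma> l = \<one>\<^bsub>S\<^esub> \<ominus>\<^bsub>S\<^esub> l"
    by (rule S.linear_combination[OF l, of _ _ "\<one>\<^bsub>S\<^esub>"],
        rule S.ring_identityI[of _ "[l, \<sigma> l]"], (rule S.reify_rules)+)
      (use c(1) in \<open>simp_all add: S.in_carrier_simps norm_simps\<close>)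
  obtain F1 F2 F3 where F: "spoly_on (3 * n) F1" "spoly_on (3 * n) F2" "spoly_on (3 * n) F3"
    and surj: "\<And>a b c. a \<in> carrier S \<Longrightarrow> b \<in> carrier S \<Longrightarrow> c \<in> carrier S \<Longrightarrow>
      \<exists>x\<in>{..<3 * n} \<rightarrow> carrier R. F1 x = a \<and> F2 x = b \<and> F3 x = c"
    by (rule three_coordinates[OF db]) (rule that)
  let ?G = "\<lambda>v. neighbour_value l a b q w q' (F1 v) (F2 v) (F3 v)"
  have sp: "spoly_on (3 * n) ?G"
    unfolding neighbour_value_def
    by (intro spoly_on_add spoly_on_mult spoly_on_diff spoly_on_sigma spoly_on_const F) (use c qw in simp_all)
  have "\<exists>Q v. primeideal Q S \<and> (\<forall>r\<in>\<mm>. h r \<in> Q) \<and> v \<in> {..<3 * n} \<rightarrow> carrier R \<and> ?G v \<notin> Q \<and> \<sigma> (?G v) \<notin> Q"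
    if m: "maximalideal \<mm> R" for \<mm>
  proof -
    obtain Q \<delta> where Q: "maximalideal Q S" and over: "\<And>r. r \<in> \<mm> \<Longrightarrow> h r \<in> Q"
      and d: "\<delta> \<in> carrier S" "\<delta> \<oplus>\<^bsub>S\<^esub> \<sigma> \<delta> = \<zero>\<^bsub>S\<^esub>" "\<delta> \<notin> Q"
      by (rule maximalideal_over_with_unit[OF m]) (rule that)
    interpret Q: maximalideal Q S by (rule Q)
    have pQ: "primeideal Q S" by (rule S.maximalideal_prime[OF Q])
    define K where "K = S Quot Q"
    define \<phi> where "\<phi> = (+>\<^bsub>S\<^esub>) Q"
    have hom: "ring_hom_cring S K \<phi>" unfolding K_def \<phi>_def by (rule Q.rcos_ring_hom_cring[OF S.is_cring])
    interpret phi: ring_hom_cring S K \<phi> by (rule hom)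
    have dom: "domain K" unfolding K_def by (rule primeideal.quotient_is_domain[OF pQ])
    have zK: "\<zero>\<^bsub>K\<^esub> = Q" by (simp add: K_def FactRing_def)
    have ker: "\<phi> x = \<zero>\<^bsub>K\<^esub> \<longleftrightarrow> x \<in> Q" if "x \<in> carrier S" for x
    proof
      show "\<phi> x = \<zero>\<^bsub>K\<^esub>" if "x \<in> Q" unfolding zK \<phi>_def by (rule S.a_rcos_zero[OF Q.is_ideal that])
      show "x \<in> Q" if "\<phi> x = \<zero>\<^bsub>K\<^esub>"
        using Q.rcos_const_imp_mem[OF \<open>x \<in> carrier S\<close>] that unfolding zK \<phi>_def .
    qed
    have eq1: "\<phi> x = \<one>\<^bsub>K\<^esub>" if "x \<in> carrier S" "x \<ominus>\<^bsub>S\<^esub> \<one>\<^bsub>S\<^esub> \<in> Q" for x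
    proof -
      have "\<phi> (x \<ominus>\<^bsub>S\<^esub> \<one>\<^bsub>S\<^esub>) = \<zero>\<^bsub>K\<^esub>"
        using ker[OF S.minus_closed[OF that(1) S.one_closed]] that(2) by (simp only:)
      then have "\<phi> x \<ominus>\<^bsub>K\<^esub> \<one>\<^bsub>K\<^esub> = \<zero>\<^bsub>K\<^esub>" using that(1) by (simp add: S.minus_eq phi.S.minus_eq)
      then show ?thesis using that(1) by simp
    qed
    have sd: "\<sigma> \<delta> = \<ominus>\<^bsub>S\<^esub> \<delta>" using S.minus_equality[of "\<sigma> \<delta>" \<delta>] d by (simp add: S.a_comm)
    have inv: "\<exists>c\<in>carrier S. \<phi> (b \<otimes>\<^bsub>S\<^esub> c) = \<one>\<^bsub>K\<^esub> \<and> \<phi> (\<sigma> b \<otimes>\<^bsub>S\<^esub> \<sigma> c) = \<one>\<^bsub>K\<^esub>"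
      if "\<phi> b \<noteq> \<zero>\<^bsub>K\<^esub>" "\<phi> (\<sigma> b) \<noteq> \<zero>\<^bsub>K\<^esub>"
    proof -
      obtain r where r: "r \<in> carrier R" "b \<otimes>\<^bsub>S\<^esub> \<sigma> b = h r" using norm_in_range[OF c(3)] by auto
      have "b \<otimes>\<^bsub>S\<^esub> \<sigma> b \<notin> Q" using S.primeideal_mult_notin[OF pQ] that ker c(3) by simp
      then have "r \<notin> \<mm>" using r(2) over by auto
      then obtain c' where c': "c' \<in> carrier R" "r \<otimes> c' \<ominus> \<one> \<in> \<mm>"
        using R.maximalideal_inverse[OF m r(1)] by metis
      have "h (r \<otimes> c' \<ominus> \<one>) \<in> Q" by (rule over[OF c'(2)])
      then have hQ: "h r \<otimes>\<^bsub>S\<^esub> h c' \<ominus>\<^bsub>S\<^esub> \<one>\<^bsub>S\<^esub> \<in> Q" using r(1) c'(1) by (simp add: R.minus_eq S.minus_eq)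
      have "b \<otimes>\<^bsub>S\<^esub> (\<sigma> b \<otimes>\<^bsub>S\<^esub> h c') = h r \<otimes>\<^bsub>S\<^esub> h c'"
        using c(3) c'(1) by (simp add: S.m_assoc flip: r(2))
      moreover have "\<sigma> b \<otimes>\<^bsub>S\<^esub> \<sigma> (\<sigma> b \<otimes>\<^bsub>S\<^esub> h c') = h r \<otimes>\<^bsub>S\<^esub> h c'"
        using c(3) c'(1) by (simp add: S.m_ac flip: r(2))
      ultimately show ?thesis
        using eq1[OF _ hQ] r(1) c' c(3) by (intro bexI[of _ "\<sigma> b \<otimes>\<^bsub>S\<^esub> h c'"]) simp_all
    qed
    have split: "\<exists>u\<in>carrier S. \<phi> u = \<one>\<^bsub>K\<^esub> \<and> \<phi> (\<sigma> u) = \<zero>\<^bsub>K\<^esub>"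
      if s: "s \<in> carrier S" "\<phi> s = \<zero>\<^bsub>K\<^esub>" "\<phi> (\<sigma> s) \<noteq> \<zero>\<^bsub>K\<^esub>" for s
    proof -
      have "\<sigma> s \<notin> Q" using s ker by simp
      then obtain v where v: "v \<in> carrier S" "\<sigma> s \<otimes>\<^bsub>S\<^esub> v \<ominus>\<^bsub>S\<^esub> \<one>\<^bsub>S\<^esub> \<in> Q"
        using S.maximalideal_inverse[OF Q sigma_closed[OF s(1)]] by metis
      have "\<phi> (\<sigma> (\<sigma> s \<otimes>\<^bsub>S\<^esub> v)) = \<zero>\<^bsub>K\<^esub>" using s(1,2) v(1) by simp
      then show ?thesis using eq1[OF _ v(2)] s(1) v(1) by (intro bexI[of _ "\<sigma> s \<otimes>\<^bsub>S\<^esub> v"]) simp_all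
    qed
    have "\<phi> \<delta> \<noteq> \<zero>\<^bsub>K\<^esub>" using d ker by simp
    then have "\<exists>x\<in>carrier S. \<exists>y\<in>carrier S. \<exists>s\<in>carrier S.
      \<phi> (neighbour_value l a b q w q' x y s) \<noteq> \<zero>\<^bsub>K\<^esub> \<and> \<phi> (\<sigma> (neighbour_value l a b q w q' x y s)) \<noteq> \<zero>\<^bsub>K\<^esub>"
      unfolding q_def w_def
      using dom hom c d(1) sl sd inv split
      by (intro neighbour_value_nonzero_local[where K = K and \<phi> = \<phi> and \<delta> = \<delta>])
    then obtain x y s where xys: "x \<in> carrier S" "y \<in> carrier S" "s \<in> carrier S"
      and nz: "\<phi> (neighbour_value l a b q w q' x y s) \<noteq> \<zero>\<^bsub>K\<^esub>" "\<phi> (\<sigma> (neighbour_value l a b q w q' x y s)) \<noteq> \<zero>\<^bsub>K\<^esub>"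
      by (elim bexE conjE)
    have "neighbour_value l a b q w q' x y s \<notin> Q" "\<sigma> (neighbour_value l a b q w q' x y s) \<notin> Q"
      using nz ker neighbour_value_closed[OF c(1-3) qw c(6) xys] by simp_all
    moreover obtain v where "v \<in> {..<3 * n} \<rightarrow> carrier R" "F1 v = x" "F2 v = y" "F3 v = s"
      using surj[OF xys] by auto
    ultimately show ?thesis using pQ over by (intro exI[of _ Q] exI[of _ v]) simp
  qed
  then have "\<exists>v\<in>{..<3 * n} \<rightarrow> carrier R. ?G v \<in> Units S" by (rule spoly_on_unit[OF LG sp])
  then obtain v where v: "v \<in> {..<3 * n} \<rightarrow> carrier R" "?G v \<in> Units S"
    by (elim bexE)
  then show ?thesis using spoly_on_closed[OF F(1) v(1)] spoly_on_closed[OF F(2) v(1)] spoly_on_closed[OF F(3) v(1)]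
      v(2) by (intro bexI[of _ "F1 v"] bexI[of _ "F2 v"] bexI[of _ "F3 v"])
qed

end

section \<open>Hyperbolic pairs\<close>

locale hermitian_module = etale_involution R S h \<sigma> + V: module S V
  for R (structure) and S (structure) and h and \<sigma> and V (structure) +
  fixes k
  assumes k_closed [simp]: "x \<in> carrier V \<Longrightarrow> y \<in> carrier V \<Longrightarrow> k x y \<in> carrier S"
    and k_add_left: "x \<in> carrier V \<Longrightarrow> x' \<in> carrier V \<Longrightarrow> y \<in> carrier V \<Longrightarrow> k (x \<oplus>\<^bsub>V\<^esub> x') y = k x y \<oplus>\<^bsub>S\<^esub> k x' y"
    and k_add_right: "x \<in> carrier V \<Longrightarrow> y \<in> carrier V \<Longrightarrow> y' \<in> carrier V \<Longrightarrow> k x (y \<oplus>\<^bsub>V\<^esub> y') = k x y \<oplus>\<^bsub>S\<^esub> k x y'"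
    and k_smult: "x \<in> carrier V \<Longrightarrow> y \<in> carrier V \<Longrightarrow> s \<in> carrier S \<Longrightarrow> t \<in> carrier S \<Longrightarrow>
      k (s \<odot>\<^bsub>V\<^esub> x) (t \<odot>\<^bsub>V\<^esub> y) = \<sigma> s \<otimes>\<^bsub>S\<^esub> k x y \<otimes>\<^bsub>S\<^esub> t"
    and k_sym: "x \<in> carrier V \<Longrightarrow> y \<in> carrier V \<Longrightarrow> k x y = \<sigma> (k y x)"
begin

lemma k_smult_left:
  "x \<in> carrier V \<Longrightarrow> y \<in> carrier V \<Longrightarrow> s \<in> carrier S \<Longrightarrow> k (s \<odot>\<^bsub>V\<^esub> x) y = \<sigma> s \<otimes>\<^bsub>S\<^esub> k x y"
  using k_smult[of x y s "\<one>\<^bsub>S\<^esub>"] by simp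

lemma k_smult_right:
  "x \<in> carrier V \<Longrightarrow> y \<in> carrier V \<Longrightarrow> t \<in> carrier S \<Longrightarrow> k x (t \<odot>\<^bsub>V\<^esub> y) = k x y \<otimes>\<^bsub>S\<^esub> t"
  using k_smult[of x y "\<one>\<^bsub>S\<^esub>" t] by simp

lemmas k_expand = k_add_left k_add_right k_smult_left k_smult_right

lemma sigma_Units: "u \<in> Units S \<Longrightarrow> \<sigma> u \<in> Units S"
proof -
  assume u: "u \<in> Units S"
  have uc: "u \<in> carrier S" "inv\<^bsub>S\<^esub> u \<in> carrier S" using u S.Units_closed S.Units_inv_closed by simp_all
  have "\<sigma> u \<otimes>\<^bsub>S\<^esub> \<sigma> (inv\<^bsub>S\<^esub> u) = \<sigma> (u \<otimes>\<^bsub>S\<^esub> inv\<^bsub>S\<^esub> u)" "\<sigma> (inv\<^bsub>S\<^esub> u) \<otimes>\<^bsub>S\<^esub> \<sigma> u = \<sigma> (inv\<^bsub>S\<^esub> u \<otimes>\<^bsub>S\<^esub> u)" using uc by simp_all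
  then have "\<sigma> u \<otimes>\<^bsub>S\<^esub> \<sigma> (inv\<^bsub>S\<^esub> u) = \<one>\<^bsub>S\<^esub>" "\<sigma> (inv\<^bsub>S\<^esub> u) \<otimes>\<^bsub>S\<^esub> \<sigma> u = \<one>\<^bsub>S\<^esub>"
    using u by (simp_all only: S.Units_r_inv S.Units_l_inv sigma_one)
  then show ?thesis using sigma_closed[OF uc(1)] sigma_closed[OF uc(2)] unfolding Units_def by auto
qed

lemma k_Units_commute: "x \<in> carrier V \<Longrightarrow> y \<in> carrier V \<Longrightarrow> k x y \<in> Units S \<Longrightarrow> k y x \<in> Units S"
  using sigma_Units[of "k x y"] k_sym[of y x] by simp

lemma k_zero_commute: "x \<in> carrier V \<Longrightarrow> y \<in> carrier V \<Longrightarrow> k x y = \<zero>\<^bsub>S\<^esub> \<Longrightarrow> k y x = \<zero>\<^bsub>S\<^esub>"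
  using k_sym[of y x] by simp

definition submod :: "_ set \<Rightarrow> bool" where
  "submod U \<longleftrightarrow> U \<subseteq> carrier V \<and> \<zero>\<^bsub>V\<^esub> \<in> U \<and> (\<forall>x\<in>U. \<forall>y\<in>U. x \<oplus>\<^bsub>V\<^esub> y \<in> U) \<and> (\<forall>s\<in>carrier S. \<forall>x\<in>U. s \<odot>\<^bsub>V\<^esub> x \<in> U)"

lemma submodD:
  assumes "submod U"
  shows "x \<in> U \<Longrightarrow> x \<in> carrier V" "\<zero>\<^bsub>V\<^esub> \<in> U" "x \<in> U \<Longrightarrow> y \<in> U \<Longrightarrow> x \<oplus>\<^bsub>V\<^esub> y \<in> U"
    "s \<in> carrier S \<Longrightarrow> x \<in> U \<Longrightarrow> s \<odot>\<^bsub>V\<^esub> x \<in> U"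
  using assms unfolding submod_def by auto

lemma submod_carrier: "submod (carrier V)"
  unfolding submod_def by simp

definition perp2 where "perp2 U e f = {x \<in> U. k e x = \<zero>\<^bsub>S\<^esub> \<and> k f x = \<zero>\<^bsub>S\<^esub>}"

lemma perp2_commute: "perp2 U e f = perp2 U f e"
  unfolding perp2_def by auto

lemma k_zero_right: "x \<in> carrier V \<Longrightarrow> k x \<zero>\<^bsub>V\<^esub> = \<zero>\<^bsub>S\<^esub>"
  using k_smult_right[of x "\<zero>\<^bsub>V\<^esub>" "\<zero>\<^bsub>S\<^esub>"] by simp

lemma submod_perp2:
  assumes "submod U" "e \<in> U" "f \<in> U"
  shows "submod (perp2 U e f)"
  using assms submodD[OF assms(1)] unfolding perp2_def
  by (subst submod_def) (auto simp: k_zero_right k_add_right k_smult_right)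

definition isometry where
  "isometry \<psi> U W \<longleftrightarrow> bij_betw \<psi> U W \<and> (\<forall>x\<in>U. \<forall>y\<in>U. \<psi> (x \<oplus>\<^bsub>V\<^esub> y) = \<psi> x \<oplus>\<^bsub>V\<^esub> \<psi> y) \<and>
    (\<forall>s\<in>carrier S. \<forall>x\<in>U. \<psi> (s \<odot>\<^bsub>V\<^esub> x) = s \<odot>\<^bsub>V\<^esub> \<psi> x) \<and> (\<forall>x\<in>U. \<forall>y\<in>U. k (\<psi> x) (\<psi> y) = k x y)"

lemma isometry_image: "isometry \<psi> U W \<Longrightarrow> x \<in> U \<Longrightarrow> \<psi> x \<in> W"
  unfolding isometry_def bij_betw_def by auto

lemma isometry_trans:
  assumes "isometry \<psi> U1 U2" "isometry \<chi> U2 U3"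
  shows "isometry (\<chi> \<circ> \<psi>) U1 U3"
  using assms isometry_image[OF assms(1)] bij_betw_trans[of \<psi> U1 U2 \<chi> U3]
  unfolding isometry_def by simp

lemma isometry_restrict:
  assumes "isometry \<psi> U W" "U' \<subseteq> U" "\<psi> ` U' = W'"
  shows "isometry \<psi> U' W'"
  using assms unfolding isometry_def bij_betw_def by (auto intro: inj_on_subset simp: subset_iff)

text \<open>For isotropic \<open>e\<close>, both complements are isometric to the quotient of the complement of \<open>e\<close> by \<open>Se\<close>.\<close>

lemma isometry_exchange:
  assumes U: "submod U" and U_in: "e \<in> U" "f \<in> U" "g \<in> U"
    and e: "k e e = \<zero>\<^bsub>S\<^esub>" and f: "k f e \<in> Units S" and g: "k g e \<in> Units S"
  shows "\<exists>\<psi>. isometry \<psi> (perp2 U e f) (perp2 U e g)"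
proof -
  define \<psi> where "\<psi> f x = x \<oplus>\<^bsub>V\<^esub> (\<ominus>\<^bsub>S\<^esub> (inv\<^bsub>S\<^esub> (k f e) \<otimes>\<^bsub>S\<^esub> k f x)) \<odot>\<^bsub>V\<^esub> e" for f x
  note D = submodD[OF U]
  note c = D(1)[OF U_in(1)]
  have main: "\<psi> g x \<in> perp2 U e g" "\<psi> f (\<psi> g x) = x"
    if x: "x \<in> perp2 U e f" and fg: "f \<in> U" "g \<in> U" "k f e \<in> Units S" "k g e \<in> Units S" for f g x
  proof -
    have xU: "x \<in> U" "k e x = \<zero>\<^bsub>S\<^esub>" "k f x = \<zero>\<^bsub>S\<^esub>" using x unfolding perp2_def by auto
    note cl = c D(1)[OF xU(1)] fg(1,2)[THEN D(1)]
    note iv = S.Units_inv_closed[OF fg(3)] S.Units_inv_closed[OF fg(4)]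
    let ?c = "inv\<^bsub>S\<^esub> (k g e) \<otimes>\<^bsub>S\<^esub> k g x"
    have cc: "?c \<in> carrier S" using cl iv by simp
    have "\<psi> g x \<in> U" unfolding \<psi>_def using cl cc xU U_in by (intro D(3,4)) simp_all
    moreover have "k e (\<psi> g x) = \<zero>\<^bsub>S\<^esub>" unfolding \<psi>_def using cl cc xU e by (simp add: k_expand)
    moreover have "k g (\<psi> g x) = \<zero>\<^bsub>S\<^esub>"
    proof -
      have "k g e \<otimes>\<^bsub>S\<^esub> ?c = k g x" using cl iv fg by (simp add: S.m_assoc[symmetric])
      then have "k g e \<otimes>\<^bsub>S\<^esub> (\<ominus>\<^bsub>S\<^esub> ?c) = \<ominus>\<^bsub>S\<^esub> k g x" using cl cc by (simp only: S.r_minus k_closed)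
      then show ?thesis unfolding \<psi>_def using cl cc by (simp only: k_expand k_closed V.smult_closed S.a_inv_closed S.r_neg)
    qed
    ultimately show "\<psi> g x \<in> perp2 U e g" unfolding perp2_def by simp
    have "k f (\<psi> g x) = k f e \<otimes>\<^bsub>S\<^esub> (\<ominus>\<^bsub>S\<^esub> ?c)"
      unfolding \<psi>_def using cl cc xU by (simp only: k_expand V.smult_closed S.a_inv_closed S.l_zero S.m_closed k_closed)
    then have "inv\<^bsub>S\<^esub> (k f e) \<otimes>\<^bsub>S\<^esub> k f (\<psi> g x) = \<ominus>\<^bsub>S\<^esub> ?c"
      using cl cc iv fg by (simp only: S.m_assoc[symmetric] S.a_inv_closed S.Units_l_inv k_closed S.l_one)
    then have "\<psi> f (\<psi> g x) = (x \<oplus>\<^bsub>V\<^esub> (\<ominus>\<^bsub>S\<^esub> ?c) \<odot>\<^bsub>V\<^esub> e) \<oplus>\<^bsub>V\<^esub> ?c \<odot>\<^bsub>V\<^esub> e"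
      unfolding \<psi>_def[of f] using cc by (simp only: S.minus_minus) (simp only: \<psi>_def)
    also have "\<dots> = x \<oplus>\<^bsub>V\<^esub> ((\<ominus>\<^bsub>S\<^esub> ?c) \<oplus>\<^bsub>S\<^esub> ?c) \<odot>\<^bsub>V\<^esub> e"
      using cl cc by (simp only: V.smult_l_distr S.a_inv_closed V.smult_closed V.M.a_assoc)
    also have "\<dots> = x" using cl cc by (simp only: S.l_neg V.smult_l_null V.M.r_zero)
    finally show "\<psi> f (\<psi> g x) = x" .
  qed
  have "bij_betw (\<psi> g) (perp2 U e f) (perp2 U e g)"
    by (rule bij_betw_byWitness[of _ "\<psi> f"]) (use main U_in f g in auto)
  moreover have "\<psi> g (x \<oplus>\<^bsub>V\<^esub> y) = \<psi> g x \<oplus>\<^bsub>V\<^esub> \<psi> g y" if "x \<in> perp2 U e f" "y \<in> perp2 U e f" for x y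
  proof -
    have cl: "x \<in> carrier V" "y \<in> carrier V" "g \<in> carrier V" using that D(1) U_in unfolding perp2_def by auto
    have iv: "inv\<^bsub>S\<^esub> (k g e) \<in> carrier S" using g by simp
    show ?thesis unfolding \<psi>_def using cl iv c
      by (simp add: k_add_right S.r_distr S.minus_add V.smult_l_distr V.M.a_ac)
  qed
  moreover have "\<psi> g (s \<odot>\<^bsub>V\<^esub> x) = s \<odot>\<^bsub>V\<^esub> \<psi> g x" if "s \<in> carrier S" "x \<in> perp2 U e f" for s x
  proof -
    have cl: "x \<in> carrier V" "g \<in> carrier V" using that D(1) U_in unfolding perp2_def by auto
    have iv: "inv\<^bsub>S\<^esub> (k g e) \<in> carrier S" using g by simp
    have "\<ominus>\<^bsub>S\<^esub> (inv\<^bsub>S\<^esub> (k g e) \<otimes>\<^bsub>S\<^esub> (k g x \<otimes>\<^bsub>S\<^esub> s)) = s \<otimes>\<^bsub>S\<^esub> (\<ominus>\<^bsub>S\<^esub> (inv\<^bsub>S\<^esub> (k g e) \<otimes>\<^bsub>S\<^esub> k g x))"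
      using cl iv that(1) by (simp add: S.r_minus S.m_ac)
    then show ?thesis unfolding \<psi>_def using cl iv c that(1)
      by (simp only: k_smult_right V.smult_r_distr V.smult_assoc1 V.smult_closed S.a_inv_closed S.m_closed k_closed)
  qed
  moreover have "k (\<psi> g x) (\<psi> g y) = k x y" if xy: "x \<in> perp2 U e f" "y \<in> perp2 U e f" for x y
  proof -
    have cl: "x \<in> carrier V" "y \<in> carrier V" "g \<in> carrier V" and z: "k e x = \<zero>\<^bsub>S\<^esub>" "k e y = \<zero>\<^bsub>S\<^esub>"
      using that D(1) U_in unfolding perp2_def by auto
    have z': "k x e = \<zero>\<^bsub>S\<^esub>" "k y e = \<zero>\<^bsub>S\<^esub>" using k_zero_commute z cl c by simp_all
    have iv: "inv\<^bsub>S\<^esub> (k g e) \<in> carrier S" using g by simp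
    let ?c = "\<lambda>x. \<ominus>\<^bsub>S\<^esub> (inv\<^bsub>S\<^esub> (k g e) \<otimes>\<^bsub>S\<^esub> k g x)"
    have cc: "?c x \<in> carrier S" "?c y \<in> carrier S" using cl iv by simp_all
    then show ?thesis unfolding \<psi>_def using cl c z z' e
      by (simp del: S.a_inv_closed add: k_expand)
  qed
  ultimately have "isometry (\<psi> g) (perp2 U e f) (perp2 U e g)" unfolding isometry_def by simp
  then show ?thesis by (intro exI)
qed

definition hyperbolic_pair where
  "hyperbolic_pair e f \<longleftrightarrow> k e e = \<zero>\<^bsub>S\<^esub> \<and> k f f = \<zero>\<^bsub>S\<^esub> \<and> k e f = \<one>\<^bsub>S\<^esub>"

text \<open>The isotropic vectors \<open>f + n + et\<close>, with \<open>n\<close> in the span of the components \<open>m\<close> and \<open>m'\<close> of \<open>e'\<close> and \<open>f'\<close>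
  orthogonal to \<open>e\<close> and \<open>f\<close>, all have product \<open>1\<close> with \<open>e\<close>. This span is large enough for one of them to have a
  unit as its product with \<open>e'\<close>, whatever the module is.\<close>

lemma exists_common_neighbour:
  assumes LG: "LG_ring R" and db: "dual_basis n \<xi> gg"
    and U: "submod U" and U_in: "e \<in> U" "f \<in> U" "e' \<in> U" "f' \<in> U"
    and ef: "hyperbolic_pair e f" and ef': "hyperbolic_pair e' f'"
  shows "\<exists>g\<in>U. k g g = \<zero>\<^bsub>S\<^esub> \<and> k e g \<in> Units S \<and> k e' g \<in> Units S"
proof -
  note D = submodD[OF U]
  note vc = U_in[THEN D(1)]
  obtain l where l: "l \<in> carrier S" "l \<oplus>\<^bsub>S\<^esub> \<sigma> l = \<one>\<^bsub>S\<^esub>" by (rule trace_one)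
  have v: "k e e = \<zero>\<^bsub>S\<^esub>" "k f f = \<zero>\<^bsub>S\<^esub>" "k e f = \<one>\<^bsub>S\<^esub>" "k e' e' = \<zero>\<^bsub>S\<^esub>" "k e' f' = \<one>\<^bsub>S\<^esub>"
    using ef ef' unfolding hyperbolic_pair_def by auto
  have fe: "k f e = \<one>\<^bsub>S\<^esub>" using k_sym[of f e] vc v by simp
  define a b a1 b1 where "a = k f e'" and "b = k e e'" and "a1 = k f f'" and "b1 = k e f'"
  have sc: "a \<in> carrier S" "b \<in> carrier S" "a1 \<in> carrier S" "b1 \<in> carrier S"
    unfolding a_def b_def a1_def b1_def using vc by simp_all
  have ae: "k e' f = \<sigma> a" "k e' e = \<sigma> b" unfolding a_def b_def by (rule k_sym[OF vc(3,2)], rule k_sym[OF vc(3,1)])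
  define m m' where "m = e' \<oplus>\<^bsub>V\<^esub> (\<ominus>\<^bsub>S\<^esub> a) \<odot>\<^bsub>V\<^esub> e \<oplus>\<^bsub>V\<^esub> (\<ominus>\<^bsub>S\<^esub> b) \<odot>\<^bsub>V\<^esub> f"
    and "m' = f' \<oplus>\<^bsub>V\<^esub> (\<ominus>\<^bsub>S\<^esub> a1) \<odot>\<^bsub>V\<^esub> e \<oplus>\<^bsub>V\<^esub> (\<ominus>\<^bsub>S\<^esub> b1) \<odot>\<^bsub>V\<^esub> f"
  have mU: "m \<in> U" "m' \<in> U" unfolding m_def m'_def using sc U_in by (auto intro!: D(3,4))
  note mc = mU[THEN D(1)]
  have perp: "k e m = \<zero>\<^bsub>S\<^esub>" "k f m = \<zero>\<^bsub>S\<^esub>" "k e m' = \<zero>\<^bsub>S\<^esub>" "k f m' = \<zero>\<^bsub>S\<^esub>"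
    unfolding m_def m'_def using vc sc v fe
    by (simp_all add: k_expand S.r_neg flip: a_def b_def a1_def b1_def)
  have perp': "k m e = \<zero>\<^bsub>S\<^esub>" "k m f = \<zero>\<^bsub>S\<^esub>" "k m' e = \<zero>\<^bsub>S\<^esub>" "k m' f = \<zero>\<^bsub>S\<^esub>"
    using k_zero_commute perp vc mc by simp_all
  define q w q' where "q = \<ominus>\<^bsub>S\<^esub> (\<sigma> a \<otimes>\<^bsub>S\<^esub> b \<oplus>\<^bsub>S\<^esub> \<sigma> b \<otimes>\<^bsub>S\<^esub> a)"
    and "w = \<one>\<^bsub>S\<^esub> \<ominus>\<^bsub>S\<^esub> \<sigma> b \<otimes>\<^bsub>S\<^esub> a1 \<ominus>\<^bsub>S\<^esub> \<sigma> a \<otimes>\<^bsub>S\<^esub> b1" and "q' = k m' m'"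
  have qc: "q \<in> carrier S" "w \<in> carrier S" "q' \<in> carrier S" unfolding q_def w_def q'_def using sc mc by simp_all
  have e'm: "k e' m = q" "k e' m' = w"
    unfolding m_def m'_def q_def w_def using vc sc v
    by (simp_all add: k_expand ae S.r_minus S.minus_add S.minus_eq S.a_ac)
  have km: "k m x = k e' x" if "x \<in> carrier V" "k e x = \<zero>\<^bsub>S\<^esub>" "k f x = \<zero>\<^bsub>S\<^esub>" for x
    unfolding m_def using vc sc that by (simp add: k_expand)
  have gram: "k m m = q" "k m m' = w" "k m' m = \<sigma> w"
    using km[OF mc(1) perp(1,2)] km[OF mc(2) perp(3,4)] e'm k_sym[OF mc(2,1)] by simp_all
  have self: "\<sigma> q = q" "\<sigma> q' = q'"
    unfolding gram(1)[symmetric] q'_def by (rule k_sym[OF mc(1,1), symmetric], rule k_sym[OF mc(2,2), symmetric])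
  obtain x y s where xys: "x \<in> carrier S" "y \<in> carrier S" "s \<in> carrier S"
    and unit: "neighbour_value l a b q w q' x y s \<in> Units S"
    using neighbour_value_unit_exists[OF LG db l(1) sc qc(3) l(2)] unfolding q_def w_def by (elim bexE)
  define hm where "hm = \<sigma> x \<otimes>\<^bsub>S\<^esub> x \<otimes>\<^bsub>S\<^esub> q \<oplus>\<^bsub>S\<^esub> \<sigma> x \<otimes>\<^bsub>S\<^esub> y \<otimes>\<^bsub>S\<^esub> w \<oplus>\<^bsub>S\<^esub> \<sigma> y \<otimes>\<^bsub>S\<^esub> x \<otimes>\<^bsub>S\<^esub> \<sigma> w \<oplus>\<^bsub>S\<^esub> \<sigma> y \<otimes>\<^bsub>S\<^esub> y \<otimes>\<^bsub>S\<^esub> q'"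
  have hmc: "hm \<in> carrier S" "\<sigma> hm = hm"
    unfolding hm_def using xys qc self by (simp_all add: S.m_ac S.a_ac)
  define t where "t = s \<ominus>\<^bsub>S\<^esub> \<sigma> s \<ominus>\<^bsub>S\<^esub> l \<otimes>\<^bsub>S\<^esub> hm"
  have tc: "t \<in> carrier S" unfolding t_def using xys l hmc by simp
  have st: "\<sigma> t = \<sigma> s \<ominus>\<^bsub>S\<^esub> s \<ominus>\<^bsub>S\<^esub> \<sigma> l \<otimes>\<^bsub>S\<^esub> hm" unfolding t_def using xys l hmc by simp
  define g where "g = f \<oplus>\<^bsub>V\<^esub> x \<odot>\<^bsub>V\<^esub> m \<oplus>\<^bsub>V\<^esub> y \<odot>\<^bsub>V\<^esub> m' \<oplus>\<^bsub>V\<^esub> t \<odot>\<^bsub>V\<^esub> e"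
  have gU: "g \<in> U" unfolding g_def using xys tc mU U_in by (auto intro!: D(3,4))
  have "k g g = t \<oplus>\<^bsub>S\<^esub> \<sigma> t \<oplus>\<^bsub>S\<^esub> hm"
    unfolding g_def hm_def using vc mc xys tc qc
    by (simp add: k_expand v fe perp perp' gram S.m_ac S.a_ac S.r_distr flip: q'_def)
  also have "\<dots> = \<zero>\<^bsub>S\<^esub>"
    unfolding st unfolding t_def
    by (rule S.linear_combination[OF l(2), of _ _ "\<ominus>\<^bsub>S\<^esub> hm"],
        rule S.ring_identityI[of _ "[s, \<sigma> s, l, \<sigma> l, hm]"], (rule S.reify_rules)+)
      (use xys l hmc in \<open>simp_all add: S.in_carrier_simps norm_simps\<close>)
  finally have gg: "k g g = \<zero>\<^bsub>S\<^esub>" .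
  have eg: "k e g = \<one>\<^bsub>S\<^esub>" unfolding g_def using vc mc xys tc by (simp add: k_expand v perp)
  have "k e' g = neighbour_value l a b q w q' x y s"
    unfolding g_def neighbour_value_def hm_def[symmetric] t_def[symmetric] using vc mc xys tc qc sc
    by (simp add: k_expand e'm ae S.a_ac)
  then show ?thesis using gU gg eg unit by (intro bexI[of _ g]) simp_all
qed

text \<open>Exchange one vector at a time along \<open>(e, f), (e, g), (g, e'), (e', f')\<close>.\<close>

lemma hyperbolic_pair_cancel:
  assumes LG: "LG_ring R" and db: "dual_basis n \<xi> gg"
    and U: "submod U" and U_in: "e \<in> U" "f \<in> U" "e' \<in> U" "f' \<in> U"
    and ef: "hyperbolic_pair e f" and ef': "hyperbolic_pair e' f'"
  shows "\<exists>\<psi>. isometry \<psi> (perp2 U e f) (perp2 U e' f')"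
proof -
  note vc = U_in[THEN submodD(1)[OF U]]
  obtain g where g: "g \<in> U" "k g g = \<zero>\<^bsub>S\<^esub>" "k e g \<in> Units S" "k e' g \<in> Units S"
    using exists_common_neighbour[OF LG db U U_in ef ef'] by auto
  have gc: "g \<in> carrier V" by (rule submodD(1)[OF U g(1)])
  have u: "k g e \<in> Units S" "k g e' \<in> Units S" using k_Units_commute g vc gc by simp_all
  have v: "k e e = \<zero>\<^bsub>S\<^esub>" "k e' e' = \<zero>\<^bsub>S\<^esub>" "k f e \<in> Units S" "k f' e' \<in> Units S"
    using ef ef' k_Units_commute[of e f] k_Units_commute[of e' f'] vc unfolding hyperbolic_pair_def by simp_all
  obtain \<psi>1 where 1: "isometry \<psi>1 (perp2 U e f) (perp2 U e g)"
    using isometry_exchange[OF U U_in(1,2) g(1) v(1,3) u(1)] by auto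
  obtain \<psi>2 where 2: "isometry \<psi>2 (perp2 U g e) (perp2 U g e')"
    using isometry_exchange[OF U g(1) U_in(1,3) g(2-4)] by auto
  obtain \<psi>3 where 3: "isometry \<psi>3 (perp2 U e' g) (perp2 U e' f')"
    using isometry_exchange[OF U U_in(3) g(1) U_in(4) v(2) u(2) v(4)] by auto
  show ?thesis
    using isometry_trans[OF isometry_trans[OF 1 2[folded perp2_commute[of U e g]]] 3[folded perp2_commute[of U g e']]]
    by (intro exI)
qed

definition hyperbolic_family :: "_ \<Rightarrow> nat \<Rightarrow> _" where
  "hyperbolic_family U n E F \<longleftrightarrow> (\<forall>i<n. E i \<in> U \<and> F i \<in> U) \<and>
    (\<forall>i<n. \<forall>j<n. k (E i) (E j) = \<zero>\<^bsub>S\<^esub> \<and> k (F i) (F j) = \<zero>\<^bsub>S\<^esub> \<and>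
      k (E i) (F j) = (if i = j then \<one>\<^bsub>S\<^esub> else \<zero>\<^bsub>S\<^esub>))"

definition perp :: "_ \<Rightarrow> nat \<Rightarrow> _" where "perp U n E F = {x \<in> U. \<forall>i<n. k (E i) x = \<zero>\<^bsub>S\<^esub> \<and> k (F i) x = \<zero>\<^bsub>S\<^esub>}"

lemma perp_Suc: "perp U (Suc n) E F = perp (perp2 U (E n) (F n)) n E F"
  unfolding perp_def perp2_def by (auto simp: less_Suc_eq)

lemma hyperbolic_family_Suc:
  assumes U: "submod U" and fam: "hyperbolic_family U (Suc n) E F"
  shows "E n \<in> U" "F n \<in> U" "hyperbolic_pair (E n) (F n)" "hyperbolic_family (perp2 U (E n) (F n)) n E F"
proof -
  note D = submodD(1)[OF U]
  have in_U: "E i \<in> U" "F i \<in> U" if "i < Suc n" for i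
    using fam that unfolding hyperbolic_family_def by auto
  have v: "k (E i) (E j) = \<zero>\<^bsub>S\<^esub>" "k (F i) (F j) = \<zero>\<^bsub>S\<^esub>" "k (E i) (F j) = (if i = j then \<one>\<^bsub>S\<^esub> else \<zero>\<^bsub>S\<^esub>)"
    if "i < Suc n" "j < Suc n" for i j
    using fam that unfolding hyperbolic_family_def by auto
  show "E n \<in> U" "F n \<in> U" using in_U by simp_all
  show "hyperbolic_pair (E n) (F n)" unfolding hyperbolic_pair_def using v[of n n] by simp
  have "k (F n) (E i) = \<zero>\<^bsub>S\<^esub>" if "i < n" for i
    using k_zero_commute[of "E i" "F n"] v[of i n] D in_U[of i] in_U[of n] that by simp
  then show "hyperbolic_family (perp2 U (E n) (F n)) n E F"
    using v in_U unfolding hyperbolic_family_def perp2_def by simp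
qed

lemma hyperbolic_family_cancel:
  assumes LG: "LG_ring R" and db: "dual_basis N \<xi> gg"
    and "submod U" "hyperbolic_family U n E F" "hyperbolic_family U n E' F'"
  shows "\<exists>\<psi>. isometry \<psi> (perp U n E F) (perp U n E' F')"
  using assms(3-)
proof (induction n arbitrary: U E F E' F')
  case 0
  have "isometry (\<lambda>x. x) (perp U 0 E F) (perp U 0 E' F')"
    unfolding isometry_def perp_def by (simp add: bij_betw_def)
  then show ?case by (intro exI)
next
  case (Suc n)
  note H = hyperbolic_family_Suc[OF Suc.prems(1,2)] and H' = hyperbolic_family_Suc[OF Suc.prems(1,3)]
  let ?U = "perp2 U (E n) (F n)" and ?U' = "perp2 U (E' n) (F' n)"
  have sub: "submod ?U" "submod ?U'" using submod_perp2[OF Suc.prems(1)] H H' by simp_all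
  obtain \<psi> where psi: "isometry \<psi> ?U ?U'"
    using hyperbolic_pair_cancel[OF LG db Suc.prems(1) H(1,2) H'(1,2) H(3) H'(3)] by auto
  have pres: "k (\<psi> x) (\<psi> y) = k x y" if "x \<in> ?U" "y \<in> ?U" for x y
    using psi that unfolding isometry_def by simp
  have EF: "E i \<in> ?U" "F i \<in> ?U" if "i < n" for i
    using H(4) that unfolding hyperbolic_family_def by auto
  have fam: "hyperbolic_family ?U' n (\<psi> \<circ> E) (\<psi> \<circ> F)"
    using H(4) isometry_image[OF psi] EF unfolding hyperbolic_family_def by (simp add: pres)
  from Suc.IH[OF sub(2) fam H'(4)]
  obtain \<chi> where chi: "isometry \<chi> (perp ?U' n (\<psi> \<circ> E) (\<psi> \<circ> F)) (perp ?U' n E' F')" ..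
  have "\<psi> ` perp ?U n E F = perp ?U' n (\<psi> \<circ> E) (\<psi> \<circ> F)"
  proof -
    have img: "\<psi> ` ?U = ?U'" using psi unfolding isometry_def bij_betw_def by auto
    have iff: "\<psi> x \<in> perp ?U' n (\<psi> \<circ> E) (\<psi> \<circ> F) \<longleftrightarrow> x \<in> perp ?U n E F" if "x \<in> ?U" for x
      unfolding perp_def using that isometry_image[OF psi that] by (simp add: pres EF)
    have "perp ?U n E F \<subseteq> ?U" "perp ?U' n (\<psi> \<circ> E) (\<psi> \<circ> F) \<subseteq> \<psi> ` ?U" unfolding img by (auto simp: perp_def)
    then show ?thesis using iff by (auto simp: subset_iff)
  qed
  then have "isometry \<psi> (perp ?U n E F) (perp ?U' n (\<psi> \<circ> E) (\<psi> \<circ> F))"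
    by (intro isometry_restrict[OF psi]) (auto simp: perp_def)
  then show ?case using isometry_trans[OF _ chi] unfolding perp_Suc by (intro exI)
qed

end

section \<open>Hermitian forms on free modules and orthogonal sums\<close>

lemma direct_sum_simps:
  "carrier (direct_sum M N) = carrier M \<times> carrier N"
  "\<zero>\<^bsub>direct_sum M N\<^esub> = (\<zero>\<^bsub>M\<^esub>, \<zero>\<^bsub>N\<^esub>)"
  "(x, y) \<oplus>\<^bsub>direct_sum M N\<^esub> (x', y') = (x \<oplus>\<^bsub>M\<^esub> x', y \<oplus>\<^bsub>N\<^esub> y')"
  "r \<odot>\<^bsub>direct_sum M N\<^esub> (x, y) = (r \<odot>\<^bsub>M\<^esub> x, r \<odot>\<^bsub>N\<^esub> y)"
  by (simp_all add: direct_sum_def)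

lemma module_direct_sum:
  assumes "module R M" "module R N"
  shows "module R (direct_sum M N)"
proof -
  interpret M: module R M by fact
  interpret N: module R N by fact
  show ?thesis
  proof (rule moduleI)
    show "cring R" by (rule M.R.is_cring)
    show "abelian_group (direct_sum M N)"
    proof (rule abelian_groupI)
      fix x assume "x \<in> carrier (direct_sum M N)"
      then obtain a b where x: "x = (a, b)" "a \<in> carrier M" "b \<in> carrier N" by (auto simp: direct_sum_simps)
      show "\<exists>y\<in>carrier (direct_sum M N). y \<oplus>\<^bsub>direct_sum M N\<^esub> x = \<zero>\<^bsub>direct_sum M N\<^esub>"
        using x by (intro bexI[of _ "(\<ominus>\<^bsub>M\<^esub> a, \<ominus>\<^bsub>N\<^esub> b)"]) (auto simp: direct_sum_simps M.M.l_neg N.M.l_neg)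
    qed (auto simp: direct_sum_simps M.M.a_ac N.M.a_ac)
  qed (auto simp: direct_sum_simps M.smult_l_distr N.smult_l_distr M.smult_r_distr N.smult_r_distr
        M.smult_assoc1 N.smult_assoc1)
qed

lemma free_module_simps:
  "carrier (free_module R n) = {..<n} \<rightarrow>\<^sub>E carrier R"
  "i < n \<Longrightarrow> \<zero>\<^bsub>free_module R n\<^esub> i = \<zero>\<^bsub>R\<^esub>"
  "i < n \<Longrightarrow> (x \<oplus>\<^bsub>free_module R n\<^esub> y) i = x i \<oplus>\<^bsub>R\<^esub> y i"
  "i < n \<Longrightarrow> (r \<odot>\<^bsub>free_module R n\<^esub> x) i = r \<otimes>\<^bsub>R\<^esub> x i"
  by (simp_all add: free_module_def)

lemma free_module_carrierD: "x \<in> carrier (free_module R n) \<Longrightarrow> i < n \<Longrightarrow> x i \<in> carrier R"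
  by (auto simp: free_module_def)

lemma free_module_ext:
  assumes "x \<in> carrier (free_module R n)" "y \<in> carrier (free_module R n)" "\<And>i. i < n \<Longrightarrow> x i = y i"
  shows "x = y"
  using assms unfolding free_module_simps(1) by (intro PiE_ext[of x "{..<n}" "\<lambda>_. carrier R" y]) auto

lemma (in cring) module_free: "module R (free_module R n)"
proof (rule moduleI)
  let ?F = "free_module R n"
  note cD = free_module_carrierD[of _ R n]
  have ac: "x \<oplus>\<^bsub>?F\<^esub> y \<in> carrier ?F" if "x \<in> carrier ?F" "y \<in> carrier ?F" for x y
    using cD that by (auto simp: free_module_def)
  have zc: "\<zero>\<^bsub>?F\<^esub> \<in> carrier ?F" by (auto simp: free_module_def)
  have sc: "r \<odot>\<^bsub>?F\<^esub> x \<in> carrier ?F" if "r \<in> carrier R" "x \<in> carrier ?F" for r x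
    using cD that by (auto simp: free_module_def)
  note ext = free_module_ext[of _ R n]
  show "abelian_group ?F"
  proof (rule abelian_groupI)
    fix x y z assume c: "x \<in> carrier ?F" "y \<in> carrier ?F" "z \<in> carrier ?F"
    show "x \<oplus>\<^bsub>?F\<^esub> y \<oplus>\<^bsub>?F\<^esub> z = x \<oplus>\<^bsub>?F\<^esub> (y \<oplus>\<^bsub>?F\<^esub> z)"
      by (rule ext) (use c ac cD in \<open>simp_all add: free_module_simps(2-) a_assoc\<close>)
  next
    fix x y assume c: "x \<in> carrier ?F" "y \<in> carrier ?F"
    show "x \<oplus>\<^bsub>?F\<^esub> y = y \<oplus>\<^bsub>?F\<^esub> x"
      by (rule ext) (use c ac cD in \<open>simp_all add: free_module_simps(2-) a_comm\<close>)
  next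
    fix x assume c: "x \<in> carrier ?F"
    show "\<zero>\<^bsub>?F\<^esub> \<oplus>\<^bsub>?F\<^esub> x = x"
      by (rule ext) (use c ac zc cD in \<open>simp_all add: free_module_simps(2-)\<close>)
    show "\<exists>y\<in>carrier ?F. y \<oplus>\<^bsub>?F\<^esub> x = \<zero>\<^bsub>?F\<^esub>"
    proof (rule bexI)
      show n: "(\<ominus> \<one>) \<odot>\<^bsub>?F\<^esub> x \<in> carrier ?F" using sc c by simp
      show "(\<ominus> \<one>) \<odot>\<^bsub>?F\<^esub> x \<oplus>\<^bsub>?F\<^esub> x = \<zero>\<^bsub>?F\<^esub>"
        by (rule ext) (use c n ac zc cD[OF c] in \<open>simp_all add: free_module_simps(2-) l_minus l_neg\<close>)
    qed
  qed (use ac zc in auto)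
  fix a x assume c: "a \<in> carrier R" "x \<in> carrier ?F"
  show "a \<odot>\<^bsub>?F\<^esub> x \<in> carrier ?F" using sc c by simp
  show "(a \<oplus> b) \<odot>\<^bsub>?F\<^esub> x = a \<odot>\<^bsub>?F\<^esub> x \<oplus>\<^bsub>?F\<^esub> b \<odot>\<^bsub>?F\<^esub> x" if b: "b \<in> carrier R" for b
    by (rule ext) (use b c cD[OF c(2)] ac sc in \<open>simp_all add: free_module_simps(2-) l_distr\<close>)
  show "(a \<otimes> b) \<odot>\<^bsub>?F\<^esub> x = a \<odot>\<^bsub>?F\<^esub> (b \<odot>\<^bsub>?F\<^esub> x)" if b: "b \<in> carrier R" for b
    by (rule ext) (use b c cD[OF c(2)] ac sc in \<open>simp_all add: free_module_simps(2-) m_assoc\<close>)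
  show "a \<odot>\<^bsub>?F\<^esub> (x \<oplus>\<^bsub>?F\<^esub> y) = a \<odot>\<^bsub>?F\<^esub> x \<oplus>\<^bsub>?F\<^esub> a \<odot>\<^bsub>?F\<^esub> y" if y: "y \<in> carrier ?F" for y
    by (rule ext) (use y c cD[OF c(2)] cD[OF y] ac sc in \<open>simp_all add: free_module_simps(2-) r_distr\<close>)
next
  fix x assume c: "x \<in> carrier (free_module R n)"
  show "\<one> \<odot>\<^bsub>free_module R n\<^esub> x = x"
    by (rule free_module_ext[of _ R n])
      (use c free_module_carrierD[OF c] in \<open>auto simp: free_module_def\<close>)
qed (rule is_cring)

lemma unit_vector_carrier: "cring R \<Longrightarrow> unit_vector R n i \<in> carrier (free_module R n)"
  by (auto simp: unit_vector_def free_module_def intro: cring.cring_simprules)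

lemma hermitian_formD:
  assumes "hermitian_form S \<sigma> M h" and one: "cring S" "\<sigma> \<one>\<^bsub>S\<^esub> = \<one>\<^bsub>S\<^esub>"
    and s: "\<sigma> \<in> carrier S \<rightarrow> carrier S"
  shows "module S M"
    "x \<in> carrier M \<Longrightarrow> y \<in> carrier M \<Longrightarrow> h x y \<in> carrier S"
    "x \<in> carrier M \<Longrightarrow> x' \<in> carrier M \<Longrightarrow> y \<in> carrier M \<Longrightarrow> h (x \<oplus>\<^bsub>M\<^esub> x') y = h x y \<oplus>\<^bsub>S\<^esub> h x' y"
    "x \<in> carrier M \<Longrightarrow> y \<in> carrier M \<Longrightarrow> y' \<in> carrier M \<Longrightarrow> h x (y \<oplus>\<^bsub>M\<^esub> y') = h x y \<oplus>\<^bsub>S\<^esub> h x y'"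
    "x \<in> carrier M \<Longrightarrow> y \<in> carrier M \<Longrightarrow> c \<in> carrier S \<Longrightarrow> h (c \<odot>\<^bsub>M\<^esub> x) y = \<sigma> c \<otimes>\<^bsub>S\<^esub> h x y"
    "x \<in> carrier M \<Longrightarrow> y \<in> carrier M \<Longrightarrow> c \<in> carrier S \<Longrightarrow> h x (c \<odot>\<^bsub>M\<^esub> y) = h x y \<otimes>\<^bsub>S\<^esub> c"
    "x \<in> carrier M \<Longrightarrow> y \<in> carrier M \<Longrightarrow> h x y = \<sigma> (h y x)"
proof -
  interpret S: cring S by (rule one)
  show m: "module S M" using assms(1) unfolding hermitian_form_def fg_projective_def by simp
  interpret M: module S M by (rule m)
  note H = assms(1)[unfolded hermitian_form_def, THEN conjunct2]
  note c = H[THEN conjunct1, rule_format]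
    and al = H[THEN conjunct2, THEN conjunct1, rule_format]
    and ar = H[THEN conjunct2, THEN conjunct2, THEN conjunct1, rule_format]
    and sm = H[THEN conjunct2, THEN conjunct2, THEN conjunct2, THEN conjunct1, rule_format]
    and sy = H[THEN conjunct2, THEN conjunct2, THEN conjunct2, THEN conjunct2, rule_format]
  show "x \<in> carrier M \<Longrightarrow> y \<in> carrier M \<Longrightarrow> h x y \<in> carrier S" by (rule c)
  show "x \<in> carrier M \<Longrightarrow> x' \<in> carrier M \<Longrightarrow> y \<in> carrier M \<Longrightarrow> h (x \<oplus>\<^bsub>M\<^esub> x') y = h x y \<oplus>\<^bsub>S\<^esub> h x' y" by (rule al)
  show "x \<in> carrier M \<Longrightarrow> y \<in> carrier M \<Longrightarrow> y' \<in> carrier M \<Longrightarrow> h x (y \<oplus>\<^bsub>M\<^esub> y') = h x y \<oplus>\<^bsub>S\<^esub> h x y'" by (rule ar)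
  show "x \<in> carrier M \<Longrightarrow> y \<in> carrier M \<Longrightarrow> h x y = \<sigma> (h y x)" by (rule sy)
  show "x \<in> carrier M \<Longrightarrow> y \<in> carrier M \<Longrightarrow> c \<in> carrier S \<Longrightarrow> h (c \<odot>\<^bsub>M\<^esub> x) y = \<sigma> c \<otimes>\<^bsub>S\<^esub> h x y"
    using sm[of x y c "\<one>\<^bsub>S\<^esub>"] c[of x y] s by (simp add: Pi_iff)
  show "x \<in> carrier M \<Longrightarrow> y \<in> carrier M \<Longrightarrow> c \<in> carrier S \<Longrightarrow> h x (c \<odot>\<^bsub>M\<^esub> y) = h x y \<otimes>\<^bsub>S\<^esub> c"
    using sm[of x y "\<one>\<^bsub>S\<^esub>" c] c[of x y] one(2) by simp
qed

context etale_involution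
begin

text \<open>The hyperbolic form on \<open>S\<^sup>n \<oplus> S\<^sup>n\<close>, realised on \<open>S\<^sup>2\<^sup>n\<close>.\<close>

definition hyp :: "nat \<Rightarrow> (nat \<Rightarrow> 'c) \<Rightarrow> (nat \<Rightarrow> 'c) \<Rightarrow> 'c" where
  "hyp n x y = (\<Oplus>\<^bsub>S\<^esub>i\<in>{..<n}. \<sigma> (x i) \<otimes>\<^bsub>S\<^esub> y (n + i) \<oplus>\<^bsub>S\<^esub> \<sigma> (x (n + i)) \<otimes>\<^bsub>S\<^esub> y i)"

abbreviation Fr where "Fr n \<equiv> free_module S (n + n)"

lemma hyp_carrier:
  assumes "x \<in> carrier (Fr n)" "i < n" shows "x i \<in> carrier S" "x (n + i) \<in> carrier S"
  using free_module_carrierD[OF assms(1)] assms(2) by simp_all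

lemma hyp_closed: "x \<in> carrier (Fr n) \<Longrightarrow> y \<in> carrier (Fr n) \<Longrightarrow> hyp n x y \<in> carrier S"
  unfolding hyp_def by (intro S.finsum_closed) (auto simp: hyp_carrier)

lemma hyp_add_left:
  assumes "x \<in> carrier (Fr n)" "x' \<in> carrier (Fr n)" "y \<in> carrier (Fr n)"
  shows "hyp n (x \<oplus>\<^bsub>Fr n\<^esub> x') y = hyp n x y \<oplus>\<^bsub>S\<^esub> hyp n x' y"
proof -
  have "hyp n (x \<oplus>\<^bsub>Fr n\<^esub> x') y = (\<Oplus>\<^bsub>S\<^esub>i\<in>{..<n}. (\<sigma> (x i) \<otimes>\<^bsub>S\<^esub> y (n + i) \<oplus>\<^bsub>S\<^esub> \<sigma> (x (n + i)) \<otimes>\<^bsub>S\<^esub> y i) \<oplus>\<^bsub>S\<^esub> (\<sigma> (x' i) \<otimes>\<^bsub>S\<^esub> y (n + i) \<oplus>\<^bsub>S\<^esub> \<sigma> (x' (n + i)) \<otimes>\<^bsub>S\<^esub> y i))"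
    unfolding hyp_def
    by (rule S.finsum_cong') (use assms in \<open>auto simp: hyp_carrier free_module_simps(3) S.l_distr S.a_ac\<close>)
  also have "\<dots> = hyp n x y \<oplus>\<^bsub>S\<^esub> hyp n x' y"
    unfolding hyp_def by (rule S.finsum_addf) (use assms in \<open>auto simp: hyp_carrier\<close>)
  finally show ?thesis .
qed

lemma hyp_add_right:
  assumes "x \<in> carrier (Fr n)" "y \<in> carrier (Fr n)" "y' \<in> carrier (Fr n)"
  shows "hyp n x (y \<oplus>\<^bsub>Fr n\<^esub> y') = hyp n x y \<oplus>\<^bsub>S\<^esub> hyp n x y'"
proof -
  have "hyp n x (y \<oplus>\<^bsub>Fr n\<^esub> y') = (\<Oplus>\<^bsub>S\<^esub>i\<in>{..<n}. (\<sigma> (x i) \<otimes>\<^bsub>S\<^esub> y (n + i) \<oplus>\<^bsub>S\<^esub> \<sigma> (x (n + i)) \<otimes>\<^bsub>S\<^esub> y i) \<oplus>\<^bsub>S\<^esub> (\<sigma> (x i) \<otimes>\<^bsub>S\<^esub> y' (n + i) \<oplus>\<^bsub>S\<^esub> \<sigma> (x (n + i)) \<otimes>\<^bsub>S\<^esub> y' i))"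
    unfolding hyp_def
    by (rule S.finsum_cong') (use assms in \<open>auto simp: hyp_carrier free_module_simps(3) S.r_distr S.a_ac\<close>)
  also have "\<dots> = hyp n x y \<oplus>\<^bsub>S\<^esub> hyp n x y'"
    unfolding hyp_def by (rule S.finsum_addf) (use assms in \<open>auto simp: hyp_carrier\<close>)
  finally show ?thesis .
qed

lemma hyp_smult:
  assumes "x \<in> carrier (Fr n)" "y \<in> carrier (Fr n)" "s \<in> carrier S" "t \<in> carrier S"
  shows "hyp n (s \<odot>\<^bsub>Fr n\<^esub> x) (t \<odot>\<^bsub>Fr n\<^esub> y) = \<sigma> s \<otimes>\<^bsub>S\<^esub> hyp n x y \<otimes>\<^bsub>S\<^esub> t"
proof -
  have "hyp n (s \<odot>\<^bsub>Fr n\<^esub> x) (t \<odot>\<^bsub>Fr n\<^esub> y) = (\<Oplus>\<^bsub>S\<^esub>i\<in>{..<n}. (\<sigma> s \<otimes>\<^bsub>S\<^esub> t) \<otimes>\<^bsub>S\<^esub> (\<sigma> (x i) \<otimes>\<^bsub>S\<^esub> y (n + i) \<oplus>\<^bsub>S\<^esub> \<sigma> (x (n + i)) \<otimes>\<^bsub>S\<^esub> y i))"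
    unfolding hyp_def
    by (rule S.finsum_cong') (use assms in \<open>auto simp: hyp_carrier free_module_simps(4) S.r_distr S.m_ac\<close>)
  also have "\<dots> = (\<sigma> s \<otimes>\<^bsub>S\<^esub> t) \<otimes>\<^bsub>S\<^esub> hyp n x y"
    unfolding hyp_def by (rule S.finsum_rdistr[symmetric]) (use assms in \<open>auto simp: hyp_carrier\<close>)
  finally show ?thesis using assms hyp_closed[OF assms(1,2)] by (simp add: S.m_ac)
qed

lemma sigma_finsum:
  fixes n :: nat
  assumes "\<And>i. i < n \<Longrightarrow> f i \<in> carrier S"
  shows "\<sigma> (\<Oplus>\<^bsub>S\<^esub>i\<in>{..<n}. f i) = (\<Oplus>\<^bsub>S\<^esub>i\<in>{..<n}. \<sigma> (f i))"
  using assms by (induction n) (auto simp: lessThan_Suc S.finsum_insert Pi_def)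

lemma hyp_sym:
  assumes "x \<in> carrier (Fr n)" "y \<in> carrier (Fr n)"
  shows "hyp n x y = \<sigma> (hyp n y x)"
proof -
  have "\<sigma> (hyp n y x) = (\<Oplus>\<^bsub>S\<^esub>i\<in>{..<n}. \<sigma> (\<sigma> (y i) \<otimes>\<^bsub>S\<^esub> x (n + i) \<oplus>\<^bsub>S\<^esub> \<sigma> (y (n + i)) \<otimes>\<^bsub>S\<^esub> x i))"
    unfolding hyp_def by (rule sigma_finsum) (use assms in \<open>simp add: hyp_carrier\<close>)
  also have "\<dots> = hyp n x y"
    unfolding hyp_def by (rule S.finsum_cong') (use assms in \<open>auto simp: hyp_carrier S.m_ac S.a_ac\<close>)
  finally show ?thesis ..
qed

lemma hyp_smult_left:
  assumes "x \<in> carrier (Fr n)" "y \<in> carrier (Fr n)" "s \<in> carrier S"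
  shows "hyp n (s \<odot>\<^bsub>Fr n\<^esub> x) y = \<sigma> s \<otimes>\<^bsub>S\<^esub> hyp n x y"
proof -
  interpret F: module S "Fr n" by (rule S.module_free)
  show ?thesis using hyp_smult[OF assms S.one_closed] assms hyp_closed[OF assms(1,2)] by simp
qed

lemma finsum_delta:
  fixes n :: nat
  assumes "i < n" "f i \<in> carrier S"
  shows "(\<Oplus>\<^bsub>S\<^esub>j\<in>{..<n}. if j = i then f j else \<zero>\<^bsub>S\<^esub>) = f i"
proof -
  have "(\<Oplus>\<^bsub>S\<^esub>j\<in>{..<n}. if j = i then f j else \<zero>\<^bsub>S\<^esub>) = (\<Oplus>\<^bsub>S\<^esub>j\<in>{i}. f j)"
    by (rule S.add.finprod_mono_neutral_cong_right) (use assms in auto)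
  then show ?thesis using assms by simp
qed

lemma hyp_unit_vector:
  assumes y: "y \<in> carrier (Fr n)" and i: "i < n"
  shows "hyp n (unit_vector S (n + n) i) y = y (n + i)" "hyp n (unit_vector S (n + n) (n + i)) y = y i"
proof -
  have "hyp n (unit_vector S (n + n) i) y = (\<Oplus>\<^bsub>S\<^esub>j\<in>{..<n}. if j = i then y (n + j) else \<zero>\<^bsub>S\<^esub>)"
    unfolding hyp_def by (rule S.finsum_cong') (use y i in \<open>auto simp: unit_vector_def hyp_carrier\<close>)
  then show "hyp n (unit_vector S (n + n) i) y = y (n + i)" using finsum_delta[OF i] hyp_carrier[OF y i] by simp
  have "hyp n (unit_vector S (n + n) (n + i)) y = (\<Oplus>\<^bsub>S\<^esub>j\<in>{..<n}. if j = i then y j else \<zero>\<^bsub>S\<^esub>)"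
    unfolding hyp_def by (rule S.finsum_cong') (use y i in \<open>auto simp: unit_vector_def hyp_carrier\<close>)
  then show "hyp n (unit_vector S (n + n) (n + i)) y = y i" using finsum_delta[OF i] hyp_carrier[OF y i] by simp
qed

text \<open>Because every hermitian form is the sum of \<open>l h\<close> and its conjugate transpose, it is induced from a
  hyperbolic space; regularity provides the orthogonal projection.\<close>

lemma embed_in_hyperbolic:
  fixes M :: "('c, 'm, 'e) module_scheme"
  assumes hs: "hermitian_space S \<sigma> M k"
  obtains n j p where "j \<in> module_hom S M (Fr n)" "p \<in> module_hom S (Fr n) M"
    "\<And>x y. x \<in> carrier M \<Longrightarrow> y \<in> carrier M \<Longrightarrow> hyp n (j x) (j y) = k x y"
    "\<And>v y. v \<in> carrier (Fr n) \<Longrightarrow> y \<in> carrier M \<Longrightarrow> k (p v) y = hyp n v (j y)"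
    "\<And>x. x \<in> carrier M \<Longrightarrow> p (j x) = x"
proof -
  have hf: "hermitian_form S \<sigma> M k" and bij: "bij_betw (\<lambda>x. \<lambda>y\<in>carrier M. k x y) (carrier M) (dual S M)"
    using hs unfolding hermitian_space_def by simp_all
  have "\<sigma> \<in> carrier S \<rightarrow> carrier S" by simp
  note K = hermitian_formD[OF hf S.is_cring sigma_one this]
  interpret M: module S M by (rule K(1))
  obtain n \<iota> \<pi> where i: "\<iota> \<in> module_hom S M (free_module S n)" and p: "\<pi> \<in> module_hom S (free_module S n) M"
    and pi: "\<And>x. x \<in> carrier M \<Longrightarrow> \<pi> (\<iota> x) = x"
    using hf unfolding hermitian_form_def fg_projective_def by auto
  obtain l where l: "l \<in> carrier S" "l \<oplus>\<^bsub>S\<^esub> \<sigma> l = \<one>\<^bsub>S\<^esub>" by (rule trace_one)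
  define b where "b i = \<pi> (unit_vector S n i)" for i
  have bc: "b i \<in> carrier M" for i
    unfolding b_def by (rule module_homD(1)[OF p unit_vector_carrier[OF S.is_cring]])
  have ic: "\<iota> x i \<in> carrier S" if "x \<in> carrier M" "i < n" for x i
    using free_module_carrierD[OF module_homD(1)[OF i that(1)] that(2)] .
  have xsum: "x = (\<Oplus>\<^bsub>M\<^esub>i\<in>{..<n}. \<iota> x i \<odot>\<^bsub>M\<^esub> b i)" if x: "x \<in> carrier M" for x
    using M.module_hom_free_expand[OF p module_homD(1)[OF i x, unfolded free_module_simps(1)]] pi[OF x]
    unfolding b_def by (simp only:)
  have ksum: "m \<le> n \<Longrightarrow> k (\<Oplus>\<^bsub>M\<^esub>i\<in>{..<m}. \<iota> x i \<odot>\<^bsub>M\<^esub> b i) y = (\<Oplus>\<^bsub>S\<^esub>i\<in>{..<m}. \<sigma> (\<iota> x i) \<otimes>\<^bsub>S\<^esub> k (b i) y)"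
    if x: "x \<in> carrier M" and y: "y \<in> carrier M" for x y m
  proof (induction m)
    case 0
    show ?case using K(5)[of "\<zero>\<^bsub>M\<^esub>" y "\<zero>\<^bsub>S\<^esub>"] y K(2) by simp
  next
    case (Suc m)
    have c: "\<iota> x i \<odot>\<^bsub>M\<^esub> b i \<in> carrier M" "\<sigma> (\<iota> x i) \<otimes>\<^bsub>S\<^esub> k (b i) y \<in> carrier S" if "i < Suc m" for i
      using that Suc.prems ic[OF x] bc K(2) y by simp_all
    have "k (\<Oplus>\<^bsub>M\<^esub>i\<in>{..<Suc m}. \<iota> x i \<odot>\<^bsub>M\<^esub> b i) y = k (\<iota> x m \<odot>\<^bsub>M\<^esub> b m \<oplus>\<^bsub>M\<^esub> (\<Oplus>\<^bsub>M\<^esub>i\<in>{..<m}. \<iota> x i \<odot>\<^bsub>M\<^esub> b i)) y"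
      unfolding lessThan_Suc using c by (subst M.M.finsum_insert) auto
    also have "\<dots> = k (\<iota> x m \<odot>\<^bsub>M\<^esub> b m) y \<oplus>\<^bsub>S\<^esub> k (\<Oplus>\<^bsub>M\<^esub>i\<in>{..<m}. \<iota> x i \<odot>\<^bsub>M\<^esub> b i) y"
      by (rule K(3)) (use c y in \<open>auto intro!: M.M.finsum_closed\<close>)
    also have "\<dots> = \<sigma> (\<iota> x m) \<otimes>\<^bsub>S\<^esub> k (b m) y \<oplus>\<^bsub>S\<^esub> (\<Oplus>\<^bsub>S\<^esub>i\<in>{..<m}. \<sigma> (\<iota> x i) \<otimes>\<^bsub>S\<^esub> k (b i) y)"
      using Suc ic[OF x] bc y by (simp add: K(5))
    also have "\<dots> = (\<Oplus>\<^bsub>S\<^esub>i\<in>{..<Suc m}. \<sigma> (\<iota> x i) \<otimes>\<^bsub>S\<^esub> k (b i) y)"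
      unfolding lessThan_Suc using c by (subst S.finsum_insert) auto
    finally show ?case .
  qed
  have kx: "k x y = (\<Oplus>\<^bsub>S\<^esub>i\<in>{..<n}. \<sigma> (\<iota> x i) \<otimes>\<^bsub>S\<^esub> k (b i) y)" if "x \<in> carrier M" "y \<in> carrier M" for x y
    using ksum[OF that, of n] xsum[OF that(1)] by simp
  define j where "j x = (\<lambda>i\<in>{..<n + n}. if i < n then \<iota> x i else l \<otimes>\<^bsub>S\<^esub> k (b (i - n)) x)" for x
  have jv: "j x i = \<iota> x i" "j x (n + i) = l \<otimes>\<^bsub>S\<^esub> k (b i) x" if "i < n" for x i
    using that by (simp_all add: j_def)
  have jhom: "j \<in> module_hom S M (Fr n)"
  proof (rule module_homI)
    show jc: "j x \<in> carrier (Fr n)" if "x \<in> carrier M" for x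
      unfolding free_module_simps(1) j_def using that ic bc l K(2) by (auto simp: PiE_def)
    interpret F: module S "Fr n" by (rule S.module_free)
    fix x assume x: "x \<in> carrier M"
    show "j (x \<oplus>\<^bsub>M\<^esub> y) = j x \<oplus>\<^bsub>Fr n\<^esub> j y" if y: "y \<in> carrier M" for y
    proof (rule free_module_ext)
      show "j (x \<oplus>\<^bsub>M\<^esub> y) \<in> carrier (Fr n)" "j x \<oplus>\<^bsub>Fr n\<^esub> j y \<in> carrier (Fr n)" using jc x y by simp_all
      show "j (x \<oplus>\<^bsub>M\<^esub> y) i = (j x \<oplus>\<^bsub>Fr n\<^esub> j y) i" if "i < n + n" for i
        using that x y bc l K(2) module_homD(2)[OF i x y]
        by (simp add: free_module_simps(3) j_def K(4) S.r_distr)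
    qed
    show "j (r \<odot>\<^bsub>M\<^esub> x) = r \<odot>\<^bsub>Fr n\<^esub> j x" if r: "r \<in> carrier S" for r
    proof (rule free_module_ext)
      show "j (r \<odot>\<^bsub>M\<^esub> x) \<in> carrier (Fr n)" "r \<odot>\<^bsub>Fr n\<^esub> j x \<in> carrier (Fr n)" using jc x r by simp_all
      show "j (r \<odot>\<^bsub>M\<^esub> x) i = (r \<odot>\<^bsub>Fr n\<^esub> j x) i" if "i < n + n" for i
        using that x r bc l K(2) module_homD(3)[OF i r x]
        by (simp add: free_module_simps(4) j_def K(6) S.m_ac)
    qed
  qed
  note jD = module_homD[OF jhom]
  have jj: "hyp n (j x) (j y) = k x y" if x: "x \<in> carrier M" and y: "y \<in> carrier M" for x y
  proof -
    have c: "\<sigma> (\<iota> x i) \<otimes>\<^bsub>S\<^esub> k (b i) y \<in> carrier S" "\<sigma> (\<iota> y i) \<otimes>\<^bsub>S\<^esub> k (b i) x \<in> carrier S" if "i < n" for i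
      using that ic x y bc K(2) by simp_all
    have "hyp n (j x) (j y) = (\<Oplus>\<^bsub>S\<^esub>i\<in>{..<n}. l \<otimes>\<^bsub>S\<^esub> (\<sigma> (\<iota> x i) \<otimes>\<^bsub>S\<^esub> k (b i) y) \<oplus>\<^bsub>S\<^esub> \<sigma> (l \<otimes>\<^bsub>S\<^esub> (\<sigma> (\<iota> y i) \<otimes>\<^bsub>S\<^esub> k (b i) x)))"
      unfolding hyp_def
      by (rule S.finsum_cong') (use jv ic x y bc l K(2) in \<open>auto simp: S.m_ac\<close>)
    also have "\<dots> = (\<Oplus>\<^bsub>S\<^esub>i\<in>{..<n}. l \<otimes>\<^bsub>S\<^esub> (\<sigma> (\<iota> x i) \<otimes>\<^bsub>S\<^esub> k (b i) y)) \<oplus>\<^bsub>S\<^esub> (\<Oplus>\<^bsub>S\<^esub>i\<in>{..<n}. \<sigma> (l \<otimes>\<^bsub>S\<^esub> (\<sigma> (\<iota> y i) \<otimes>\<^bsub>S\<^esub> k (b i) x)))"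
      using c l by (intro S.finsum_addf) (simp_all add: Pi_def)
    also have "(\<Oplus>\<^bsub>S\<^esub>i\<in>{..<n}. \<sigma> (l \<otimes>\<^bsub>S\<^esub> (\<sigma> (\<iota> y i) \<otimes>\<^bsub>S\<^esub> k (b i) x))) = \<sigma> (\<Oplus>\<^bsub>S\<^esub>i\<in>{..<n}. l \<otimes>\<^bsub>S\<^esub> (\<sigma> (\<iota> y i) \<otimes>\<^bsub>S\<^esub> k (b i) x))"
      using c l by (intro sigma_finsum[symmetric]) simp
    also have "(\<Oplus>\<^bsub>S\<^esub>i\<in>{..<n}. l \<otimes>\<^bsub>S\<^esub> (\<sigma> (\<iota> y i) \<otimes>\<^bsub>S\<^esub> k (b i) x)) = l \<otimes>\<^bsub>S\<^esub> k y x"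
      unfolding kx[OF y x] using c l by (intro S.finsum_rdistr[symmetric]) (simp_all add: Pi_def)
    also have "(\<Oplus>\<^bsub>S\<^esub>i\<in>{..<n}. l \<otimes>\<^bsub>S\<^esub> (\<sigma> (\<iota> x i) \<otimes>\<^bsub>S\<^esub> k (b i) y)) = l \<otimes>\<^bsub>S\<^esub> k x y"
      unfolding kx[OF x y] using c l by (intro S.finsum_rdistr[symmetric]) (simp_all add: Pi_def)
    also have "\<sigma> (l \<otimes>\<^bsub>S\<^esub> k y x) = \<sigma> l \<otimes>\<^bsub>S\<^esub> k x y" using K(2)[OF y x] l K(7)[OF x y] by simp
    also have "l \<otimes>\<^bsub>S\<^esub> k x y \<oplus>\<^bsub>S\<^esub> \<sigma> l \<otimes>\<^bsub>S\<^esub> k x y = k x y"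
      using K(2)[OF x y] l by (simp add: S.l_distr[symmetric])
    finally show ?thesis .
  qed
  have inj: "x = y" if "x \<in> carrier M" "y \<in> carrier M" "\<And>z. z \<in> carrier M \<Longrightarrow> k x z = k y z" for x y
  proof -
    have "(\<lambda>z\<in>carrier M. k x z) = (\<lambda>z\<in>carrier M. k y z)" using that(3) by (intro restrict_ext) simp
    then show ?thesis using bij that(1,2) unfolding bij_betw_def inj_on_def by simp
  qed
  define p where "p v = (SOME x. x \<in> carrier M \<and> (\<forall>y\<in>carrier M. k x y = hyp n v (j y)))" for v
  have pv: "p v \<in> carrier M \<and> (\<forall>y\<in>carrier M. k (p v) y = hyp n v (j y))" if v: "v \<in> carrier (Fr n)" for v
  proof -
    interpret F: module S "Fr n" by (rule S.module_free)
    have "(\<lambda>y\<in>carrier M. hyp n v (j y)) \<in> dual S M"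
    proof -
      have "hyp n v (r \<odot>\<^bsub>Fr n\<^esub> j y) = hyp n v (j y) \<otimes>\<^bsub>S\<^esub> r" if "r \<in> carrier S" "y \<in> carrier M" for r y
        using hyp_smult[OF v jD(1)[OF that(2)] S.one_closed that(1)] v hyp_closed[OF v jD(1)[OF that(2)]] by simp
      then have "(\<lambda>y\<in>carrier M. hyp n v (j y)) \<in> module_hom S M (regular_module S)"
        using v jD hyp_closed
        by (intro module_homI) (auto simp: regular_module_def hyp_add_right S.m_comm)
      then show ?thesis unfolding dual_def by simp
    qed
    then have "(\<lambda>y\<in>carrier M. hyp n v (j y)) \<in> (\<lambda>x. \<lambda>y\<in>carrier M. k x y) ` carrier M"
      unfolding bij_betw_imp_surj_on[OF bij] .
    then obtain x where x: "x \<in> carrier M" "(\<lambda>y\<in>carrier M. hyp n v (j y)) = (\<lambda>y\<in>carrier M. k x y)"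
      by (elim imageE)
    have "k x y = hyp n v (j y)" if "y \<in> carrier M" for y
      using fun_cong[OF x(2), of y] that by simp
    then have "\<exists>x. x \<in> carrier M \<and> (\<forall>y\<in>carrier M. k x y = hyp n v (j y))" using x(1) by auto
    then show ?thesis unfolding p_def by (rule someI_ex)
  qed
  have phom: "p \<in> module_hom S (Fr n) M"
  proof (rule module_homI)
    interpret F: module S "Fr n" by (rule S.module_free)
    fix v assume v: "v \<in> carrier (Fr n)"
    show "p v \<in> carrier M" using pv[OF v] by simp
    show "p (v \<oplus>\<^bsub>Fr n\<^esub> u) = p v \<oplus>\<^bsub>M\<^esub> p u" if u: "u \<in> carrier (Fr n)" for u
      by (rule inj) (use pv[OF v] pv[OF u] pv[OF F.M.a_closed[OF v u]] hyp_add_left[OF v u] jD(1) K(3) in simp_all)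
    show "p (r \<odot>\<^bsub>Fr n\<^esub> v) = r \<odot>\<^bsub>M\<^esub> p v" if r: "r \<in> carrier S" for r
      by (rule inj) (use r pv[OF v] pv[OF F.smult_closed[OF r v]] hyp_smult_left[OF v _ r] jD(1) K(5) in simp_all)
  qed
  have "p (j x) = x" if x: "x \<in> carrier M" for x
    by (rule inj) (use x pv[OF jD(1)[OF x]] jj[OF x] in simp_all)
  then show ?thesis using that[OF jhom phom jj] pv by simp
qed

end

section \<open>Cancellation\<close>

context etale_involution
begin

lemma sigma_Pi: "\<sigma> \<in> carrier S \<rightarrow> carrier S"
  by simp

lemmas formD = hermitian_formD[OF _ S.is_cring sigma_one sigma_Pi]

text \<open>Both sides are enlarged by the orthogonal complement of \<open>M3\<close> in a hyperbolic space. The complement is not formed;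
  it is the image of the idempotent \<open>r\<close>.\<close>

lemma isometric_add_hyperbolic:
  fixes M1 :: "('c, 'm1, 'e1) module_scheme" and M2 :: "('c, 'm2, 'e2) module_scheme"
    and M3 :: "('c, 'm3, 'e3) module_scheme"
  assumes f1: "hermitian_form S \<sigma> M1 h1" and f2: "hermitian_form S \<sigma> M2 h2"
    and s3: "hermitian_space S \<sigma> M3 h3"
    and iso: "isometric S (direct_sum M1 M3) (orthogonal_sum S h1 h3) (direct_sum M2 M3) (orthogonal_sum S h2 h3)"
  obtains n where "isometric S (direct_sum M1 (Fr n)) (orthogonal_sum S h1 (hyp n))
    (direct_sum M2 (Fr n)) (orthogonal_sum S h2 (hyp n))"
proof -
  have f3: "hermitian_form S \<sigma> M3 h3" using s3 unfolding hermitian_space_def by simp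
  interpret M1: module S M1 by (rule formD(1)[OF f1])
  interpret M2: module S M2 by (rule formD(1)[OF f2])
  interpret M3: module S M3 by (rule formD(1)[OF f3])
  obtain n j p where j: "j \<in> module_hom S M3 (Fr n)" and p: "p \<in> module_hom S (Fr n) M3"
    and jj: "\<And>x y. x \<in> carrier M3 \<Longrightarrow> y \<in> carrier M3 \<Longrightarrow> hyp n (j x) (j y) = h3 x y"
    and pj: "\<And>v y. v \<in> carrier (Fr n) \<Longrightarrow> y \<in> carrier M3 \<Longrightarrow> h3 (p v) y = hyp n v (j y)"
    and pjx: "\<And>x. x \<in> carrier M3 \<Longrightarrow> p (j x) = x"
    by (rule embed_in_hyperbolic[OF s3]) (rule that)
  interpret F: module S "Fr n" by (rule S.module_free)
  note jD = module_homD[OF j] and pD = module_homD[OF p]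
  let ?m = "\<ominus>\<^bsub>S\<^esub> \<one>\<^bsub>S\<^esub>"
  have mc: "?m \<in> carrier S" by simp
  define r where "r v = v \<oplus>\<^bsub>Fr n\<^esub> ?m \<odot>\<^bsub>Fr n\<^esub> j (p v)" for v
  have rc: "r v \<in> carrier (Fr n)" if "v \<in> carrier (Fr n)" for v
    unfolding r_def using that jD(1) pD(1) mc by simp
  have neg3: "x \<oplus>\<^bsub>M3\<^esub> ?m \<odot>\<^bsub>M3\<^esub> x = \<zero>\<^bsub>M3\<^esub>" if "x \<in> carrier M3" for x
  proof -
    have "x \<oplus>\<^bsub>M3\<^esub> ?m \<odot>\<^bsub>M3\<^esub> x = (\<one>\<^bsub>S\<^esub> \<oplus>\<^bsub>S\<^esub> ?m) \<odot>\<^bsub>M3\<^esub> x" using that mc by (simp only: M3.smult_l_distr M3.smult_one S.one_closed)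
    then show ?thesis using that by (simp add: S.r_neg)
  qed
  have negF: "x \<oplus>\<^bsub>Fr n\<^esub> ?m \<odot>\<^bsub>Fr n\<^esub> x = \<zero>\<^bsub>Fr n\<^esub>" if "x \<in> carrier (Fr n)" for x
  proof -
    have "x \<oplus>\<^bsub>Fr n\<^esub> ?m \<odot>\<^bsub>Fr n\<^esub> x = (\<one>\<^bsub>S\<^esub> \<oplus>\<^bsub>S\<^esub> ?m) \<odot>\<^bsub>Fr n\<^esub> x" using that mc by (simp only: F.smult_l_distr F.smult_one S.one_closed)
    then show ?thesis using that by (simp add: S.r_neg)
  qed
  have pr: "p (r v) = \<zero>\<^bsub>M3\<^esub>" if v: "v \<in> carrier (Fr n)" for v
    unfolding r_def using v jD(1) pD mc pjx neg3 by simp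
  have radd: "r (v \<oplus>\<^bsub>Fr n\<^esub> u) = r v \<oplus>\<^bsub>Fr n\<^esub> r u" if "v \<in> carrier (Fr n)" "u \<in> carrier (Fr n)" for v u
    unfolding r_def using that jD pD mc by (simp add: F.smult_r_distr F.M.a_ac)
  have rsm: "r (s \<odot>\<^bsub>Fr n\<^esub> v) = s \<odot>\<^bsub>Fr n\<^esub> r v" if "s \<in> carrier S" "v \<in> carrier (Fr n)" for s v
    unfolding r_def using that jD pD mc by (simp add: F.smult_r_distr F.smult_assoc1[symmetric] S.m_comm[of s ?m])
  have rj: "r (j x) = \<zero>\<^bsub>Fr n\<^esub>" if x: "x \<in> carrier M3" for x
    unfolding r_def pjx[OF x] using negF[OF jD(1)[OF x]] .
  have j0: "j \<zero>\<^bsub>M3\<^esub> = \<zero>\<^bsub>Fr n\<^esub>"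
    using jD(3)[of "\<zero>\<^bsub>S\<^esub>" "\<zero>\<^bsub>M3\<^esub>"] jD(1)[of "\<zero>\<^bsub>M3\<^esub>"] by simp
  have rr: "r (r v) = r v" if v: "v \<in> carrier (Fr n)" for v
  proof -
    have "r (r v) = r v \<oplus>\<^bsub>Fr n\<^esub> ?m \<odot>\<^bsub>Fr n\<^esub> j (p (r v))" by (simp only: r_def)
    then show ?thesis using rc[OF v] mc by (simp add: pr[OF v] j0)
  qed
  have dec: "j (p v) \<oplus>\<^bsub>Fr n\<^esub> r v = v" if v: "v \<in> carrier (Fr n)" for v
  proof -
    have c: "j (p v) \<in> carrier (Fr n)" using v jD(1) pD(1) by simp
    have "j (p v) \<oplus>\<^bsub>Fr n\<^esub> r v = v \<oplus>\<^bsub>Fr n\<^esub> (j (p v) \<oplus>\<^bsub>Fr n\<^esub> ?m \<odot>\<^bsub>Fr n\<^esub> j (p v))"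
      unfolding r_def using v c mc F.smult_closed[OF mc c] by (simp only: F.M.a_ac F.M.a_closed)
    then show ?thesis unfolding negF[OF c] using v by simp
  qed
  have hr: "hyp n (r v) (j y) = \<zero>\<^bsub>S\<^esub>" if v: "v \<in> carrier (Fr n)" and y: "y \<in> carrier M3" for v y
  proof -
    have c: "p v \<in> carrier M3" "j (p v) \<in> carrier (Fr n)" "j y \<in> carrier (Fr n)" using v y jD(1) pD(1) by simp_all
    have "hyp n (r v) (j y) = hyp n v (j y) \<oplus>\<^bsub>S\<^esub> \<sigma> ?m \<otimes>\<^bsub>S\<^esub> hyp n (j (p v)) (j y)"
      unfolding r_def using v c mc F.smult_closed[OF mc c(2)] by (simp only: hyp_add_left hyp_smult_left)
    also have "\<dots> = h3 (p v) y \<oplus>\<^bsub>S\<^esub> \<sigma> ?m \<otimes>\<^bsub>S\<^esub> h3 (p v) y"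
      using pj[OF v y] jj[OF c(1) y] by simp
    also have "\<dots> = \<zero>\<^bsub>S\<^esub>" using formD(2)[OF f3 c(1) y] by (simp add: S.l_minus S.r_neg)
    finally show ?thesis .
  qed
  have hjr: "hyp n (j a \<oplus>\<^bsub>Fr n\<^esub> r v) (j b \<oplus>\<^bsub>Fr n\<^esub> r u) = h3 a b \<oplus>\<^bsub>S\<^esub> hyp n (r v) (r u)"
    if "a \<in> carrier M3" "b \<in> carrier M3" "v \<in> carrier (Fr n)" "u \<in> carrier (Fr n)" for a b v u
  proof -
    have c: "j a \<in> carrier (Fr n)" "j b \<in> carrier (Fr n)" "r v \<in> carrier (Fr n)" "r u \<in> carrier (Fr n)"
      using that jD(1) rc by simp_all
    have "hyp n (j a) (r u) = \<zero>\<^bsub>S\<^esub>" using hyp_sym[OF c(1,4)] hr[OF that(4,1)] by simp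
    then show ?thesis
      using hyp_add_left[OF c(1,3) F.M.a_closed[OF c(2,4)]] hyp_add_right[OF c(1,2,4)] hyp_add_right[OF c(3,2,4)]
        hr[OF that(3,2)] jj[OF that(1,2)] formD(2)[OF f3 that(1,2)] hyp_closed[OF c(3,4)] by simp
  qed
  obtain f where fh: "f \<in> module_hom S (direct_sum M1 M3) (direct_sum M2 M3)"
    and fb: "bij_betw f (carrier (direct_sum M1 M3)) (carrier (direct_sum M2 M3))"
    and fk: "\<And>x y. x \<in> carrier (direct_sum M1 M3) \<Longrightarrow> y \<in> carrier (direct_sum M1 M3) \<Longrightarrow>
      orthogonal_sum S h2 h3 (f x) (f y) = orthogonal_sum S h1 h3 x y"
    using iso unfolding isometric_def by auto
  note fD = module_homD[OF fh, unfolded direct_sum_simps(1)]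
  define g where "g = inv_into (carrier (direct_sum M1 M3)) f"
  have gf: "g (f x) = x" if "x \<in> carrier M1 \<times> carrier M3" for x
    unfolding g_def using that fb by (simp add: bij_betw_inv_into_left direct_sum_simps)
  have fg: "f (g y) = y" "g y \<in> carrier M1 \<times> carrier M3" if "y \<in> carrier M2 \<times> carrier M3" for y
    unfolding g_def using that bij_betw_inv_into_right[OF fb, of y]
      bspec[OF bij_betwE[OF bij_betw_inv_into[OF fb]], of y]
    by (simp_all add: direct_sum_simps)
  define T where "T x = (fst (f (fst x, p (snd x))), j (snd (f (fst x, p (snd x)))) \<oplus>\<^bsub>Fr n\<^esub> r (snd x))" for x
  define T' where "T' x = (fst (g (fst x, p (snd x))), j (snd (g (fst x, p (snd x)))) \<oplus>\<^bsub>Fr n\<^esub> r (snd x))" for x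
  have fc: "fst (f (m, b)) \<in> carrier M2" "snd (f (m, b)) \<in> carrier M3" if "m \<in> carrier M1" "b \<in> carrier M3" for m b
    using fD(1)[of "(m, b)"] that by (simp_all add: direct_sum_simps mem_Times_iff)
  have gc: "fst (g (m, b)) \<in> carrier M1" "snd (g (m, b)) \<in> carrier M3" if "m \<in> carrier M2" "b \<in> carrier M3" for m b
    using fg(2)[of "(m, b)"] that by (simp_all add: mem_Times_iff)
  have pjr: "p (j b \<oplus>\<^bsub>Fr n\<^esub> r v) = b" "r (j b \<oplus>\<^bsub>Fr n\<^esub> r v) = r v" if "b \<in> carrier M3" "v \<in> carrier (Fr n)" for b v
    using that pD(2)[OF jD(1) rc] radd[OF jD(1) rc] rc by (simp_all add: pjx pr rj rr)
  have Tc: "T x \<in> carrier M2 \<times> carrier (Fr n)" if "x \<in> carrier M1 \<times> carrier (Fr n)" for x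
    using that fc pD(1) jD(1) rc by (auto simp: T_def)
  have T'c: "T' x \<in> carrier M1 \<times> carrier (Fr n)" if "x \<in> carrier M2 \<times> carrier (Fr n)" for x
    using that gc pD(1) jD(1) rc by (auto simp: T'_def)
  have T'T: "T' (T x) = x" if x: "x \<in> carrier M1 \<times> carrier (Fr n)" for x
  proof -
    obtain m v where mv: "x = (m, v)" "m \<in> carrier M1" "v \<in> carrier (Fr n)" using x by auto
    obtain a b where ab: "f (m, p v) = (a, b)" by (cases "f (m, p v)")
    have b: "b \<in> carrier M3" using fc(2)[OF mv(2) pD(1)[OF mv(3)]] ab by simp
    have "g (a, b) = (m, p v)" using gf[of "(m, p v)"] mv pD(1) ab by simp
    then show ?thesis using mv pjr[OF b mv(3)] dec[OF mv(3)] by (simp add: T_def T'_def ab)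
  qed
  have TT': "T (T' x) = x" if x: "x \<in> carrier M2 \<times> carrier (Fr n)" for x
  proof -
    obtain m v where mv: "x = (m, v)" "m \<in> carrier M2" "v \<in> carrier (Fr n)" using x by auto
    obtain a b where ab: "g (m, p v) = (a, b)" by (cases "g (m, p v)")
    have b: "b \<in> carrier M3" using gc(2)[OF mv(2) pD(1)[OF mv(3)]] ab by simp
    have "f (a, b) = (m, p v)" using fg(1)[of "(m, p v)"] mv pD(1) ab by simp
    then show ?thesis using mv pjr[OF b mv(3)] dec[OF mv(3)] by (simp add: T_def T'_def ab)
  qed
  have Tb: "bij_betw T (carrier (direct_sum M1 (Fr n))) (carrier (direct_sum M2 (Fr n)))"
    unfolding direct_sum_simps
    by (rule bij_betw_byWitness[of _ T']) (use T'T TT' Tc T'c in \<open>simp_all add: image_subset_iff\<close>)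
  have Th: "T \<in> module_hom S (direct_sum M1 (Fr n)) (direct_sum M2 (Fr n))"
  proof (rule module_homI)
    fix x assume "x \<in> carrier (direct_sum M1 (Fr n))"
    then have x: "x \<in> carrier M1 \<times> carrier (Fr n)" by (simp add: direct_sum_simps)
    then show "T x \<in> carrier (direct_sum M2 (Fr n))" using Tc by (simp add: direct_sum_simps)
    obtain m v where mv: "x = (m, v)" "m \<in> carrier M1" "v \<in> carrier (Fr n)" using x by auto
    obtain a b where ab: "f (m, p v) = (a, b)" by (cases "f (m, p v)")
    have b: "b \<in> carrier M3" using fc(2)[OF mv(2) pD(1)[OF mv(3)]] ab by simp
    have xin: "(m, p v) \<in> carrier M1 \<times> carrier M3" using mv pD(1) by simp
    show "T (s \<odot>\<^bsub>direct_sum M1 (Fr n)\<^esub> x) = s \<odot>\<^bsub>direct_sum M2 (Fr n)\<^esub> T x" if s: "s \<in> carrier S" for s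
    proof -
      have "f (s \<odot>\<^bsub>M1\<^esub> m, s \<odot>\<^bsub>M3\<^esub> p v) = (s \<odot>\<^bsub>M2\<^esub> a, s \<odot>\<^bsub>M3\<^esub> b)"
        using fD(3)[OF s xin] by (simp add: direct_sum_simps ab)
      then show ?thesis
        using s mv b jD(1) rc by (simp add: T_def direct_sum_simps ab pD(3) jD(3) rsm F.smult_r_distr)
    qed
    fix y assume "y \<in> carrier (direct_sum M1 (Fr n))"
    then obtain m' v' where mv': "y = (m', v')" "m' \<in> carrier M1" "v' \<in> carrier (Fr n)" by (auto simp: direct_sum_simps)
    obtain a' b' where ab': "f (m', p v') = (a', b')" by (cases "f (m', p v')")
    have b': "b' \<in> carrier M3" using fc(2)[OF mv'(2) pD(1)[OF mv'(3)]] ab' by simp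
    have yin: "(m', p v') \<in> carrier M1 \<times> carrier M3" using mv' pD(1) by simp
    have fsum: "f (m \<oplus>\<^bsub>M1\<^esub> m', p v \<oplus>\<^bsub>M3\<^esub> p v') = (a \<oplus>\<^bsub>M2\<^esub> a', b \<oplus>\<^bsub>M3\<^esub> b')"
      using fD(2)[OF xin yin] by (simp add: direct_sum_simps ab ab')
    show "T (x \<oplus>\<^bsub>direct_sum M1 (Fr n)\<^esub> y) = T x \<oplus>\<^bsub>direct_sum M2 (Fr n)\<^esub> T y"
    proof -
      have "(j b \<oplus>\<^bsub>Fr n\<^esub> j b') \<oplus>\<^bsub>Fr n\<^esub> (r v \<oplus>\<^bsub>Fr n\<^esub> r v') = (j b \<oplus>\<^bsub>Fr n\<^esub> r v) \<oplus>\<^bsub>Fr n\<^esub> (j b' \<oplus>\<^bsub>Fr n\<^esub> r v')"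
        using jD(1)[OF b] jD(1)[OF b'] rc[OF mv(3)] rc[OF mv'(3)] by (simp add: F.M.a_ac)
      then show ?thesis
        using mv mv' b b' fsum
        by (simp add: T_def direct_sum_simps ab ab' pD(2) jD(2) radd)
    qed
  qed
  have Tk: "orthogonal_sum S h2 (hyp n) (T x) (T y) = orthogonal_sum S h1 (hyp n) x y"
    if xy: "x \<in> carrier (direct_sum M1 (Fr n))" "y \<in> carrier (direct_sum M1 (Fr n))" for x y
  proof -
    obtain m v m' v' where mv: "x = (m, v)" "m \<in> carrier M1" "v \<in> carrier (Fr n)"
      and mv': "y = (m', v')" "m' \<in> carrier M1" "v' \<in> carrier (Fr n)"
      using xy by (auto simp: direct_sum_simps)
    obtain a b a' b' where ab: "f (m, p v) = (a, b)" and ab': "f (m', p v') = (a', b')"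
      by (cases "f (m, p v)"; cases "f (m', p v')")
    have c: "a \<in> carrier M2" "b \<in> carrier M3" "a' \<in> carrier M2" "b' \<in> carrier M3"
      using fc[OF mv(2) pD(1)[OF mv(3)]] fc[OF mv'(2) pD(1)[OF mv'(3)]] ab ab' by simp_all
    have pc: "p v \<in> carrier M3" "p v' \<in> carrier M3" using pD(1) mv mv' by simp_all
    note cc = formD(2)[OF f2 c(1,3)] formD(2)[OF f3 c(2,4)] formD(2)[OF f1 mv(2) mv'(2)] formD(2)[OF f3 pc]
      hyp_closed[OF rc[OF mv(3)] rc[OF mv'(3)]]
    have "orthogonal_sum S h2 (hyp n) (T x) (T y) = (h2 a a' \<oplus>\<^bsub>S\<^esub> h3 b b') \<oplus>\<^bsub>S\<^esub> hyp n (r v) (r v')"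
      using mv mv' cc by (simp add: T_def orthogonal_sum_def ab ab' hjr[OF c(2,4) mv(3) mv'(3)] S.a_assoc)
    also have "h2 a a' \<oplus>\<^bsub>S\<^esub> h3 b b' = h1 m m' \<oplus>\<^bsub>S\<^esub> h3 (p v) (p v')"
      using fk[of "(m, p v)" "(m', p v')"] mv mv' pc by (simp add: direct_sum_simps orthogonal_sum_def ab ab')
    also have "(h1 m m' \<oplus>\<^bsub>S\<^esub> h3 (p v) (p v')) \<oplus>\<^bsub>S\<^esub> hyp n (r v) (r v')
        = h1 m m' \<oplus>\<^bsub>S\<^esub> hyp n (j (p v) \<oplus>\<^bsub>Fr n\<^esub> r v) (j (p v') \<oplus>\<^bsub>Fr n\<^esub> r v')"
      using cc by (simp add: hjr[OF pc mv(3) mv'(3)] S.a_assoc)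
    also have "\<dots> = orthogonal_sum S h1 (hyp n) x y"
      unfolding dec[OF mv(3)] dec[OF mv'(3)] mv(1) mv'(1) by (simp add: orthogonal_sum_def)
    finally show ?thesis .
  qed
  show ?thesis
    by (rule that[of n], unfold isometric_def) (use Th Tb Tk in \<open>intro bexI[of _ T] conjI ballI\<close>)
qed

lemma zero_form:
  assumes "hermitian_form S \<sigma> M k" "x \<in> carrier M"
  shows "k \<zero>\<^bsub>M\<^esub> x = \<zero>\<^bsub>S\<^esub>" "k x \<zero>\<^bsub>M\<^esub> = \<zero>\<^bsub>S\<^esub>"
proof -
  interpret M: module S M by (rule formD(1)[OF assms(1)])
  show "k \<zero>\<^bsub>M\<^esub> x = \<zero>\<^bsub>S\<^esub>"
    using formD(5)[OF assms(1) M.M.zero_closed assms(2) S.zero_closed] formD(2)[OF assms(1) M.M.zero_closed assms(2)] by simp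
  show "k x \<zero>\<^bsub>M\<^esub> = \<zero>\<^bsub>S\<^esub>"
    using formD(6)[OF assms(1) assms(2) M.M.zero_closed S.zero_closed] formD(2)[OF assms(1) assms(2) M.M.zero_closed] by simp
qed

lemma hyp_zero: "x \<in> carrier (Fr n) \<Longrightarrow> hyp n \<zero>\<^bsub>Fr n\<^esub> x = \<zero>\<^bsub>S\<^esub>"
  unfolding hyp_def by (intro S.add.finprod_one_eqI) (simp add: free_module_simps(2) hyp_carrier)

text \<open>For \<open>i < n\<close>, the vectors with the indices \<open>i\<close> and \<open>n + i\<close> form a hyperbolic pair.\<close>

definition hbasis :: "('c, 'm, 'e) module_scheme \<Rightarrow> nat \<Rightarrow> nat \<Rightarrow> 'm \<times> (nat \<Rightarrow> 'c)" where
  "hbasis M n i = (\<zero>\<^bsub>M\<^esub>, unit_vector S (n + n) i)"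

lemma hbasis_carrier: "hermitian_form S \<sigma> M k \<Longrightarrow> hbasis M n i \<in> carrier (direct_sum M (Fr n))"
  unfolding hbasis_def direct_sum_simps
  using abelian_group.axioms(1)[OF module.axioms(2)[OF formD(1)]] unit_vector_carrier[OF S.is_cring]
  by (auto intro: abelian_monoid.zero_closed)

lemma orthogonal_sum_hbasis:
  assumes f: "hermitian_form S \<sigma> M k" and x: "x \<in> carrier M" and v: "v \<in> carrier (Fr n)" and i: "i < n"
  shows "orthogonal_sum S k (hyp n) (hbasis M n i) (x, v) = v (n + i)"
    "orthogonal_sum S k (hyp n) (hbasis M n (n + i)) (x, v) = v i"
  using zero_form(1)[OF f x] hyp_unit_vector[OF v i] hyp_carrier[OF v i]
  unfolding hbasis_def orthogonal_sum_def by simp_all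

lemma hbasis_complement:
  assumes f: "hermitian_form S \<sigma> M k"
  shows "{y \<in> carrier (direct_sum M (Fr n)). \<forall>i<n. orthogonal_sum S k (hyp n) (hbasis M n i) y = \<zero>\<^bsub>S\<^esub> \<and>
      orthogonal_sum S k (hyp n) (hbasis M n (n + i)) y = \<zero>\<^bsub>S\<^esub>} = carrier M \<times> {\<zero>\<^bsub>Fr n\<^esub>}" (is "?L = ?R")
proof
  interpret F: module S "Fr n" by (rule S.module_free)
  show "?L \<subseteq> ?R"
  proof
    fix y assume y: "y \<in> ?L"
    then obtain x v where xv: "y = (x, v)" "x \<in> carrier M" "v \<in> carrier (Fr n)" by (auto simp: direct_sum_simps)
    have z: "v (n + i) = \<zero>\<^bsub>S\<^esub>" "v i = \<zero>\<^bsub>S\<^esub>" if "i < n" for i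
      using y that unfolding xv(1) by (simp_all add: orthogonal_sum_hbasis[OF f xv(2,3)])
    have "v = \<zero>\<^bsub>Fr n\<^esub>"
    proof (rule free_module_ext[OF xv(3) F.M.zero_closed])
      fix i assume i: "i < n + n"
      show "v i = \<zero>\<^bsub>Fr n\<^esub> i"
      proof (cases "i < n")
        case True
        then show ?thesis using z i by (simp add: free_module_simps(2))
      next
        case False
        then show ?thesis using z(1)[of "i - n"] i by (simp add: free_module_simps(2))
      qed
    qed
    then show "y \<in> ?R" using xv by simp
  qed
  show "?R \<subseteq> ?L"
    by (auto simp: orthogonal_sum_hbasis[OF f] direct_sum_simps free_module_simps(2))
qed

lemma hbasis_gram:
  assumes f: "hermitian_form S \<sigma> M k" and i: "i < n" and j: "j < n"
  shows "orthogonal_sum S k (hyp n) (hbasis M n i) (hbasis M n j) = \<zero>\<^bsub>S\<^esub>"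
    "orthogonal_sum S k (hyp n) (hbasis M n (n + i)) (hbasis M n (n + j)) = \<zero>\<^bsub>S\<^esub>"
    "orthogonal_sum S k (hyp n) (hbasis M n i) (hbasis M n (n + j)) = (if i = j then \<one>\<^bsub>S\<^esub> else \<zero>\<^bsub>S\<^esub>)"
proof -
  have z: "\<zero>\<^bsub>M\<^esub> \<in> carrier M" using hbasis_carrier[OF f, of n i] by (simp add: hbasis_def direct_sum_simps)
  note u = unit_vector_carrier[OF S.is_cring, of "n + n"]
  note o = orthogonal_sum_hbasis[OF f z u i, folded hbasis_def]
  show "orthogonal_sum S k (hyp n) (hbasis M n i) (hbasis M n j) = \<zero>\<^bsub>S\<^esub>"
    "orthogonal_sum S k (hyp n) (hbasis M n (n + i)) (hbasis M n (n + j)) = \<zero>\<^bsub>S\<^esub>"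
    "orthogonal_sum S k (hyp n) (hbasis M n i) (hbasis M n (n + j)) = (if i = j then \<one>\<^bsub>S\<^esub> else \<zero>\<^bsub>S\<^esub>)"
    unfolding o using i j by (simp_all add: unit_vector_def)
qed

lemma hermitian_module_sum:
  assumes f: "hermitian_form S \<sigma> M k"
  shows "hermitian_module R S h \<sigma> (direct_sum M (Fr n)) (orthogonal_sum S k (hyp n))"
proof -
  interpret M: module S M by (rule formD(1)[OF f])
  interpret F: module S "Fr n" by (rule S.module_free)
  note K = formD[OF f]
  have mV: "module S (direct_sum M (Fr n))" by (rule module_direct_sum[OF M.module_axioms F.module_axioms])
  note hs = hyp_closed hyp_add_left hyp_add_right hyp_smult
  show ?thesis
  proof (intro hermitian_module.intro hermitian_module_axioms.intro etale_involution_axioms mV)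
    fix x y assume "x \<in> carrier (direct_sum M (Fr n))" "y \<in> carrier (direct_sum M (Fr n))"
    then obtain a v b u where xy: "x = (a, v)" "y = (b, u)" "a \<in> carrier M" "b \<in> carrier M" "v \<in> carrier (Fr n)" "u \<in> carrier (Fr n)"
      by (auto simp: direct_sum_simps)
    show "orthogonal_sum S k (hyp n) x y \<in> carrier S"
      using xy K(2) hs(1) by (simp add: orthogonal_sum_def)
    show "orthogonal_sum S k (hyp n) x y = \<sigma> (orthogonal_sum S k (hyp n) y x)"
      using xy K(2) hs(1) K(7)[OF xy(3,4)] hyp_sym[OF xy(5,6)] by (simp add: orthogonal_sum_def)
    show "orthogonal_sum S k (hyp n) (s \<odot>\<^bsub>direct_sum M (Fr n)\<^esub> x) (t \<odot>\<^bsub>direct_sum M (Fr n)\<^esub> y)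
        = \<sigma> s \<otimes>\<^bsub>S\<^esub> orthogonal_sum S k (hyp n) x y \<otimes>\<^bsub>S\<^esub> t" if "s \<in> carrier S" "t \<in> carrier S" for s t
      using that xy K(2) hs(1) by (simp add: orthogonal_sum_def direct_sum_simps K(5,6) hyp_smult S.l_distr S.r_distr S.m_assoc)
    fix z assume "z \<in> carrier (direct_sum M (Fr n))"
    then obtain c w where z: "z = (c, w)" "c \<in> carrier M" "w \<in> carrier (Fr n)" by (auto simp: direct_sum_simps)
    show "orthogonal_sum S k (hyp n) (x \<oplus>\<^bsub>direct_sum M (Fr n)\<^esub> y) z
        = orthogonal_sum S k (hyp n) x z \<oplus>\<^bsub>S\<^esub> orthogonal_sum S k (hyp n) y z"
      using xy z K(2) hs(1) by (simp add: orthogonal_sum_def direct_sum_simps K(3) hyp_add_left S.a_ac)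
    show "orthogonal_sum S k (hyp n) x (y \<oplus>\<^bsub>direct_sum M (Fr n)\<^esub> z)
        = orthogonal_sum S k (hyp n) x y \<oplus>\<^bsub>S\<^esub> orthogonal_sum S k (hyp n) x z"
      using xy z K(2) hs(1) by (simp add: orthogonal_sum_def direct_sum_simps K(4) hyp_add_right S.a_ac)
  qed
qed

text \<open>The images of the hyperbolic basis of one side and the hyperbolic basis of the other are two hyperbolic
  families in one module, with complements \<open>M1\<close> and \<open>M2\<close>.\<close>

lemma cancel_hyperbolic:
  fixes M1 :: "('c, 'm1, 'e1) module_scheme" and M2 :: "('c, 'm2, 'e2) module_scheme"
  assumes LG: "LG_ring R" and db: "dual_basis N \<xi> gg"
    and f1: "hermitian_form S \<sigma> M1 h1" and f2: "hermitian_form S \<sigma> M2 h2"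
    and iso: "isometric S (direct_sum M1 (Fr n)) (orthogonal_sum S h1 (hyp n))
      (direct_sum M2 (Fr n)) (orthogonal_sum S h2 (hyp n))"
  shows "isometric S M1 h1 M2 h2"
proof -
  let ?V1 = "direct_sum M1 (Fr n)" and ?V = "direct_sum M2 (Fr n)"
  let ?k1 = "orthogonal_sum S h1 (hyp n)" and ?k = "orthogonal_sum S h2 (hyp n)"
  interpret M1: module S M1 by (rule formD(1)[OF f1])
  interpret M2: module S M2 by (rule formD(1)[OF f2])
  interpret F: module S "Fr n" by (rule S.module_free)
  interpret V: hermitian_module R S h \<sigma> ?V ?k by (rule hermitian_module_sum[OF f2])
  obtain g where gh: "g \<in> module_hom S ?V1 ?V" and gb: "bij_betw g (carrier ?V1) (carrier ?V)"
    and gk: "\<And>x y. x \<in> carrier ?V1 \<Longrightarrow> y \<in> carrier ?V1 \<Longrightarrow> ?k (g x) (g y) = ?k1 x y"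
    using iso unfolding isometric_def by auto
  note gD = module_homD[OF gh]
  let ?E = "\<lambda>i. g (hbasis M1 n i)" and ?F = "\<lambda>i. g (hbasis M1 n (n + i))"
  let ?Es = "\<lambda>i. hbasis M2 n i" and ?Fs = "\<lambda>i. hbasis M2 n (n + i)"
  note c1 = hbasis_carrier[OF f1] and c2 = hbasis_carrier[OF f2]
  have fam0: "V.hyperbolic_family (carrier ?V) n ?Es ?Fs"
    unfolding V.hyperbolic_family_def using c2 hbasis_gram[OF f2] by simp
  have fam: "V.hyperbolic_family (carrier ?V) n ?E ?F"
    unfolding V.hyperbolic_family_def using gD(1)[OF c1] hbasis_gram[OF f1] by (simp add: gk[OF c1 c1])
  obtain \<psi> where psi: "V.isometry \<psi> (V.perp (carrier ?V) n ?E ?F) (V.perp (carrier ?V) n ?Es ?Fs)"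
    using V.hyperbolic_family_cancel[OF LG db V.submod_carrier fam fam0] by (elim exE)
  have P0: "V.perp (carrier ?V) n ?Es ?Fs = carrier M2 \<times> {\<zero>\<^bsub>Fr n\<^esub>}"
    unfolding V.perp_def by (rule hbasis_complement[OF f2])
  have P: "V.perp (carrier ?V) n ?E ?F = g ` (carrier M1 \<times> {\<zero>\<^bsub>Fr n\<^esub>})"
  proof -
    have "V.perp (g ` carrier ?V1) n ?E ?F = g ` {y \<in> carrier ?V1. \<forall>i<n. ?k1 (hbasis M1 n i) y = \<zero>\<^bsub>S\<^esub> \<and>
      ?k1 (hbasis M1 n (n + i)) y = \<zero>\<^bsub>S\<^esub>}"
      unfolding V.perp_def by (auto simp: gk[OF c1])
    then show ?thesis unfolding bij_betw_imp_surj_on[OF gb] hbasis_complement[OF f1] .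
  qed
  define i1 where "i1 x = (x, \<zero>\<^bsub>Fr n\<^esub>)" for x :: 'm1
  have i1c: "i1 x \<in> carrier ?V1" "i1 x \<in> carrier M1 \<times> {\<zero>\<^bsub>Fr n\<^esub>}" if "x \<in> carrier M1" for x
    using that unfolding i1_def direct_sum_simps by simp_all
  have gi: "g (i1 x) \<in> V.perp (carrier ?V) n ?E ?F" if "x \<in> carrier M1" for x
    unfolding P using i1c(2)[OF that] by (rule imageI)
  define f where "f x = fst (\<psi> (g (i1 x)))" for x
  have psiP: "\<psi> y \<in> carrier M2 \<times> {\<zero>\<^bsub>Fr n\<^esub>}" if "y \<in> V.perp (carrier ?V) n ?E ?F" for y
    using V.isometry_image[OF psi that] unfolding P0 .
  have fx: "\<psi> (g (i1 x)) = (f x, \<zero>\<^bsub>Fr n\<^esub>)" "f x \<in> carrier M2" if "x \<in> carrier M1" for x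
    using psiP[OF gi[OF that]] unfolding f_def by (auto simp: mem_Times_iff prod_eq_iff)
  have b1: "bij_betw i1 (carrier M1) (carrier M1 \<times> {\<zero>\<^bsub>Fr n\<^esub>})"
    unfolding i1_def by (auto simp: bij_betw_def inj_on_def)
  have b2: "bij_betw g (carrier M1 \<times> {\<zero>\<^bsub>Fr n\<^esub>}) (V.perp (carrier ?V) n ?E ?F)"
    unfolding P by (rule bij_betw_subset[OF gb _ refl]) (auto simp: direct_sum_simps)
  have b3: "bij_betw \<psi> (V.perp (carrier ?V) n ?E ?F) (carrier M2 \<times> {\<zero>\<^bsub>Fr n\<^esub>})"
    using psi unfolding V.isometry_def P0 by simp
  have b4: "bij_betw fst (carrier M2 \<times> {\<zero>\<^bsub>Fr n\<^esub>}) (carrier M2)"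
    by (auto simp: bij_betw_def inj_on_def image_iff)
  have "bij_betw (fst \<circ> (\<psi> \<circ> (g \<circ> i1))) (carrier M1) (carrier M2)"
    by (intro bij_betw_trans[OF _ b4] bij_betw_trans[OF _ b3] bij_betw_trans[OF b1 b2])
  then have fb: "bij_betw f (carrier M1) (carrier M2)" by (simp add: f_def[abs_def] comp_def)
  have fh: "f \<in> module_hom S M1 M2"
  proof (rule module_homI)
    fix x assume x: "x \<in> carrier M1"
    show "f x \<in> carrier M2" by (rule fx(2)[OF x])
    show "f (x \<oplus>\<^bsub>M1\<^esub> y) = f x \<oplus>\<^bsub>M2\<^esub> f y" if y: "y \<in> carrier M1" for y
    proof -
      have "i1 (x \<oplus>\<^bsub>M1\<^esub> y) = i1 x \<oplus>\<^bsub>?V1\<^esub> i1 y" by (simp add: i1_def direct_sum_simps)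
      then have "\<psi> (g (i1 (x \<oplus>\<^bsub>M1\<^esub> y))) = \<psi> (g (i1 x)) \<oplus>\<^bsub>?V\<^esub> \<psi> (g (i1 y))"
        using psi gi[OF x] gi[OF y] gD(2)[OF i1c(1)[OF x] i1c(1)[OF y]] unfolding V.isometry_def by simp
      then show ?thesis using fx(1)[OF x] fx(1)[OF y] fx(1)[OF M1.M.a_closed[OF x y]] by (simp add: direct_sum_simps)
    qed
    show "f (s \<odot>\<^bsub>M1\<^esub> x) = s \<odot>\<^bsub>M2\<^esub> f x" if s: "s \<in> carrier S" for s
    proof -
      have "i1 (s \<odot>\<^bsub>M1\<^esub> x) = s \<odot>\<^bsub>?V1\<^esub> i1 x" using s by (simp add: i1_def direct_sum_simps)
      then have "\<psi> (g (i1 (s \<odot>\<^bsub>M1\<^esub> x))) = s \<odot>\<^bsub>?V\<^esub> \<psi> (g (i1 x))"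
        using psi gi[OF x] gD(3)[OF s i1c(1)[OF x]] s unfolding V.isometry_def by simp
      then show ?thesis using fx(1)[OF x] fx(1)[OF M1.smult_closed[OF s x]] by (simp add: direct_sum_simps)
    qed
  qed
  have "h2 (f x) (f y) = h1 x y" if x: "x \<in> carrier M1" and y: "y \<in> carrier M1" for x y
  proof -
    have "h2 (f x) (f y) = ?k (\<psi> (g (i1 x))) (\<psi> (g (i1 y)))"
      unfolding fx(1)[OF x] fx(1)[OF y] using formD(2)[OF f2 fx(2)[OF x] fx(2)[OF y]]
      by (simp add: orthogonal_sum_def hyp_zero)
    also have "\<dots> = ?k (g (i1 x)) (g (i1 y))"
      using psi gi[OF x] gi[OF y] unfolding V.isometry_def by simp
    also have "\<dots> = h1 x y"
      unfolding gk[OF i1c(1)[OF x] i1c(1)[OF y]] using formD(2)[OF f1 x y]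
      by (simp add: i1_def orthogonal_sum_def hyp_zero)
    finally show ?thesis .
  qed
  then show ?thesis unfolding isometric_def using fh fb by (intro bexI[of _ f]) simp_all
qed

end


theorem mainTheorem8:
  fixes R :: "('r, 'a) ring_scheme"
    and S :: "('r, 's, 'b) module_scheme"
    and \<sigma> :: "'s \<Rightarrow> 's"
    and M1 :: "('s, 'm1, 'c1) module_scheme" and h1 :: "'m1 \<Rightarrow> 'm1 \<Rightarrow> 's"
    and M2 :: "('s, 'm2, 'c2) module_scheme" and h2 :: "'m2 \<Rightarrow> 'm2 \<Rightarrow> 's"
    and M3 :: "('s, 'm3, 'c3) module_scheme" and h3 :: "'m3 \<Rightarrow> 'm3 \<Rightarrow> 's"
  assumes "LG_ring R"
    and "quadratic_etale R S"
    and "standard_involution R S \<sigma>"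
    and "hermitian_space S \<sigma> M1 h1"
    and "hermitian_space S \<sigma> M2 h2"
    and "hermitian_space S \<sigma> M3 h3"
    and "isometric S (direct_sum M1 M3) (orthogonal_sum S h1 h3)
                     (direct_sum M2 M3) (orthogonal_sum S h2 h3)"
  shows "isometric S M1 h1 M2 h2"
proof -
  interpret etale_involution R S "\<lambda>r. r \<odot>\<^bsub>S\<^esub> \<one>\<^bsub>S\<^esub>" \<sigma>
    by (rule quadratic_etale_involution[OF assms(2,3)])
  have "algebra R S" "fg_projective R S"
    using assms(2) unfolding quadratic_etale_def projective_of_rank_def by simp_all
  then obtain N \<xi> gg where db: "dual_basis N \<xi> gg" by (rule dual_basis_exists)
  have f1: "hermitian_form S \<sigma> M1 h1" and f2: "hermitian_form S \<sigma> M2 h2"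
    using assms(4,5) unfolding hermitian_space_def by simp_all
  obtain n where "isometric S (direct_sum M1 (Fr n)) (orthogonal_sum S h1 (hyp n))
      (direct_sum M2 (Fr n)) (orthogonal_sum S h2 (hyp n))"
    by (rule isometric_add_hyperbolic[OF f1 f2 assms(6,7)])
  then show ?thesis by (rule cancel_hyperbolic[OF assms(1) db f1 f2])
qed

end
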